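(* Assume condition (NonRev): $B>0$, $R_{\widehat{\mathfrak q}}(k,k+1)>0$ for all $k\in\mathbb Z$, and $R_{\widehat{\mathfrak q}}(j,j-1)=0$ for some $j\in\mathbb Z$. Let $\omega\in\mathcal P(\mathcal S_{\widehat{\mathfrak q}})$ be strictly positive and let $\mu=\sum_{\mathcal M\in\mathcal S_{\widehat{\mathfrak q}}}\omega(\mathcal M)\,\mu^{\widehat{\mathfrak q}}_{\mathcal M}\in\mathcal P(\mathbb T)$. Let $\mu_{\widehat{\mathfrak q},\epsilon}$ be the stationary state of the tilted generator $L_{\widehat{\mathfrak q},\epsilon}$ built from $\omega$ (see context). Then $\mu_{\widehat{\mathfrak q},\epsilon}$ converges weakly to $\mu$ as $\epsilon\to0$.
   Context: SETTING. $\mathbb T=[0,1)$ is the one-dimensional torus of length $1$. Standing assumptions: $a,b:\mathbb T\to\mathbb R$ are of class $C^2(\mathbb T)$; $a(x)\ge c_0>0$; $b$ vanishes at exactly finitely many points $x_1,\dots,x_{2N}$ ($N\ge1$), and $b'(x_j)\ne0$ for each $j$; $B=\int_{\mathbb T} b/a\,dx\ge0$. $L_\epsilon f=bf'+\epsilon a f''$, $f\in C^2(\mathbb T)$. $\mathcal P(\mathbb M)$ is the set of Borel probability measures on a metric space $\mathbb M$. HIERARCHICAL METASTABLE STRUCTURE. Regard $a,b$ as $1$-periodic functions on $\mathbb R$ and let $S(x)=-\int_0^x b(z)/a(z)\,dz$, $x\in\mathbb R$. The zeros of $b$ in $\mathbb R$ with $b'<0$ (local minima of $S$) are labelled $m_k$,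 $k\in\mathbb Z$, and those with $b'>0$ (local maxima of $S$) are labelled $\sigma_k$, with $m_{k+N}=m_k+1$, $\sigma_{k+N}=\sigma_k+1$ and, choosing the origin suitably (without loss of generality), $m_{-1}<0<\sigma_0<m_0<\dots<\sigma_{N-1}<m_{N-1}<1<\sigma_N$. For a local minimum $m$ put $\pi_1(\{m\})=\frac1{a(m)}\sqrt{\frac{2\pi}{S''(m)}}$. Level $1$: $\widetilde{\mathcal M}_1(k)=\{m_k\}$, $k\in\mathbb Z$, $\mathfrak u_1=N$. At level $q\ge1$ one has a family $\widetilde{\mathcal S}_q=\{\widetilde{\mathcal M}_q(k):k\in\mathbb Z\}$ of disjoint nonempty finite sets of local minima of $S$, ordered ($x<y$ for $x\in\widetilde{\mathcal M}_q(k)$, $y\in\widetilde{\mathcal M}_q(k+1)$), with $S$ constant on each $\widetilde{\mathcal M}_q(k)$ (common value $S(\widetilde{\mathcal M}_q(k))$), and $\widetilde{\mathcal M}_q(k+\mathfrak u_q)=\widetilde{\mathcal M}_q(k)+1$ where $\mathfrak u_q\ge1$ is the number of these sets up to integer translation. Let $m^-_{q,k}=\min\widetilde{\mathcal M}_q(k)$, $m^+_{q,k}=\max\widetilde{\mathcal M}_q(k)$; let $W^{(q)}_{k,k+1}$ be the set of points where $S$ attains its maximum on $[m^+_{q,k},m^-_{q,k+1}]$, and $S(W^{(q)}_{k,k+1})$ that maximum. Define $h^{q,+}_k=S(W^{(q)}_{k,k+1})-S(\widetilde{\mathcal M}_q(k))$, $h^{q,-}_k=S(W^{(q)}_{k-1,k})-S(\widetilde{\mathcal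 M}_q(k))$, $\mathfrak h_q=\min_{k\in\mathbb Z}\min\{h^{q,-}_k,h^{q,+}_k\}$, $\theta^{(q)}_\epsilon=e^{\mathfrak h_q/\epsilon}$, $\pi_q(k)=\sum_{m\in\widetilde{\mathcal M}_q(k)}\pi_1(\{m\})$, $\sigma_q(k,k+1)=\sum_{\sigma\in W^{(q)}_{k,k+1}}\sqrt{\frac{2\pi}{-S''(\sigma)}}$, and jump rates $R_q(k,k+1)=\frac{\mathbf 1\{h^{q,+}_k=\mathfrak h_q\}}{\pi_q(k)\sigma_q(k,k+1)}$, $R_q(k,k-1)=\frac{\mathbf 1\{h^{q,-}_k=\mathfrak h_q\}}{\pi_q(k)\sigma_q(k-1,k)}$. $\mathbb X_q$ is the continuous-time Markov chain on $\widetilde{\mathcal S}_q$ jumping from $\widetilde{\mathcal M}_q(k)$ to $\widetilde{\mathcal M}_q(k\pm1)$ at rate $R_q(k,k\pm1)$ (no other jumps). Recursion: if $\mathbb X_q$ has two or more closed irreducible classes (absorbing states count as such), the sets of level $q+1$ are the unions $\bigcup_{\widetilde{\mathcal M}\in\mathfrak R}\widetilde{\mathcal M}$, one for each closed irreducible class $\mathfrak R$ of $\mathbb X_q$, labelled increasingly by $\mathbb Z$ so that $\widetilde{\mathcal M}_{q+1}(0)$ contains the smallest nonnegative element of their union. (It is known that the stated structural properties persist from level to level.) The recursion stops at the first level $\mathfrak q$ at which $\mathbb X_{\mathfrak q}$ has one or no closed irreducible class. Projection: $\Pi(x)=x-\lfloor x\rfloor$, $\mathcal M_q(k)=\Pi(\widetilde{\mathcal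 M}_q(k))\subset\mathbb T$, $\mathcal S_q=\{\mathcal M_q(k):0\le k<\mathfrak u_q\}$. $\widehat{\mathbb X}_q=\Pi(\mathbb X_q)$ is the Markov chain on $\mathcal S_q$ with generator $(\widehat{\mathbb L}_qf)(\mathcal M_q(k))=\sum_{c=\pm1}R_q(k,k+c)[f(\mathcal M_q(k+c))-f(\mathcal M_q(k))]$ (indices modulo $\mathfrak u_q$). $\widehat{\mathfrak q}$ is the first integer $p\ge1$ such that $\widehat{\mathbb X}_p$ has a unique closed irreducible class; $\widehat{\mathfrak q}\le\mathfrak q$. For $\omega\in\mathcal P(\mathcal S_p)$, $\mathbb I^{(p)}(\omega)=\sup_H-\sum_{\mathcal M\in\mathcal S_p}\frac{(\widehat{\mathbb L}_pH)(\mathcal M)}{H(\mathcal M)}\omega(\mathcal M)$, over all $H:\mathcal S_p\to(0,\infty)$. $\mu^p_{\mathcal M_p(k)}=\frac1{\pi_p(k)}\sum_{m\in\widetilde{\mathcal M}_p(k)}\pi_1(\{m\})\,\delta_{\Pi(m)}\in\mathcal P(\mathbb T)$. WELLS. For $x\in\mathbb R$, $r>0$, $N(x,r)$ is the connected component of $\{y\in\mathbb R:S(y)<S(x)+r\}$ containing $x$ and $B(x,r)$ the open ball of radius $r$. Fix $\hat r>0$ with $B(m_k,\hat r)\subsetneq(0,1)$ for $0\le k\le N-1$. For $0<r<\mathfrak h_1\wedge\hat r$ let $\mathcal N_r(m_k)=\Pi(N(m_k,r)\cap B(m_k,r))$, $0\le k\le N-1$. Fix $0<r_0<\frac12(\mathfrak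 h_1\wedge\hat r)$ and $r\in(2r_0,\mathfrak h_1\wedge\hat r)$. For $0\le k<\mathfrak u_{\widehat{\mathfrak q}}$ let $\mathcal E(k)$, resp. $\mathcal N(k)$, be the union of the sets $\mathcal N_{r_0}(m)$, resp. $\mathcal N_r(m)$, over the minima $m$ (identified with points of $\mathbb T$) in $\mathcal M_{\widehat{\mathfrak q}}(k)$, and let $\zeta^k:\mathbb T\to\mathbb R$ be a smooth function with $\mathbf 1_{\mathcal E(k)}\le\zeta^k\le\mathbf 1_{\mathcal N(k)}$. TILTED DIFFUSION. Given strictly positive $\omega\in\mathcal P(\mathcal S_{\widehat{\mathfrak q}})$, let $\widehat h:\mathcal S_{\widehat{\mathfrak q}}\to(0,\infty)$ be an optimizer, unique up to a multiplicative constant, of the variational problem for $\mathbb I^{(\widehat{\mathfrak q})}(\omega)$: $\mathbb I^{(\widehat{\mathfrak q})}(\omega)=-\sum_{\mathcal M}\frac{(\widehat{\mathbb L}_{\widehat{\mathfrak q}}\widehat h)(\mathcal M)}{\widehat h(\mathcal M)}\omega(\mathcal M)$. Fix $\lambda>0$ and let $\phi_\epsilon\in C^2(\mathbb T)$ be the unique solution of $$(\lambda-\theta^{(\widehat{\mathfrak q})}_\epsilon L_\epsilon)\phi_\epsilon=\sum_{0\le k<\mathfrak u_{\widehat{\mathfrak q}}}[(\lambda-\widehat{\mathbb L}_{\widehat{\mathfrak q}})\widehat h](\mathcal M_{\widehat{\mathfrak q}}(k))\,\zeta^k .$$ For $\epsilon$ small enough $\phi_\epsilon$ is strictly positive (bounded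 below by a positive constant uniformly in small $\epsilon$). The tilted generator is $$(L_{\widehat{\mathfrak q},\epsilon}F)(x)=\Big\{b(x)+2\epsilon\,a(x)\frac{\phi_\epsilon'(x)}{\phi_\epsilon(x)}\Big\}F'(x)+\epsilon\,a(x)F''(x),$$ and $\mu_{\widehat{\mathfrak q},\epsilon}\in\mathcal P(\mathbb T)$ is its unique stationary state. *)

theory Defs
  imports "HOL-Probability.Probability"
begin

section \<open>The torus of length one\<close>

text \<open>Functions on the torus are 1-periodic functions on the reals. Points of the torus are the
  reals in \<open>{0..<1}\<close>, and the projection of the line onto the torus is \<^const>\<open>frac\<close>. The Borel
  sigma-algebra of the torus coincides with that of \<open>{0..<1}\<close> as a subset of the line, although
  the topologies differ; the torus topology enters through 1-periodic continuous functions.\<close>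

definition periodic1 :: "(real \<Rightarrow> real) \<Rightarrow> bool" where
  "periodic1 f \<longleftrightarrow> (\<forall>x. f (x + 1) = f x)"

definition C2_torus :: "(real \<Rightarrow> real) \<Rightarrow> bool" where
  "C2_torus f \<longleftrightarrow> periodic1 f \<and> (\<forall>x. f differentiable (at x)) \<and>
     (\<forall>x. deriv f differentiable (at x)) \<and> continuous_on UNIV (deriv (deriv f))"

definition smooth_torus :: "(real \<Rightarrow> real) \<Rightarrow> bool" where
  "smooth_torus f \<longleftrightarrow> periodic1 f \<and> (\<forall>n x. (deriv ^^ n) f differentiable (at x))"

definition torus_borel :: "real measure" where
  "torus_borel = restrict_space borel {0..<1}"

definition torus_prob :: "real measure \<Rightarrow> bool" where
  "torus_prob M \<longleftrightarrow> sets M = sets torus_borel \<and> prob_space M"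

definition weak_conv_torus :: "('i \<Rightarrow> real measure) \<Rightarrow> real measure \<Rightarrow> 'i filter \<Rightarrow> bool" where
  "weak_conv_torus M \<mu> \<F> \<longleftrightarrow>
     (\<forall>f. periodic1 f \<and> continuous_on UNIV f \<longrightarrow>
        ((\<lambda>i. \<integral>x. f x \<partial>(M i)) \<longlongrightarrow> (\<integral>x. f x \<partial>\<mu>)) \<F>)"

definition weighted_sum_measure :: "'i set \<Rightarrow> ('i \<Rightarrow> real) \<Rightarrow> ('i \<Rightarrow> real measure) \<Rightarrow> real measure" where
  "weighted_sum_measure I w \<nu> =
     measure_of (space torus_borel) (sets torus_borel)
       (\<lambda>A. \<Sum>i\<in>I. ennreal (w i) * emeasure (\<nu> i) A)"

section \<open>The coefficients, the potential and its critical points\<close>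

definition potential :: "(real \<Rightarrow> real) \<Rightarrow> (real \<Rightarrow> real) \<Rightarrow> real \<Rightarrow> real" where
  "potential a b x = - (LBINT z=ereal 0..ereal x. b z / a z)"

definition drift_integral :: "(real \<Rightarrow> real) \<Rightarrow> (real \<Rightarrow> real) \<Rightarrow> real" where
  "drift_integral a b = (LBINT z=ereal 0..ereal 1. b z / a z)"

definition admissible_coefficients :: "(real \<Rightarrow> real) \<Rightarrow> (real \<Rightarrow> real) \<Rightarrow> nat \<Rightarrow> bool" where
  "admissible_coefficients a b N \<longleftrightarrow>
     C2_torus a \<and> C2_torus b \<and> (\<exists>c0>0. \<forall>x. c0 \<le> a x) \<and>
     1 \<le> N \<and> card {x \<in> {0..<1}. b x = 0} = 2 * N \<and>
     (\<forall>x. b x = 0 \<longrightarrow> deriv b x \<noteq> 0) \<and> 0 \<le> drift_integral a b"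

text \<open>The last four inequalities express the choice of the origin on the torus.\<close>

definition critical_labelling ::
    "(real \<Rightarrow> real) \<Rightarrow> nat \<Rightarrow> (int \<Rightarrow> real) \<Rightarrow> (int \<Rightarrow> real) \<Rightarrow> bool" where
  "critical_labelling b N m \<sigma> \<longleftrightarrow>
     range m = {x. b x = 0 \<and> deriv b x < 0} \<and>
     range \<sigma> = {x. b x = 0 \<and> deriv b x > 0} \<and>
     (\<forall>k. \<sigma> k < m k \<and> m k < \<sigma> (k + 1)) \<and>
     (\<forall>k. m (k + int N) = m k + 1 \<and> \<sigma> (k + int N) = \<sigma> k + 1) \<and>
     m (-1) < 0 \<and> 0 < \<sigma> 0 \<and> m (int N - 1) < 1 \<and> 1 < \<sigma> (int N)"

definition weight1 :: "(real \<Rightarrow> real) \<Rightarrow> (real \<Rightarrow> real) \<Rightarrow> real \<Rightarrow> real" where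
  "weight1 a b x = 1 / a x * sqrt (2 * pi / deriv (deriv (potential a b)) x)"

section \<open>One level of the hierarchy\<close>

text \<open>Throughout this section \<open>F\<close> is the family of sets of local minima of one level, indexed
  by the integers.\<close>

definition num_classes :: "(int \<Rightarrow> real set) \<Rightarrow> nat" where
  "num_classes F = card (range (\<lambda>k. range (\<lambda>j::int. (\<lambda>x. x + of_int j) ` F k)))"

definition pot_value :: "(real \<Rightarrow> real) \<Rightarrow> (real \<Rightarrow> real) \<Rightarrow> (int \<Rightarrow> real set) \<Rightarrow> int \<Rightarrow> real" where
  "pot_value a b F k = potential a b (Min (F k))"

text \<open>\<open>gap F k\<close>, \<open>saddle_value a b F k\<close>, \<open>saddles a b F k\<close> and \<open>saddle_weight a b F k\<close>
  all refer to the passage between the sets number \<open>k\<close> and \<open>k + 1\<close>.\<close>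

definition gap :: "(int \<Rightarrow> real set) \<Rightarrow> int \<Rightarrow> real set" where
  "gap F k = {Max (F k)..Min (F (k + 1))}"

definition saddle_value :: "(real \<Rightarrow> real) \<Rightarrow> (real \<Rightarrow> real) \<Rightarrow> (int \<Rightarrow> real set) \<Rightarrow> int \<Rightarrow> real" where
  "saddle_value a b F k = (SUP x\<in>gap F k. potential a b x)"

definition saddles :: "(real \<Rightarrow> real) \<Rightarrow> (real \<Rightarrow> real) \<Rightarrow> (int \<Rightarrow> real set) \<Rightarrow> int \<Rightarrow> real set" where
  "saddles a b F k = {x \<in> gap F k. potential a b x = saddle_value a b F k}"

definition height_right :: "(real \<Rightarrow> real) \<Rightarrow> (real \<Rightarrow> real) \<Rightarrow> (int \<Rightarrow> real set) \<Rightarrow> int \<Rightarrow> real" where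
  "height_right a b F k = saddle_value a b F k - pot_value a b F k"

definition height_left :: "(real \<Rightarrow> real) \<Rightarrow> (real \<Rightarrow> real) \<Rightarrow> (int \<Rightarrow> real set) \<Rightarrow> int \<Rightarrow> real" where
  "height_left a b F k = saddle_value a b F (k - 1) - pot_value a b F k"

definition lowest_barrier :: "(real \<Rightarrow> real) \<Rightarrow> (real \<Rightarrow> real) \<Rightarrow> (int \<Rightarrow> real set) \<Rightarrow> real" where
  "lowest_barrier a b F = (INF k. min (height_left a b F k) (height_right a b F k))"

definition time_scale :: "(real \<Rightarrow> real) \<Rightarrow> (real \<Rightarrow> real) \<Rightarrow> (int \<Rightarrow> real set) \<Rightarrow> real \<Rightarrow> real" where
  "time_scale a b F \<epsilon> = exp (lowest_barrier a b F / \<epsilon>)"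

definition well_weight :: "(real \<Rightarrow> real) \<Rightarrow> (real \<Rightarrow> real) \<Rightarrow> (int \<Rightarrow> real set) \<Rightarrow> int \<Rightarrow> real" where
  "well_weight a b F k = (\<Sum>x\<in>F k. weight1 a b x)"

definition saddle_weight :: "(real \<Rightarrow> real) \<Rightarrow> (real \<Rightarrow> real) \<Rightarrow> (int \<Rightarrow> real set) \<Rightarrow> int \<Rightarrow> real" where
  "saddle_weight a b F k =
     (\<Sum>x\<in>saddles a b F k. sqrt (2 * pi / (- deriv (deriv (potential a b)) x)))"

definition rate :: "(real \<Rightarrow> real) \<Rightarrow> (real \<Rightarrow> real) \<Rightarrow> (int \<Rightarrow> real set) \<Rightarrow> int \<Rightarrow> int \<Rightarrow> real" where
  "rate a b F k l =
     (if l = k + 1 then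
        of_bool (height_right a b F k = lowest_barrier a b F)
          / (well_weight a b F k * saddle_weight a b F k)
      else if l = k - 1 then
        of_bool (height_left a b F k = lowest_barrier a b F)
          / (well_weight a b F k * saddle_weight a b F (k - 1))
      else 0)"

section \<open>Closed irreducible classes and the recursion\<close>

text \<open>\<open>X\<close> is the state space of a chain and \<open>E\<close> the set of pairs of states between which the chain
  jumps with positive rate.\<close>

definition closed_irreducible :: "'s set \<Rightarrow> ('s \<times> 's) set \<Rightarrow> 's set \<Rightarrow> bool" where
  "closed_irreducible X E C \<longleftrightarrow> C \<subseteq> X \<and> C \<noteq> {} \<and> (\<forall>x\<in>C. E\<^sup>* `` {x} = C)"

definition chain_jumps ::
    "(real \<Rightarrow> real) \<Rightarrow> (real \<Rightarrow> real) \<Rightarrow> (int \<Rightarrow> real set) \<Rightarrow> (real set \<times> real set) set" where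
  "chain_jumps a b F = {(F k, F l) |k l. 0 < rate a b F k l}"

text \<open>The labelling \<open>G\<close> below exists and is unique as long as the chain of level \<open>F\<close> has at least
  two closed irreducible classes. Once it has fewer, the recursion has stopped and the value of
  \<open>next_level\<close> is irrelevant: \<open>final_level\<close> below never exceeds the stopping level.\<close>

definition next_level ::
    "(real \<Rightarrow> real) \<Rightarrow> (real \<Rightarrow> real) \<Rightarrow> (int \<Rightarrow> real set) \<Rightarrow> int \<Rightarrow> real set" where
  "next_level a b F = (THE G.
     range G = {\<Union>C |C. closed_irreducible (range F) (chain_jumps a b F) C} \<and>
     (\<forall>k. \<forall>x\<in>G k. \<forall>y\<in>G (k + 1). x < y) \<and>
     (\<exists>z\<in>G 0. 0 \<le> z \<and> (\<forall>y\<in>\<Union>(range G). 0 \<le> y \<longrightarrow> z \<le> y)))"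

text \<open>Levels are numbered from one; level zero is a dummy.\<close>

fun level :: "(real \<Rightarrow> real) \<Rightarrow> (real \<Rightarrow> real) \<Rightarrow> (int \<Rightarrow> real) \<Rightarrow> nat \<Rightarrow> int \<Rightarrow> real set" where
  "level a b m 0 = (\<lambda>k. {})"
| "level a b m (Suc 0) = (\<lambda>k. {m k})"
| "level a b m (Suc (Suc q)) = next_level a b (level a b m (Suc q))"

section \<open>The projected chain\<close>

definition proj_set :: "(int \<Rightarrow> real set) \<Rightarrow> int \<Rightarrow> real set" where
  "proj_set F k = frac ` F k"

definition proj_states :: "(int \<Rightarrow> real set) \<Rightarrow> real set set" where
  "proj_states F = proj_set F ` {0..<int (num_classes F)}"

definition proj_jumps ::
    "(real \<Rightarrow> real) \<Rightarrow> (real \<Rightarrow> real) \<Rightarrow> (int \<Rightarrow> real set) \<Rightarrow> (real set \<times> real set) set" where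
  "proj_jumps a b F = {(proj_set F k, proj_set F l) |k l. 0 < rate a b F k l}"

definition final_level :: "(real \<Rightarrow> real) \<Rightarrow> (real \<Rightarrow> real) \<Rightarrow> (int \<Rightarrow> real) \<Rightarrow> nat" where
  "final_level a b m = (LEAST p. 1 \<le> p \<and>
     (\<exists>!C. closed_irreducible (proj_states (level a b m p)) (proj_jumps a b (level a b m p)) C))"

text \<open>\<open>proj_gen a b F f k\<close> is the generator applied to \<open>f\<close>, evaluated at the state
  \<open>proj_set F k\<close>. Reducing indices modulo \<open>num_classes F\<close> is implicit, because \<open>proj_set F\<close> is
  periodic with that period.\<close>

definition proj_gen ::
    "(real \<Rightarrow> real) \<Rightarrow> (real \<Rightarrow> real) \<Rightarrow> (int \<Rightarrow> real set) \<Rightarrow> (real set \<Rightarrow> real) \<Rightarrow> int \<Rightarrow> real" where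
  "proj_gen a b F f k =
     (\<Sum>c\<in>{1, -1}. rate a b F k (k + c) * (f (proj_set F (k + c)) - f (proj_set F k)))"

definition dv_objective ::
    "(real \<Rightarrow> real) \<Rightarrow> (real \<Rightarrow> real) \<Rightarrow> (int \<Rightarrow> real set) \<Rightarrow> real set pmf \<Rightarrow> (real set \<Rightarrow> real) \<Rightarrow> real" where
  "dv_objective a b F \<omega> H =
     - (\<Sum>k\<in>{0..<int (num_classes F)}.
          proj_gen a b F H k / H (proj_set F k) * pmf \<omega> (proj_set F k))"

definition dv_rate ::
    "(real \<Rightarrow> real) \<Rightarrow> (real \<Rightarrow> real) \<Rightarrow> (int \<Rightarrow> real set) \<Rightarrow> real set pmf \<Rightarrow> ereal" where
  "dv_rate a b F \<omega> =
     (SUP H\<in>{H. \<forall>A\<in>proj_states F. 0 < H A}. ereal (dv_objective a b F \<omega> H))"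

definition dv_optimizer ::
    "(real \<Rightarrow> real) \<Rightarrow> (real \<Rightarrow> real) \<Rightarrow> (int \<Rightarrow> real set) \<Rightarrow> real set pmf \<Rightarrow> (real set \<Rightarrow> real) \<Rightarrow> bool" where
  "dv_optimizer a b F \<omega> h \<longleftrightarrow>
     (\<forall>A\<in>proj_states F. 0 < h A) \<and> dv_rate a b F \<omega> = ereal (dv_objective a b F \<omega> h)"

definition well_measure ::
    "(real \<Rightarrow> real) \<Rightarrow> (real \<Rightarrow> real) \<Rightarrow> (int \<Rightarrow> real set) \<Rightarrow> int \<Rightarrow> real measure" where
  "well_measure a b F k =
     weighted_sum_measure (F k) (\<lambda>x. weight1 a b x / well_weight a b F k)
       (\<lambda>x. return torus_borel (frac x))"

definition mixture_measure ::
    "(real \<Rightarrow> real) \<Rightarrow> (real \<Rightarrow> real) \<Rightarrow> (int \<Rightarrow> real set) \<Rightarrow> real set pmf \<Rightarrow> real measure" where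
  "mixture_measure a b F \<omega> =
     weighted_sum_measure {0..<int (num_classes F)} (\<lambda>k. pmf \<omega> (proj_set F k)) (well_measure a b F)"

section \<open>Wells\<close>

definition local_well :: "(real \<Rightarrow> real) \<Rightarrow> (real \<Rightarrow> real) \<Rightarrow> real \<Rightarrow> real \<Rightarrow> real set" where
  "local_well a b r x =
     frac ` (connected_component_set {y. potential a b y < potential a b x + r} x \<inter> ball x r)"

text \<open>The minima in \<open>proj_set F k\<close> are represented by their copies in the unit interval.\<close>

definition well_union ::
    "(real \<Rightarrow> real) \<Rightarrow> (real \<Rightarrow> real) \<Rightarrow> (int \<Rightarrow> real set) \<Rightarrow> real \<Rightarrow> int \<Rightarrow> real set" where
  "well_union a b F r k = (\<Union>x\<in>proj_set F k. local_well a b r x)"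

section \<open>Generators of diffusions on the torus\<close>

definition diff_gen :: "(real \<Rightarrow> real) \<Rightarrow> (real \<Rightarrow> real) \<Rightarrow> real \<Rightarrow> (real \<Rightarrow> real) \<Rightarrow> real \<Rightarrow> real" where
  "diff_gen a b \<epsilon> f x = b x * deriv f x + \<epsilon> * a x * deriv (deriv f) x"

definition tilted_gen ::
    "(real \<Rightarrow> real) \<Rightarrow> (real \<Rightarrow> real) \<Rightarrow> real \<Rightarrow> (real \<Rightarrow> real) \<Rightarrow> (real \<Rightarrow> real) \<Rightarrow> real \<Rightarrow> real" where
  "tilted_gen a b \<epsilon> \<phi> f x =
     (b x + 2 * \<epsilon> * a x * (deriv \<phi> x / \<phi> x)) * deriv f x + \<epsilon> * a x * deriv (deriv f) x"

definition stationary_state :: "((real \<Rightarrow> real) \<Rightarrow> real \<Rightarrow> real) \<Rightarrow> real measure \<Rightarrow> bool" where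
  "stationary_state L \<mu> \<longleftrightarrow>
     torus_prob \<mu> \<and> (\<forall>f. C2_torus f \<longrightarrow> (\<integral>x. L f x \<partial>\<mu>) = 0)"

definition resolvent_solution ::
    "(real \<Rightarrow> real) \<Rightarrow> (real \<Rightarrow> real) \<Rightarrow> (int \<Rightarrow> real set) \<Rightarrow> (int \<Rightarrow> real \<Rightarrow> real) \<Rightarrow> (real set \<Rightarrow> real)
      \<Rightarrow> real \<Rightarrow> real \<Rightarrow> (real \<Rightarrow> real) \<Rightarrow> bool" where
  "resolvent_solution a b F \<zeta> h lam \<epsilon> \<phi> \<longleftrightarrow>
     C2_torus \<phi> \<and>
     (\<forall>x. lam * \<phi> x - time_scale a b F \<epsilon> * diff_gen a b \<epsilon> \<phi> x =
        (\<Sum>k\<in>{0..<int (num_classes F)}.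
           (lam * h (proj_set F k) - proj_gen a b F h k) * \<zeta> k x))"

end

theory Submission
  imports Defs
begin

text \<open>Write \<open>S\<close> for the potential, so that \<open>S (x + 1) = S x - B\<close>, and \<open>\<theta>\<close> for the time scale. On the circle the
  equation \<open>\<theta> L g = v\<close> can be integrated explicitly: \<open>g' s\<close> is a multiple close to one of
  \<open>1/\<epsilon>\<close> times the integral of \<open>v y * exp ((S s - S y - \<hh>) / \<epsilon>) / a y\<close> over \<open>s - 1 \<le> y \<le> s\<close>. Under (NonRev) the
  exponent is nonpositive for \<open>y \<le> s\<close> and vanishes only if \<open>s\<close> is a saddle of some passage from \<open>k\<close> to \<open>k + 1\<close>
  and \<open>y\<close> a minimum in a set \<open>j \<le> k\<close> of the same depth. Laplace's method thus gives the increments of \<open>g\<close> between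
  neighbouring wells, and these say that the values of \<open>g\<close> on the wells solve the equation of the
  limiting chain with right-hand side the mean of \<open>v\<close> over each well.

  Applied to \<open>\<phi> \<epsilon>\<close>, this and the maximum principle give \<open>\<phi> \<epsilon> \<rightarrow> h\<close> on the wells and a positive lower
  bound. For the measure \<open>\<nu> = M \<epsilon> / \<phi> \<epsilon>\<close>, stationarity tested with \<open>g / \<phi> \<epsilon>\<close> reads
  \<open>\<nu> (\<theta> L g) = \<nu> ((lam - G / \<phi> \<epsilon>) g)\<close>, where \<open>G\<close> is the right-hand side of the resolvent equation. Taking for \<open>g\<close> solutions of
  Poisson equations shows that \<open>\<nu>\<close> concentrates on the wells with the profile of the well measures, and that
  its weights multiplied by \<open>h\<close> are asymptotically stationary for the chain tilted by \<open>h\<close>. The optimality of \<open>h\<close>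
  says that \<open>\<omega>\<close> is stationary for that chain, and the stationary state is unique.\<close>

section \<open>Periodic functions\<close>

text \<open>The bound on the exponent concerns every y to the left of s, also near minima lost at
  earlier levels. So the recursion has to keep track of discarded minima, and the structural
  properties of the levels are derived together with that invariant. A second obstacle is that the
  equation for \<phi> \<epsilon> has the unknown function in its own right-hand side lam * \<phi>
  \<epsilon> - G: its values on the wells are not known to converge beforehand. Laplace's method is
  therefore carried out for right-hand sides that are merely close, near each minimum, to constants
  moving with \<epsilon>; the outcome is an approximate resolvent equation for the chain, and the
  maximum principle of the chain yields convergence. Thirdly, on the circle a Poisson equation is
  solvable only after subtracting a constant. Summing the increments over one period shows that this
  constant vanishes as \<epsilon> tends to 0 whenever the means over the wells lie in the range of
  the limiting generator. Dividing by \<phi> \<epsilon> converts the tilted generator back into L,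
  so the explicit kernel of L suffices.\<close>

definition primitive :: "(real \<Rightarrow> real) \<Rightarrow> real \<Rightarrow> real" where
  "primitive f x = (LBINT z=ereal 0..ereal x. f z)"

lemma primitive_has_derivative:
  assumes "continuous_on UNIV f"
  shows "(primitive f has_real_derivative f x) (at x)"
proof -
  define K where "K = \<bar>x\<bar> + 1"
  have "((\<lambda>u. LBINT y=0..u. f y) has_vector_derivative f x) (at x within {-K..K})"
    using interval_integral_FTC2[of "-K" 0 K f x] continuous_on_subset[OF assms]
    by (auto simp: K_def zero_ereal_def)
  moreover have "x \<in> interior {-K..K}"
    by (auto simp: K_def interior_atLeastAtMost_real)
  ultimately have "((\<lambda>u. LBINT y=0..u. f y) has_vector_derivative f x) (at x)"
    by (metis at_within_interior)
  then show ?thesis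
    by (simp add: has_real_derivative_iff_has_vector_derivative primitive_def[abs_def] zero_ereal_def)
qed

lemma primitive_0 [simp]: "primitive f 0 = 0"
  by (simp add: primitive_def)

lemma primitive_diff_eq_integral:
  assumes "continuous_on UNIV f" "p \<le> q"
  shows "(f has_integral primitive f q - primitive f p) {p..q}"
  by (rule fundamental_theorem_of_calculus[OF assms(2)])
    (auto simp flip: has_real_derivative_iff_has_vector_derivative
      intro: has_field_derivative_at_within primitive_has_derivative assms)

lemma periodic1_of_int:
  assumes "periodic1 f"
  shows "f (x + of_int n) = f x"
proof (induction n rule: int_induct[where k = 0])
  case (step1 i)
  then show ?case using assms by (simp add: periodic1_def flip: add.assoc)
next
  case (step2 i)
  have "f (x + of_int (i - 1) + 1) = f (x + of_int (i - 1))"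
    using assms unfolding periodic1_def by blast
  then show ?case using step2 by simp
qed simp

lemma periodic1_frac:
  assumes "periodic1 f"
  shows "f (frac x) = f x"
  using periodic1_of_int[OF assms, of x "- \<lfloor>x\<rfloor>"] by (simp add: frac_def)

lemma periodic1_deriv:
  assumes "periodic1 f"
  shows "periodic1 (deriv f)"
proof -
  have *: "(\<lambda>x. f (x + 1)) = f" using assms by (auto simp: periodic1_def)
  have "deriv f (x + 1) = deriv f x" for x
  proof -
    have "(f has_field_derivative D) (at (x + 1)) \<longleftrightarrow> (f has_field_derivative D) (at x)" for D
      using DERIV_shift[of f D x 1] * by simp
    then show ?thesis by (simp add: deriv_def)
  qed
  then show ?thesis by (simp add: periodic1_def)
qed

lemma periodic1_bounded:
  fixes f :: "real \<Rightarrow> real"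
  assumes "periodic1 f" "continuous_on UNIV f"
  shows "\<exists>C>0. \<forall>x. \<bar>f x\<bar> \<le> C"
proof -
  have "bounded (f ` {0..1})"
    by (intro compact_imp_bounded compact_continuous_image continuous_on_subset[OF assms(2)]) auto
  then obtain C where C: "C > 0" "\<forall>x\<in>{0..1}. \<bar>f x\<bar> \<le> C"
    unfolding bounded_pos by auto
  have "\<bar>f x\<bar> \<le> C" for x
    using C(2)[rule_format, of "frac x"] frac_lt_1[of x] periodic1_frac[OF assms(1), of x] by force
  then show ?thesis using C(1) by blast
qed

lemma periodic1_attains_max:
  fixes f :: "real \<Rightarrow> real"
  assumes "periodic1 f" "continuous_on UNIV f"
  shows "\<exists>x. \<forall>y. f y \<le> f x"
proof -
  obtain x where "\<forall>y\<in>{0..1}. f y \<le> f x"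
    using continuous_attains_sup[of "{0..1}" f] continuous_on_subset[OF assms(2)] by auto
  then have "f y \<le> f x" for y
    using periodic1_frac[OF assms(1), of y] frac_lt_1[of y] frac_ge_0[of y]
    by (metis atLeastAtMost_iff less_imp_le)
  then show ?thesis by blast
qed

lemma C2_torusD:
  assumes "C2_torus f"
  shows "periodic1 f" "(f has_real_derivative deriv f x) (at x)"
    "(deriv f has_real_derivative deriv (deriv f) x) (at x)"
    "continuous_on UNIV f" "continuous_on UNIV (deriv f)" "continuous_on UNIV (deriv (deriv f))"
proof -
  show "periodic1 f" and 1: "(f has_real_derivative deriv f x) (at x)"
    and 2: "(deriv f has_real_derivative deriv (deriv f) x) (at x)"
    and "continuous_on UNIV (deriv (deriv f))" for x
    using assms by (auto simp: C2_torus_def DERIV_deriv_iff_real_differentiable)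
  show "continuous_on UNIV f"
    by (rule DERIV_continuous_on, rule has_field_derivative_at_within, rule 1)
  show "continuous_on UNIV (deriv f)"
    by (rule DERIV_continuous_on, rule has_field_derivative_at_within, rule 2)
qed

lemma C2_torusI:
  assumes "periodic1 f" "\<And>x. (f has_real_derivative f1 x) (at x)"
    "\<And>x. (f1 has_real_derivative f2 x) (at x)" "continuous_on UNIV f2"
  shows "C2_torus f" "deriv f = f1" "deriv (deriv f) = f2"
proof -
  show 1: "deriv f = f1" using assms(2) DERIV_imp_deriv by blast
  show 2: "deriv (deriv f) = f2" unfolding 1 using assms(3) DERIV_imp_deriv by blast
  show "C2_torus f"
    using assms unfolding C2_torus_def 1 2[unfolded 1]
    by (auto simp: real_differentiable_def)
qed

lemma C2_torus_attains_max:
  assumes "C2_torus f"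
  shows "\<exists>x. (\<forall>y. f y \<le> f x) \<and> deriv f x = 0 \<and> deriv (deriv f) x \<le> 0"
proof -
  note D = C2_torusD[OF assms]
  obtain x where x: "\<forall>y. f y \<le> f x" using periodic1_attains_max[OF D(1,4)] by blast
  have 0: "deriv f x = 0"
    using DERIV_local_max[OF D(2), of 1 x] x by auto
  \<comment> \<open>A positive second derivative would make f' positive just to the right of x, and
    f would exceed its maximum there.\<close>
  have "deriv (deriv f) x \<le> 0"
  proof (rule ccontr)
    assume "\<not> ?thesis"
    then obtain d where d: "d > 0" "\<forall>h>0. h < d \<longrightarrow> deriv f x < deriv f (x + h)"
      using DERIV_pos_inc_right[OF D(3)[of x]] by (auto simp: not_le)
    obtain z where z: "x < z" "z < x + d/2" "f (x + d/2) - f x = d/2 * deriv f z"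
      using MVT2[of x "x + d/2" f "deriv f"] D(2) d(1) by auto
    have "deriv f z > 0" using d(2)[rule_format, of "z - x"] z d 0 by auto
    then have "f (x + d/2) > f x" using z(3) d(1)
      by (smt (verit, best) divide_pos_pos mult_pos_pos)
    then show False using x by (metis not_le)
  qed
  then show ?thesis using x 0 by blast
qed

text \<open>Half of the Taylor coefficient D/2 is given up so that the bound holds on a whole
  neighbourhood. The second derivative is required at x alone: the difference quotient of f' exceeds
  D/2 nearby, and the mean value theorem is applied to f minus the parabola.\<close>

lemma quadratic_bound_at_critical_point:
  fixes f :: "real \<Rightarrow> real"
  assumes f': "\<And>y. (f has_real_derivative f' y) (at y)" and f'': "(f' has_real_derivative D) (at x)"
    and "f' x = 0" "D > 0"
  shows "\<exists>e>0. \<forall>y. \<bar>y - x\<bar> \<le> e \<longrightarrow> f y - f x \<ge> D/4 * (y - x)^2"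
proof -
  have "((\<lambda>y. (f' y - f' x) / (y - x)) \<longlongrightarrow> D) (at x)"
    using f'' by (simp add: has_field_derivative_iff)
  then have "eventually (\<lambda>y. (f' y - f' x) / (y - x) > D/2) (at x)"
    using assms(4) by (intro order_tendstoD) auto
  then obtain d where d: "d > 0" "\<forall>y. y \<noteq> x \<and> dist y x < d \<longrightarrow> f' y / (y - x) > D/2"
    using \<open>f' x = 0\<close> by (auto simp: eventually_at)
  define q where "q = (\<lambda>y. f y - f x - D/4*(y-x)^2)"
  have q': "(q has_real_derivative f' y - D/2*(y-x)) (at y)" for y
    unfolding q_def by (auto intro!: derivative_eq_intros f')
  have "q y \<ge> 0" if "\<bar>y - x\<bar> \<le> d/2" for y
  proof (cases y x rule: linorder_cases)
    case greater
    then obtain z where z: "x < z" "z < y" "q y - q x = (y - x) * (f' z - D/2*(z-x))"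
      using MVT2[OF greater, of q "\<lambda>y. f' y - D/2*(y-x)"] q' by auto
    have "f' z / (z - x) > D/2" using d z that by (auto simp: dist_real_def)
    then have "f' z - D/2*(z-x) > 0" using z by (simp add: field_simps)
    then show ?thesis using z greater by (simp add: q_def)
  next
    case less
    then obtain z where z: "y < z" "z < x" "q x - q y = (x - y) * (f' z - D/2*(z-x))"
      using MVT2[OF less, of q "\<lambda>y. f' y - D/2*(y-x)"] q' by auto
    have "f' z / (z - x) > D/2" using d z that by (auto simp: dist_real_def)
    then have "f' z - D/2*(z-x) < 0" using z by (simp add: field_simps)
    then have "q x - q y < 0" using z(3) less by (simp add: mult_pos_neg)
    then show ?thesis by (simp add: q_def)
  qed (simp add: q_def)
  then show ?thesis using d(1) by (intro exI[of _ "d/2"]) (auto simp: q_def)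
qed

section \<open>The potential landscape\<close>

locale landscape =
  fixes a b :: "real \<Rightarrow> real" and N :: nat and m \<sigma> :: "int \<Rightarrow> real"
  assumes coefficients: "admissible_coefficients a b N"
    and labelling: "critical_labelling b N m \<sigma>"
begin

abbreviation S :: "real \<Rightarrow> real" where "S \<equiv> potential a b"
abbreviation B :: real where "B \<equiv> drift_integral a b"

definition Mins :: "real set" where "Mins = {x. b x = 0 \<and> deriv b x < 0}"
definition Maxs :: "real set" where "Maxs = {x. b x = 0 \<and> deriv b x > 0}"

text \<open>The second derivative of S. At a zero of b only -b'/a remains, so its sign there is
  opposite to that of b'.\<close>

definition S2 :: "real \<Rightarrow> real" where "S2 x = - ((deriv b x * a x - b x * deriv a x) / (a x * a x))"

lemma a_C2: "C2_torus a" and b_C2: "C2_torus b" and N_pos: "1 \<le> N" and B_nonneg: "0 \<le> B"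
  and simple_zeros: "b x = 0 \<Longrightarrow> deriv b x \<noteq> 0"
  using coefficients by (auto simp: admissible_coefficients_def)

lemma a_lower: "\<exists>c0>0. \<forall>x. c0 \<le> a x"
  using coefficients by (auto simp: admissible_coefficients_def)

lemma a_pos: "0 < a x"
  using a_lower by (meson less_le_trans)

lemma cont_drift: "continuous_on UNIV (\<lambda>x. b x / a x)"
  using C2_torusD(4)[OF a_C2] C2_torusD(4)[OF b_C2] a_pos
  by (intro continuous_intros) (auto simp: less_imp_neq[symmetric])

lemma S_eq: "S x = - primitive (\<lambda>x. b x / a x) x" and B_eq: "B = primitive (\<lambda>x. b x / a x) 1"
  by (auto simp: potential_def primitive_def drift_integral_def)

lemma S_deriv: "(S has_real_derivative - (b x / a x)) (at x)"
  unfolding S_eq[abs_def] by (intro DERIV_minus primitive_has_derivative cont_drift)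

lemma S_cont: "continuous_on A S"
  by (rule DERIV_continuous_on, rule has_field_derivative_at_within, rule S_deriv)

lemma deriv_S: "deriv S = (\<lambda>x. - (b x / a x))"
  using S_deriv DERIV_imp_deriv by blast

lemma S_deriv2: "((\<lambda>x. - (b x / a x)) has_real_derivative S2 x) (at x)"
  unfolding S2_def using a_pos[of x]
  by (auto intro!: derivative_eq_intros C2_torusD(2)[OF a_C2] C2_torusD(2)[OF b_C2])

lemma deriv2_S: "deriv (deriv S) = S2"
  unfolding deriv_S using S_deriv2 DERIV_imp_deriv by blast

lemma a_periodic: "a (x + of_int n) = a x" and b_periodic: "b (x + of_int n) = b x"
  using periodic1_of_int C2_torusD(1) a_C2 b_C2 by blast+

lemma deriv_b_periodic: "deriv b (x + of_int n) = deriv b x"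
  and deriv_a_periodic: "deriv a (x + of_int n) = deriv a x"
  using periodic1_of_int periodic1_deriv C2_torusD(1) a_C2 b_C2 by blast+

lemma S2_periodic: "S2 (x + of_int n) = S2 x"
  by (simp add: S2_def a_periodic b_periodic deriv_a_periodic deriv_b_periodic)

lemma S_shift1: "S (x + 1) = S x - B"
proof -
  have "((\<lambda>x. S (x + 1) - S x) has_real_derivative 0) (at x)" for x
  proof -
    have "((\<lambda>x. S (x + 1)) has_real_derivative - (b x / a x)) (at x)"
      using S_deriv[of "x + 1"] DERIV_shift[of S "- (b x / a x)" x 1]
        a_periodic[of x 1] b_periodic[of x 1] by simp
    from DERIV_diff[OF this S_deriv] show ?thesis by simp
  qed
  then have "S (x + 1) - S x = S (0 + 1) - S 0"
    by (intro DERIV_isconst_all) auto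
  then show ?thesis by (simp add: S_eq B_eq)
qed

lemma S_shift: "S (x + of_int n) = S x - of_int n * B"
proof (induction n rule: int_induct[where k = 0])
  case (step1 i)
  then show ?case using S_shift1[of "x + of_int i"] by (simp add: algebra_simps)
next
  case (step2 i)
  then show ?case using S_shift1[of "x + of_int (i - 1)"] by (simp add: algebra_simps)
qed simp

lemma Mins_shift: "x + of_int n \<in> Mins \<longleftrightarrow> x \<in> Mins"
  by (simp add: Mins_def b_periodic deriv_b_periodic)

lemma range_m: "range m = Mins" and range_\<sigma>: "range \<sigma> = Maxs"
  and m_\<sigma>: "\<sigma> k < m k" "m k < \<sigma> (k + 1)" and m_shift: "m (k + int N) = m k + 1"
  using labelling by (auto simp: critical_labelling_def Mins_def Maxs_def)

lemma finite_zeros: "finite {x \<in> {p..q}. b x = 0}"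
proof -
  have "card {x \<in> {0..<1}. b x = 0} = 2 * N"
    using coefficients by (auto simp: admissible_coefficients_def)
  \<comment> \<open>Infinite sets have cardinality 0, so a positive cardinality implies
    finiteness.\<close>
  then have fin: "finite {x \<in> {0..<1}. b x = 0}" using N_pos by (intro card_ge_0_finite) linarith
  have "{x \<in> {p..q}. b x = 0} \<subseteq> (\<Union>n\<in>{\<lfloor>p\<rfloor>..\<lfloor>q\<rfloor>}. (\<lambda>x. x + of_int n) ` {x \<in> {0..<1}. b x = 0})"
  proof
    fix x assume x: "x \<in> {x \<in> {p..q}. b x = 0}"
    have "b (frac x) = 0" using x b_periodic[of x "- \<lfloor>x\<rfloor>"] by (simp add: frac_def)
    then have "x \<in> (\<lambda>y. y + of_int \<lfloor>x\<rfloor>) ` {x \<in> {0..<1}. b x = 0}"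
      by (intro image_eqI[of _ _ "frac x"]) (auto simp: frac_lt_1, simp add: frac_def)
    moreover have "\<lfloor>x\<rfloor> \<in> {\<lfloor>p\<rfloor>..\<lfloor>q\<rfloor>}" using x by (auto intro: floor_mono)
    ultimately show "x \<in> (\<Union>n\<in>{\<lfloor>p\<rfloor>..\<lfloor>q\<rfloor>}. (\<lambda>x. x + of_int n) ` {x \<in> {0..<1}. b x = 0})" by blast
  qed
  then show ?thesis using fin by (auto intro: finite_subset)
qed

lemma finite_Mins: "finite (Mins \<inter> {p..q})" and finite_Maxs: "finite (Maxs \<inter> {p..q})"
  by (auto intro!: finite_subset[OF _ finite_zeros[of p q]] simp: Mins_def Maxs_def)

lemma S2_Mins: "x \<in> Mins \<Longrightarrow> S2 x > 0" and S2_Maxs: "x \<in> Maxs \<Longrightarrow> S2 x < 0"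
  using a_pos[of x] by (auto simp: S2_def Mins_def Maxs_def mult_neg_pos divide_neg_pos)

lemma Mins_quadratic:
  assumes "x \<in> Mins"
  shows "\<exists>e>0. \<forall>y. \<bar>y - x\<bar> \<le> e \<longrightarrow> S y - S x \<ge> S2 x / 4 * (y - x)^2"
  using assms S2_Mins[OF assms]
  by (intro quadratic_bound_at_critical_point[OF S_deriv S_deriv2]) (auto simp: Mins_def)

lemma Maxs_quadratic:
  assumes "x \<in> Maxs"
  shows "\<exists>e>0. \<forall>y. \<bar>y - x\<bar> \<le> e \<longrightarrow> S x - S y \<ge> - S2 x / 4 * (y - x)^2"
proof -
  have "\<exists>e>0. \<forall>y. \<bar>y - x\<bar> \<le> e \<longrightarrow> - S y - - S x \<ge> (- S2 x) / 4 * (y - x)^2"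
    using assms S2_Maxs[OF assms]
    by (intro quadratic_bound_at_critical_point[of "\<lambda>x. - S x" "\<lambda>x. - (- (b x / a x))"]
        DERIV_minus S_deriv S_deriv2) (auto simp: Maxs_def)
  then show ?thesis by simp
qed

lemma Mins_strict:
  assumes "x \<in> Mins"
  shows "\<exists>e>0. \<forall>y. y \<noteq> x \<and> \<bar>y - x\<bar> \<le> e \<longrightarrow> S x < S y"
proof -
  obtain e where e: "e > 0" "\<forall>y. \<bar>y - x\<bar> \<le> e \<longrightarrow> S y - S x \<ge> S2 x / 4 * (y - x)^2"
    using Mins_quadratic[OF assms] by blast
  have "S x < S y" if "y \<noteq> x" "\<bar>y - x\<bar> \<le> e" for y
  proof -
    have "S2 x / 4 * (y - x)^2 > 0" using S2_Mins[OF assms] that by simp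
    then show ?thesis using e(2) that by force
  qed
  then show ?thesis using e(1) by blast
qed

lemma Maxs_strict:
  assumes "x \<in> Maxs"
  shows "\<exists>e>0. \<forall>y. y \<noteq> x \<and> \<bar>y - x\<bar> \<le> e \<longrightarrow> S y < S x"
proof -
  obtain e where e: "e > 0" "\<forall>y. \<bar>y - x\<bar> \<le> e \<longrightarrow> S x - S y \<ge> - S2 x / 4 * (y - x)^2"
    using Maxs_quadratic[OF assms] by blast
  have "S y < S x" if "y \<noteq> x" "\<bar>y - x\<bar> \<le> e" for y
  proof -
    have "- S2 x / 4 * (y - x)^2 > 0" using S2_Maxs[OF assms] that by (simp add: mult_neg_pos)
    then show ?thesis using e(2) that by force
  qed
  then show ?thesis using e(1) by blast
qed

text \<open>Zeros of b are simple, so a critical point is of one of two strict kinds, and a strict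
  local maximum cannot be a local minimum.\<close>

lemma local_min_in_Mins:
  assumes "e > 0" "\<forall>y. \<bar>x - y\<bar> < e \<longrightarrow> S x \<le> S y"
  shows "x \<in> Mins"
proof -
  have "- (b x / a x) = 0" using DERIV_local_min[OF S_deriv assms(1)] assms(2) by simp
  then have b0: "b x = 0" using a_pos[of x] by auto
  have "x \<notin> Maxs"
  proof
    assume "x \<in> Maxs"
    then obtain d where d: "d > 0" "\<forall>y. y \<noteq> x \<and> \<bar>y - x\<bar> \<le> d \<longrightarrow> S y < S x" using Maxs_strict by blast
    define y where "y = x + min d (e/2)"
    have "S y < S x" "S x \<le> S y" using d assms by (auto simp: y_def)
    then show False by simp
  qed
  then show ?thesis using b0 simple_zeros[OF b0] by (auto simp: Mins_def Maxs_def)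
qed

lemma local_max_in_Maxs:
  assumes "e > 0" "\<forall>y. \<bar>x - y\<bar> < e \<longrightarrow> S y \<le> S x"
  shows "x \<in> Maxs"
proof -
  have "- (b x / a x) = 0" using DERIV_local_max[OF S_deriv assms(1)] assms(2) by simp
  then have b0: "b x = 0" using a_pos[of x] by auto
  have "x \<notin> Mins"
  proof
    assume "x \<in> Mins"
    then obtain d where d: "d > 0" "\<forall>y. y \<noteq> x \<and> \<bar>y - x\<bar> \<le> d \<longrightarrow> S x < S y" using Mins_strict by blast
    define y where "y = x + min d (e/2)"
    have "S x < S y" "S y \<le> S x" using d assms by (auto simp: y_def)
    then show False by simp
  qed
  then show ?thesis using b0 simple_zeros[OF b0] by (auto simp: Mins_def Maxs_def)
qed

text \<open>Both ends are strict local minima, so S exceeds its end values inside the interval.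
  Hence every maximizer is interior and is a local maximum; this is why saddles never coincide with
  minima.\<close>

lemma max_on_interval:
  assumes "p < q" "p \<in> Mins" "q \<in> Mins"
  shows "\<exists>x\<in>{p<..<q}. (\<forall>y\<in>{p..q}. S y \<le> S x) \<and> S p < S x \<and> S q < S x"
    and "x \<in> {p..q} \<Longrightarrow> \<forall>y\<in>{p..q}. S y \<le> S x \<Longrightarrow> x \<in> {p<..<q} \<inter> Maxs"
proof -
  obtain e1 where e1: "e1 > 0" "\<forall>y. y \<noteq> p \<and> \<bar>y - p\<bar> \<le> e1 \<longrightarrow> S p < S y" using Mins_strict assms by blast
  obtain e2 where e2: "e2 > 0" "\<forall>y. y \<noteq> q \<and> \<bar>y - q\<bar> \<le> e2 \<longrightarrow> S q < S y" using Mins_strict assms by blast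
  have *: "\<exists>y\<in>{p..q}. S p < S y" "\<exists>y\<in>{p..q}. S q < S y"
    using e1 e2 assms by (intro bexI[of _ "p + min e1 (q - p)"] bexI[of _ "q - min e2 (q - p)"]; auto simp: min_def)+
  obtain x where x: "x \<in> {p..q}" "\<forall>y\<in>{p..q}. S y \<le> S x"
    using continuous_attains_sup[of "{p..q}" S] S_cont assms(1) by auto
  have "S p < S x" "S q < S x" using * x(2) by (meson le_less_trans less_le_trans)+
  then show "\<exists>x\<in>{p<..<q}. (\<forall>y\<in>{p..q}. S y \<le> S x) \<and> S p < S x \<and> S q < S x"
    using x by (intro bexI[of _ x]) (auto simp: le_less)
  show "x \<in> {p<..<q} \<inter> Maxs" if x: "x \<in> {p..q}" "\<forall>y\<in>{p..q}. S y \<le> S x" for x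
  proof -
    have "S p < S x" "S q < S x" using * x(2) by (meson le_less_trans less_le_trans)+
    then have x': "x \<in> {p<..<q}" using x(1) by (auto simp: le_less)
    moreover have "x \<in> Maxs"
      by (rule local_max_in_Maxs[of "min (x - p) (q - x)"]) (use x x' in \<open>auto simp: abs_if split: if_splits\<close>)
    ultimately show ?thesis by blast
  qed
qed

end

section \<open>Families of sets of minima\<close>

lemma int_step_less:
  fixes e :: "int \<Rightarrow> int"
  assumes "\<And>k. e k < e (k + 1)" "k < l"
  shows "e k < e l"
proof -
  have "e k < e (k + 1 + int n)" for n
  proof (induction n)
    case (Suc n)
    have "e (k + 1 + int n) < e (k + 1 + int n + 1)" by (rule assms(1))
    then show ?case using Suc by (simp add: algebra_simps)
  qed (use assms(1) in simp)
  from this[of "nat (l - k - 1)"] show ?thesis using assms(2) by simp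
qed

lemma periodic_int_shift:
  fixes f :: "int \<Rightarrow> 'a"
  assumes "\<And>k. f (k + int u) = f k"
  shows "f (k + n * int u) = f k"
proof (induction n rule: int_induct[where k = 0])
  case (step1 i)
  then show ?case using assms[of "k + i * int u"] by (simp add: algebra_simps)
next
  case (step2 i)
  then show ?case using assms[of "k + (i - 1) * int u"] by (simp add: algebra_simps)
qed simp

lemma periodic_int_mod:
  fixes f :: "int \<Rightarrow> 'a"
  assumes "\<And>k. f (k + int u) = f k"
  shows "f (k mod int u) = f k"
  using periodic_int_shift[of f u k "- (k div int u)", OF assms]
  by (simp add: minus_div_mult_eq_mod)

lemma periodic_int_finite_range:
  fixes f :: "int \<Rightarrow> 'a"
  assumes "\<And>k. f (k + int u) = f k" "1 \<le> u"
  shows "range f = f ` {0..<int u}" "finite (range f)"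
proof -
  show 1: "range f = f ` {0..<int u}"
  proof
    show "range f \<subseteq> f ` {0..<int u}"
    proof
      fix y assume "y \<in> range f"
      then obtain k where "y = f k" by auto
      then have "y = f (k mod int u)" using periodic_int_mod[of f u k, OF assms(1)] by simp
      then show "y \<in> f ` {0..<int u}" using assms(2) by auto
    qed
  qed auto
  show "finite (range f)" unfolding 1 by simp
qed

text \<open>Sort the elements within one period and repeat the list: the position in the list is
  taken modulo its length u', and each completed round adds u.\<close>

lemma periodic_int_set_enumeration:
  fixes K :: "int set"
  assumes per: "\<And>k. k + int u \<in> K \<longleftrightarrow> k \<in> K" and u: "1 \<le> u" and ne: "K \<noteq> {}"
  shows "\<exists>e u'. (\<forall>k. e k < e (k + 1)) \<and> range e = K \<and> (\<forall>k. e (k + int u') = e k + int u) \<and>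
    1 \<le> u' \<and> u' = card (K \<inter> {0..<int u})"
proof -
  define A where "A = K \<inter> {0..<int u}"
  define xs where "xs = sorted_list_of_set A"
  define u' where "u' = card A"
  have fin: "finite A" by (simp add: A_def)
  have modK: "k mod int u \<in> K \<longleftrightarrow> k \<in> K" for k
    using periodic_int_mod[of "\<lambda>k. k \<in> K" u k] per by simp
  have Ane: "A \<noteq> {}" using ne modK u by (fastforce simp: A_def)
  then have u': "1 \<le> u'" using fin by (simp add: u'_def Suc_leI card_gt_0_iff)
  have xs: "set xs = A" "length xs = u'" "sorted_wrt (<) xs"
    using fin by (auto simp: xs_def u'_def)
  define e where "e = (\<lambda>k::int. xs ! nat (k mod int u') + int u * (k div int u'))"
  have inA: "xs ! nat (k mod int u') \<in> A" for k
    using xs u' by (metis nth_mem nat_less_iff of_nat_0_less_iff pos_mod_bound pos_mod_sign less_le_trans zero_less_one)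
  have step: "e k < e (k + 1)" for k
  proof (cases "k mod int u' + 1 < int u'")
    case True
    have d: "(k + 1) mod int u' = k mod int u' + 1" "(k + 1) div int u' = k div int u'"
    proof -
      have eq: "k + 1 = int u' * (k div int u') + (k mod int u' + 1)" by simp
      have "0 \<le> k mod int u' + 1" using u' by (simp add: add_nonneg_nonneg)
      then show "(k + 1) mod int u' = k mod int u' + 1" "(k + 1) div int u' = k div int u'"
        using int_mod_pos_eq[OF eq _ True] int_div_pos_eq[OF eq _ True] by auto
    qed
    have "xs ! nat (k mod int u') < xs ! nat (k mod int u' + 1)"
      using xs True u' by (intro sorted_wrt_nth_less[OF xs(3)]) (auto simp: nat_less_iff nat_mono_iff)
    then show ?thesis by (simp add: e_def d)
  next
    \<comment> \<open>A round is complete: the next value is the first list entry, moved to the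
      following period.\<close>
    case False
    have "k mod int u' < int u'" using u' by simp
    then have *: "k mod int u' = int u' - 1" using False by linarith
    have "k + 1 = (k div int u' + 1) * int u'"
      using * div_mult_mod_eq[of k "int u'"] unfolding distrib_right by linarith
    then have d: "(k + 1) mod int u' = 0" "(k + 1) div int u' = k div int u' + 1"
      using u' by auto
    have "xs ! nat (k mod int u') < int u" "xs ! nat 0 \<ge> 0"
      using inA[of k] inA[of 0] by (auto simp: A_def)
    then show ?thesis unfolding e_def d distrib_left using inA[of k] by simp
  qed
  have shift: "e (k + int u') = e k + int u" for k
    using u' by (simp add: e_def algebra_simps)
  have "range e = K"
  proof
    show "range e \<subseteq> K"
    proof
      fix y assume "y \<in> range e"
      then obtain k where k: "y = e k" by auto
      have "xs ! nat (k mod int u') \<in> K" using inA by (auto simp: A_def)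
      then show "y \<in> K"
        using periodic_int_shift[of "\<lambda>k. k \<in> K" u "xs ! nat (k mod int u')" "k div int u'"] per
        by (simp add: k e_def mult.commute)
    qed
    show "K \<subseteq> range e"
    proof
      fix y assume "y \<in> K"
      then have "y mod int u \<in> A" using modK u by (auto simp: A_def)
      then obtain i where i: "i < u'" "xs ! i = y mod int u" using xs by (metis in_set_conv_nth)
      have "e (int u' * (y div int u) + int i) = y"
        using i u' by (simp add: e_def)
      then show "y \<in> range e" by (metis rangeI)
    qed
  qed
  then show ?thesis using step shift u' unfolding u'_def A_def by blast
qed

text \<open>A skipped value would have to be attained at an argument between two consecutive
  integers. This leaves a translation as the only freedom in labelling the sets of a level
  increasingly.\<close>

lemma int_strict_mono_surj_shift:
  fixes t :: "int \<Rightarrow> int"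
  assumes "\<And>k. t k < t (k + 1)" "surj t"
  shows "t k = t 0 + k"
proof -
  have step: "t (k + 1) = t k + 1" for k
  proof (rule ccontr)
    assume ne: "t (k + 1) \<noteq> t k + 1"
    obtain j where j: "t j = t k + 1" using assms(2) by (metis surjD)
    have "k < j" using j int_step_less[of t, OF assms(1), of j k] by (cases j k rule: linorder_cases) auto
    moreover have "j < k + 1" using j ne assms(1)[of k] int_step_less[of t, OF assms(1), of "k+1" j]
      by (cases j "k+1" rule: linorder_cases) auto
    ultimately show False by simp
  qed
  show ?thesis
  proof (induction k rule: int_induct[where k = 0])
    case (step2 i) then show ?case using step[of "i - 1"] by simp
  qed (auto simp: step)
qed

text \<open>The structural properties expected of a level, with u the number of sets up to integer
  translation. They are established by induction over the levels.\<close>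

locale family = landscape +
  fixes F :: "int \<Rightarrow> real set" and u :: nat
  assumes u_pos: "1 \<le> u"
    and F_shift1: "F (k + int u) = (\<lambda>x. x + 1) ` F k"
    and F_finite [simp]: "finite (F k)" and F_ne [simp]: "F k \<noteq> {}" and F_Mins: "F k \<subseteq> Mins"
    and F_step: "x \<in> F k \<Longrightarrow> y \<in> F (k + 1) \<Longrightarrow> x < y"
    and S_const: "x \<in> F k \<Longrightarrow> y \<in> F k \<Longrightarrow> S x = S y"
begin

abbreviation "pv \<equiv> pot_value a b F"
abbreviation "sad \<equiv> saddle_value a b F"
abbreviation "W \<equiv> saddles a b F"
abbreviation "HR \<equiv> height_right a b F"
abbreviation "HL \<equiv> height_left a b F"
abbreviation "\<hh> \<equiv> lowest_barrier a b F"
abbreviation "P \<equiv> proj_set F"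

lemma F_less: "k < l \<Longrightarrow> x \<in> F k \<Longrightarrow> y \<in> F l \<Longrightarrow> x < y"
proof -
  assume kl: "k < l" and x: "x \<in> F k" and y: "y \<in> F l"
  have "\<forall>y\<in>F (k + 1 + int n). x < y" for n
  proof (induction n)
    case 0 then show ?case using F_step[OF x] by auto
  next
    case (Suc n)
    obtain z where "z \<in> F (k + 1 + int n)" using F_ne by blast
    then show ?case using Suc F_step[of z "k + 1 + int n"] by (force simp: algebra_simps)
  qed
  from this[of "nat (l - k - 1)"] show "x < y" using kl y by simp
qed

lemma F_disjoint: "x \<in> F k \<Longrightarrow> x \<in> F l \<Longrightarrow> k = l"
  using F_less[of k l x x] F_less[of l k x x] by (cases k l rule: linorder_cases) auto

lemma inj_F: "inj F"
  by (intro injI) (metis F_disjoint F_ne ex_in_conv)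

lemma F_shift: "F (k + n * int u) = (\<lambda>x. x + of_int n) ` F k"
proof (induction n rule: int_induct[where k = 0])
  case (step1 i)
  have "F (k + (i + 1) * int u) = (\<lambda>x. x + 1) ` F (k + i * int u)"
    using F_shift1[of "k + i * int u"] by (simp add: algebra_simps)
  then show ?case using step1 by (simp add: image_image algebra_simps)
next
  case (step2 i)
  have "(\<lambda>x. x + 1) ` F (k + (i - 1) * int u) = (\<lambda>x. x + of_int i) ` F k"
    using F_shift1[of "k + (i - 1) * int u"] step2 by (simp add: algebra_simps)
  then have "(\<lambda>x. x - 1) ` (\<lambda>x. x + 1) ` F (k + (i - 1) * int u) = (\<lambda>x. x - 1) ` (\<lambda>x. x + of_int i) ` F k"
    by simp
  then show ?case by (simp add: image_image algebra_simps)
qed simp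

lemma F_Min_in: "Min (F k) \<in> F k" and F_Max_in: "Max (F k) \<in> F k"
  by auto

lemma S_F: "x \<in> F k \<Longrightarrow> S x = pv k"
  unfolding pot_value_def using S_const F_Min_in by blast

lemma Min_shift: "Min (F (k + n * int u)) = Min (F k) + of_int n"
  and Max_shift: "Max (F (k + n * int u)) = Max (F k) + of_int n"
proof -
  have mono: "mono (\<lambda>x::real. x + of_int n)" by (auto simp: mono_def)
  show "Min (F (k + n * int u)) = Min (F k) + of_int n"
    unfolding F_shift by (rule mono_Min_commute[OF mono, symmetric]) auto
  show "Max (F (k + n * int u)) = Max (F k) + of_int n"
    unfolding F_shift by (rule mono_Max_commute[OF mono, symmetric]) auto
qed

lemma gap_shift: "x + of_int n \<in> gap F (k + n * int u) \<longleftrightarrow> x \<in> gap F k"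
  using Min_shift[of "k + 1" n] by (simp add: gap_def Max_shift algebra_simps)

lemma pv_shift: "pv (k + n * int u) = pv k - of_int n * B"
  by (simp add: pot_value_def Min_shift S_shift)

lemma Max_less_Min: "Max (F k) < Min (F (k + 1))"
  using F_step F_Max_in F_Min_in by blast

text \<open>The supremum in \<open>saddle_value\<close> is attained, and only at local maxima of S,
  because the gap runs between two minima.\<close>

lemma saddle_ex: "\<exists>x\<in>gap F k. x \<in> Maxs \<and> (\<forall>y\<in>gap F k. S y \<le> S x) \<and> pv k < S x \<and> pv (k + 1) < S x \<and> sad k = S x"
proof -
  have "Max (F k) \<in> Mins" "Min (F (k + 1)) \<in> Mins" using F_Mins F_Max_in F_Min_in by blast+
  note X = max_on_interval[OF Max_less_Min this]
  obtain x where x: "x \<in> {Max (F k)<..<Min (F (k + 1))}" "\<forall>y\<in>gap F k. S y \<le> S x"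
      "S (Max (F k)) < S x" "S (Min (F (k + 1))) < S x"
    using X(1) by (auto simp: gap_def)
  then have xg: "x \<in> gap F k" by (auto simp: gap_def)
  then have "x \<in> Maxs" using X(2)[of x] x(2) by (auto simp: gap_def)
  moreover have "sad k = S x"
    unfolding saddle_value_def using xg x(2) by (intro cSup_eq_maximum) auto
  moreover have "pv k < S x" "pv (k + 1) < S x"
    using x(3,4) S_F[OF F_Max_in] S_F[OF F_Min_in] by auto
  ultimately show ?thesis using x xg by blast
qed

lemma S_le_sad: "y \<in> gap F k \<Longrightarrow> S y \<le> sad k" and pv_less_sad: "pv k < sad k" "pv (k + 1) < sad k"
  using saddle_ex[of k] by auto

lemma W_ne: "W k \<noteq> {}" and W_Maxs: "W k \<subseteq> Maxs" and W_finite [simp]: "finite (W k)"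
  and W_interior: "W k \<subseteq> {Max (F k)<..<Min (F (k + 1))}"
proof -
  have Mi: "Max (F k) \<in> Mins" "Min (F (k + 1)) \<in> Mins" using F_Mins F_Max_in F_Min_in by blast+
  show "W k \<noteq> {}" using saddle_ex[of k] by (auto simp: saddles_def)
  have *: "W k \<subseteq> {Max (F k)<..<Min (F (k + 1))} \<inter> Maxs"
    using max_on_interval(2)[OF Max_less_Min Mi] S_le_sad[of _ k] by (auto simp: saddles_def gap_def)
  then show "W k \<subseteq> Maxs" "W k \<subseteq> {Max (F k)<..<Min (F (k + 1))}" by blast+
  have sub: "{p<..<q} \<inter> Maxs \<subseteq> Maxs \<inter> {p..q}" for p q by auto
  show "finite (W k)"
    by (rule finite_subset[OF _ finite_Maxs[of "Max (F k)" "Min (F (k + 1))"]]) (rule order.trans[OF *], rule sub)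
qed

lemma sad_shift: "sad (k + n * int u) = sad k - of_int n * B"
proof -
  obtain x where x: "x \<in> gap F k" "\<forall>y\<in>gap F k. S y \<le> S x" "sad k = S x" using saddle_ex by blast
  have "S y \<le> S (x + of_int n)" if "y \<in> gap F (k + n * int u)" for y
  proof -
    have "y - of_int n \<in> gap F k" using that gap_shift[of "y - of_int n" n k] by simp
    then have "S (y - of_int n) \<le> S x" using x by blast
    then show ?thesis using S_shift[of "y - of_int n" n] S_shift[of x n] by simp
  qed
  then have "sad (k + n * int u) = S (x + of_int n)"
    unfolding saddle_value_def using x(1) gap_shift by (intro cSup_eq_maximum) auto
  then show ?thesis using x by (simp add: S_shift)
qed

lemma HR_shift: "HR (k + n * int u) = HR k" and HL_shift: "HL (k + n * int u) = HL k"
  using sad_shift[of "k - 1" n] by (simp_all add: height_right_def height_left_def sad_shift pv_shift algebra_simps)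

text \<open>Along one period the saddle values and the depths drop by the same amount B, so the
  heights are periodic in the index and the infimum over all integers is a minimum over a finite
  set.\<close>

lemma hh_attained: "\<exists>k. \<hh> = HR k \<or> \<hh> = HL k" and hh_le: "\<hh> \<le> HR k" "\<hh> \<le> HL k" and hh_pos: "0 < \<hh>"
proof -
  let ?f = "\<lambda>k. min (HL k) (HR k)"
  have fin: "finite (range ?f)"
    by (rule periodic_int_finite_range(2)[where u = u]) (use HR_shift[of _ 1] HL_shift[of _ 1] u_pos in auto)
  have eq: "\<hh> = Min (range ?f)" unfolding lowest_barrier_def using fin by (simp add: cInf_eq_Min)
  then have "\<hh> \<in> range ?f" using fin Min_in[of "range ?f"] by simp
  then obtain k0 where "\<hh> = min (HL k0) (HR k0)" by auto
  then show ex: "\<exists>k. \<hh> = HR k \<or> \<hh> = HL k" by (auto simp: min_def split: if_splits)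
  have "\<hh> \<le> ?f k" unfolding eq by (rule Min_le[OF fin]) blast
  then show "\<hh> \<le> HR k" "\<hh> \<le> HL k" by auto
  have "0 < HR k" "0 < HL k" for k
    using pv_less_sad(1)[of k] pv_less_sad(2)[of "k - 1"] by (auto simp: height_right_def height_left_def)
  then show "0 < \<hh>" using ex by metis
qed

lemma weight1_pos: "x \<in> Mins \<Longrightarrow> 0 < weight1 a b x"
  using a_pos S2_Mins by (simp add: weight1_def deriv2_S)

lemma well_weight_pos: "0 < well_weight a b F k"
  unfolding well_weight_def using F_Mins by (intro sum_pos weight1_pos) auto

lemma saddle_weight_pos: "0 < saddle_weight a b F k"
proof -
  have "0 < sqrt (2 * pi / - S2 x)" if "x \<in> W k" for x
    using S2_Maxs[of x] W_Maxs[of k] that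
    by (intro iffD2[OF real_sqrt_gt_0_iff] divide_pos_pos) auto
  then show ?thesis unfolding saddle_weight_def deriv2_S using W_ne[of k] by (intro sum_pos) auto
qed

lemma rate_right: "rate a b F k (k + 1) = of_bool (HR k = \<hh>) / (well_weight a b F k * saddle_weight a b F k)"
  and rate_left: "rate a b F k (k - 1) = of_bool (HL k = \<hh>) / (well_weight a b F k * saddle_weight a b F (k - 1))"
  by (auto simp: rate_def)

lemma rate_pos_iff: "0 < rate a b F k l \<longleftrightarrow> l = k + 1 \<and> HR k = \<hh> \<or> l = k - 1 \<and> HL k = \<hh>"
  using well_weight_pos[of k] saddle_weight_pos[of k] saddle_weight_pos[of "k - 1"]
  by (auto simp: rate_def zero_less_mult_iff)

lemma same_frac_index:
  assumes "x \<in> F k" "y \<in> F l" "frac x = frac y"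
  shows "k mod int u = l mod int u"
proof -
  define n where "n = \<lfloor>x\<rfloor> - \<lfloor>y\<rfloor>"
  have "x = y + of_int n" using assms(3) by (simp add: frac_def n_def)
  then have "x \<in> F (l + n * int u)" using assms(2) F_shift by auto
  then have "k = l + n * int u" using assms(1) F_disjoint by blast
  then show ?thesis by simp
qed

lemma P_shift: "P (k + n * int u) = P k"
  by (simp add: proj_set_def F_shift image_image frac_def)

lemma P_eq_iff: "P k = P l \<longleftrightarrow> k mod int u = l mod int u"
proof
  assume "P k = P l"
  then obtain x y where "x \<in> F k" "y \<in> F l" "frac x = frac y"
    unfolding proj_set_def by (metis F_ne ex_in_conv image_iff)
  then show "k mod int u = l mod int u" using same_frac_index by blast
next
  assume "k mod int u = l mod int u"
  then show "P k = P l"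
    using periodic_int_mod[of P u k] periodic_int_mod[of P u l] P_shift[of _ 1] by simp
qed

text \<open>The translates of \<open>F k\<close> by integers are the sets with index congruent to k
  modulo u, so the orbits correspond to the residues.\<close>

lemma num_classes: "num_classes F = u"
proof -
  let ?O = "\<lambda>k. range (\<lambda>j::int. (\<lambda>x. x + of_int j) ` F k)"
  have O: "?O k = range (\<lambda>j. F (k + j * int u))" for k by (simp add: F_shift)
  have per: "?O (k + int u) = ?O k" for k
  proof -
    have "F (k + j * int u) \<in> ?O (k + int u)" "F (k + int u + j * int u) \<in> ?O k" for j
      unfolding O by (rule range_eqI[of _ _ "j - 1"], simp add: algebra_simps)
        (rule range_eqI[of _ _ "j + 1"], simp add: algebra_simps)
    then show ?thesis unfolding O by blast
  qed
  have "range ?O = ?O ` {0..<int u}" by (rule periodic_int_finite_range(1)[of ?O u, OF per u_pos])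
  moreover have "inj_on ?O {0..<int u}"
  proof (rule inj_onI)
    fix k l assume kl: "k \<in> {0..<int u}" "l \<in> {0..<int u}" "?O k = ?O l"
    have "F (k + 0 * int u) \<in> ?O k" unfolding O by (rule rangeI)
    then have "F k \<in> range (\<lambda>j. F (l + j * int u))" using kl(3) unfolding O by simp
    then obtain j where "F k = F (l + j * int u)" by auto
    then have "k = l + j * int u" using inj_F by (simp add: inj_eq)
    then have "k mod int u = l mod int u" by simp
    then show "k = l" using kl by simp
  qed
  ultimately show ?thesis by (simp add: num_classes_def card_image)
qed

lemma proj_states_eq: "proj_states F = range P"
  unfolding proj_states_def num_classes using periodic_int_finite_range(1)[of P u] P_shift[of _ 1] u_pos by simp

lemma inj_on_P: "inj_on P {0..<int u}"
  by (auto intro!: inj_onI simp: P_eq_iff)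

end

section \<open>The hierarchy of levels\<close>

lemma rtrancl_image_inj:
  assumes "inj f"
  shows "(map_prod f f ` E)\<^sup>* `` {f k} = f ` (E\<^sup>* `` {k})"
proof
  show "(map_prod f f ` E)\<^sup>* `` {f k} \<subseteq> f ` (E\<^sup>* `` {k})"
  proof
    fix y assume "y \<in> (map_prod f f ` E)\<^sup>* `` {f k}"
    then have "(f k, y) \<in> (map_prod f f ` E)\<^sup>*" by simp
    then show "y \<in> f ` (E\<^sup>* `` {k})"
    proof induction
      case (step y z)
      then obtain i p q where "(k, i) \<in> E\<^sup>*" "y = f i" "(p, q) \<in> E" "y = f p" "z = f q" by auto
      then show ?case using assms by (auto simp: inj_eq intro: rtrancl_into_rtrancl)
    qed auto
  qed
  show "f ` (E\<^sup>* `` {k}) \<subseteq> (map_prod f f ` E)\<^sup>* `` {f k}"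
  proof (rule image_subsetI)
    fix i assume "i \<in> E\<^sup>* `` {k}"
    then have "(k, i) \<in> E\<^sup>*" by simp
    then show "f i \<in> (map_prod f f ` E)\<^sup>* `` {f k}"
    proof induction
      case (step y z)
      then have "(f y, f z) \<in> map_prod f f ` E" by force
      then show ?case using step by (auto intro: rtrancl_into_rtrancl)
    qed auto
  qed
qed

text \<open>Trades states for indices: since distinct indices carry distinct sets, the chain on sets
  of minima may be studied as a chain on the integers, where the order is at hand.\<close>

lemma closed_irreducible_image:
  assumes "inj f"
  shows "closed_irreducible (range f) (map_prod f f ` E) C \<longleftrightarrow>
    (\<exists>K. closed_irreducible UNIV E K \<and> C = f ` K)"
proof
  assume C: "closed_irreducible (range f) (map_prod f f ` E) C"
  define K where "K = f -` C"
  have CK: "C = f ` K" using C by (auto simp: closed_irreducible_def K_def)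
  have "E\<^sup>* `` {k} = K" if "k \<in> K" for k
  proof -
    have "f k \<in> C" using that by (simp add: K_def)
    then have "(map_prod f f ` E)\<^sup>* `` {f k} = C" using C unfolding closed_irreducible_def by blast
    then have "f ` (E\<^sup>* `` {k}) = f ` K" unfolding rtrancl_image_inj[OF assms] CK .
    then show ?thesis using assms by (simp add: inj_image_eq_iff)
  qed
  moreover have "K \<noteq> {}" using C CK by (auto simp: closed_irreducible_def)
  ultimately have "closed_irreducible UNIV E K" unfolding closed_irreducible_def by blast
  then show "\<exists>K. closed_irreducible UNIV E K \<and> C = f ` K" using CK by blast
next
  assume "\<exists>K. closed_irreducible UNIV E K \<and> C = f ` K"
  then obtain K where K: "closed_irreducible UNIV E K" "C = f ` K" by blast
  have "(map_prod f f ` E)\<^sup>* `` {f k} = f ` K" if "k \<in> K" for k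
    unfolding rtrancl_image_inj[OF assms] using K(1) that unfolding closed_irreducible_def by simp
  moreover have "K \<noteq> {}" using K(1) unfolding closed_irreducible_def by simp
  ultimately show "closed_irreducible (range f) (map_prod f f ` E) C"
    unfolding closed_irreducible_def K(2) by blast
qed

text \<open>Closed classes depend only on which jumps are possible, so rates are replaced by
  predicates. A blocked jump in each direction, repeated periodically, keeps the chain from escaping
  to infinity and makes every closed class a finite interval.\<close>

locale periodic_chain =
  fixes R L :: "int \<Rightarrow> bool" and u :: nat
  assumes u_ge1: "1 \<le> u" and R_per: "R (k + int u) = R k" and L_per: "L (k + int u) = L k"
    and not_all_R: "\<exists>k. \<not> R k" and not_all_L: "\<exists>k. \<not> L k"
begin

definition jumps :: "(int \<times> int) set" where
  "jumps = {(k, k + 1) |k. R k} \<union> {(k, k - 1) |k. L k}"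

definition block :: "int \<Rightarrow> int \<Rightarrow> bool" where
  "block l r \<longleftrightarrow> l \<le> r \<and> \<not> L l \<and> \<not> R r \<and> (\<forall>i\<in>{l..<r}. R i) \<and> (\<forall>i\<in>{l<..r}. L i)"

lemma first_not_R: "\<exists>r\<ge>k. \<not> R r \<and> (\<forall>i\<in>{k..<r}. R i)"
proof -
  obtain k0 where k0: "\<not> R k0" using not_all_R by blast
  \<comment> \<open>A period has length at least 1, so moving the blocked index k0 by |k - k0|
    periods brings it to k or beyond.\<close>
  have "\<not> R (k0 + \<bar>k - k0\<bar> * int u)" using k0 periodic_int_shift[of R u k0 "\<bar>k - k0\<bar>"] R_per by simp
  moreover have "\<bar>k - k0\<bar> * 1 \<le> \<bar>k - k0\<bar> * int u" using u_ge1 by (intro mult_left_mono) auto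
  then have ge: "k0 + \<bar>k - k0\<bar> * int u \<ge> k" by simp
  ultimately have ex: "\<exists>n. \<not> R (k + int n)"
    by (intro exI[of _ "nat (k0 + \<bar>k - k0\<bar> * int u - k)"]) simp
  define n where "n = (LEAST n. \<not> R (k + int n))"
  have n: "\<not> R (k + int n)" unfolding n_def using ex by (rule LeastI_ex)
  have "R i" if "i \<in> {k..<k + int n}" for i
    using not_less_Least[of "nat (i - k)" "\<lambda>n. \<not> R (k + int n)"] that by (auto simp: n_def)
  then show ?thesis using n by (intro exI[of _ "k + int n"]) auto
qed

lemma last_not_L: "\<exists>l\<le>k. \<not> L l \<and> (\<forall>i\<in>{l<..k}. L i)"
proof -
  obtain k0 where k0: "\<not> L k0" using not_all_L by blast
  have "\<not> L (k0 + (- \<bar>k - k0\<bar>) * int u)" using k0 periodic_int_shift[of L u k0 "- \<bar>k - k0\<bar>"] L_per by simp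
  moreover have "\<bar>k - k0\<bar> * 1 \<le> \<bar>k - k0\<bar> * int u" using u_ge1 by (intro mult_left_mono) auto
  then have "k0 + (- \<bar>k - k0\<bar>) * int u \<le> k" by simp
  ultimately have ex: "\<exists>n. \<not> L (k - int n)"
    by (intro exI[of _ "nat (k - (k0 + (- \<bar>k - k0\<bar>) * int u))"]) simp
  define n where "n = (LEAST n. \<not> L (k - int n))"
  have n: "\<not> L (k - int n)" unfolding n_def using ex by (rule LeastI_ex)
  have "L i" if "i \<in> {k - int n<..k}" for i
    using not_less_Least[of "nat (k - i)" "\<lambda>n. \<not> L (k - int n)"] that by (auto simp: n_def)
  then show ?thesis using n by (intro exI[of _ "k - int n"]) auto
qed

text \<open>Run right until blocked at r0, then left until blocked at l0. From l0 the run to the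
  right stops at some r1, not beyond r0 where the right jump is blocked, and all left jumps above l0
  are possible; so l0 and r1 bound a block.\<close>

lemma reach_block:
  "\<exists>r0 l0 r1. k \<le> r0 \<and> l0 \<le> r0 \<and> r1 \<le> r0 \<and> (\<forall>i\<in>{k..<r0}. R i) \<and> (\<forall>i\<in>{l0<..r0}. L i) \<and> block l0 r1"
proof -
  obtain r0 where r0: "r0 \<ge> k" "\<not> R r0" "\<forall>i\<in>{k..<r0}. R i" using first_not_R by blast
  obtain l0 where l0: "l0 \<le> r0" "\<not> L l0" "\<forall>i\<in>{l0<..r0}. L i" using last_not_L by blast
  obtain r1 where r1: "r1 \<ge> l0" "\<not> R r1" "\<forall>i\<in>{l0..<r1}. R i" using first_not_R by blast
  have "r1 \<le> r0" using r0 l0 r1 by (metis atLeastLessThan_iff not_le)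
  then have "block l0 r1" using r1 l0 by (auto simp: block_def)
  then show ?thesis using r0 l0 \<open>r1 \<le> r0\<close> by blast
qed

lemma path_right:
  assumes "k \<le> r" "\<forall>i\<in>{k..<r}. R i"
  shows "(k, r) \<in> jumps\<^sup>*"
  using assms
proof (induction r rule: int_ge_induct)
  case (step i)
  then have "(i, i + 1) \<in> jumps" by (auto simp: jumps_def)
  then show ?case using step by (auto intro: rtrancl_into_rtrancl)
qed auto

lemma path_left:
  assumes "l \<le> k" "\<forall>i\<in>{l<..k}. L i"
  shows "(k, l) \<in> jumps\<^sup>*"
  using assms
proof (induction k rule: int_ge_induct)
  case (step i)
  then have "(i + 1, i) \<in> jumps" by (auto simp: jumps_def)
  then show ?case using step by (auto intro: converse_rtrancl_into_rtrancl)
qed auto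

lemma block_reach:
  assumes "block l r" "k \<in> {l..r}"
  shows "jumps\<^sup>* `` {k} = {l..r}"
proof
  show "jumps\<^sup>* `` {k} \<subseteq> {l..r}"
  proof
    fix j assume "j \<in> jumps\<^sup>* `` {k}"
    then have "(k, j) \<in> jumps\<^sup>*" by simp
    then show "j \<in> {l..r}"
    proof induction
      case (step y z)
      then show ?case using assms(1) by (cases "y = l"; cases "y = r") (auto simp: jumps_def block_def)
    qed (use assms in auto)
  qed
  show "{l..r} \<subseteq> jumps\<^sup>* `` {k}"
  proof
    fix j assume j: "j \<in> {l..r}"
    then show "j \<in> jumps\<^sup>* `` {k}"
      using path_right[of k j] path_left[of j k] assms by (cases "k \<le> j") (auto simp: block_def)
  qed
qed

lemma closed_irreducible_iff_block: "closed_irreducible UNIV jumps C \<longleftrightarrow> (\<exists>l r. block l r \<and> C = {l..r})"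
proof
  assume C: "closed_irreducible UNIV jumps C"
  then obtain k where k: "k \<in> C" "jumps\<^sup>* `` {k} = C" by (auto simp: closed_irreducible_def)
  obtain r0 l0 r1 where *: "k \<le> r0" "l0 \<le> r0" "\<forall>i\<in>{k..<r0}. R i" "\<forall>i\<in>{l0<..r0}. L i" "block l0 r1"
    using reach_block by blast
  have "(k, l0) \<in> jumps\<^sup>*" using path_right[of k r0] path_left[of l0 r0] * by (blast intro: rtrancl_trans)
  then have "l0 \<in> C" using k by auto
  then have "jumps\<^sup>* `` {l0} = C" using C by (auto simp: closed_irreducible_def)
  moreover have "jumps\<^sup>* `` {l0} = {l0..r1}" using block_reach[OF *(5)] *(5) by (auto simp: block_def)
  ultimately show "\<exists>l r. block l r \<and> C = {l..r}" using *(5) by blast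
next
  assume "\<exists>l r. block l r \<and> C = {l..r}"
  then obtain l r where "block l r" "C = {l..r}" by blast
  then show "closed_irreducible UNIV jumps C" using block_reach[of l r]
    unfolding closed_irreducible_def by (simp add: block_def)
qed

lemma block_unique: "block l r \<Longrightarrow> block l r' \<Longrightarrow> r = r'"
  by (cases r r' rule: linorder_cases) (auto simp: block_def)

lemma block_order: "block l r \<Longrightarrow> block l' r' \<Longrightarrow> l < l' \<Longrightarrow> r < l'"
  by (rule ccontr) (auto simp: block_def)

lemma block_shift: "block (l + int u) (r + int u) \<longleftrightarrow> block l r"
proof -
  have "(\<forall>i\<in>{l + int u..<r + int u}. R i) \<longleftrightarrow> (\<forall>i\<in>{l..<r}. R i)"
  proof safe
    fix i assume "\<forall>i\<in>{l + int u..<r + int u}. R i" "i \<in> {l..<r}"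
    then show "R i" using R_per[of i] by auto
  next
    fix i assume "\<forall>i\<in>{l..<r}. R i" "i \<in> {l + int u..<r + int u}"
    then show "R i" using R_per[of "i - int u"] by auto
  qed
  moreover have "(\<forall>i\<in>{l + int u<..r + int u}. L i) \<longleftrightarrow> (\<forall>i\<in>{l<..r}. L i)"
  proof safe
    fix i assume "\<forall>i\<in>{l + int u<..r + int u}. L i" "i \<in> {l<..r}"
    then show "L i" using L_per[of i] by auto
  next
    fix i assume "\<forall>i\<in>{l<..r}. L i" "i \<in> {l + int u<..r + int u}"
    then show "L i" using L_per[of "i - int u"] by auto
  qed
  ultimately show ?thesis by (simp add: block_def R_per L_per)
qed

text \<open>The blocks are the closed irreducible classes; the sets of the next level are indexed by \<open>k\<close>
  through the block from \<open>e k\<close> to \<open>\<rho> k\<close>.\<close>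

definition enumerates :: "(int \<Rightarrow> int) \<Rightarrow> (int \<Rightarrow> int) \<Rightarrow> nat \<Rightarrow> bool" where
  "enumerates e \<rho> u' \<longleftrightarrow> (\<forall>k. e k < e (k + 1)) \<and> (\<forall>k. block (e k) (\<rho> k)) \<and>
     (\<forall>l r. block l r \<longrightarrow> (\<exists>k. l = e k \<and> r = \<rho> k)) \<and>
     (\<forall>k. e (k + int u') = e k + int u \<and> \<rho> (k + int u') = \<rho> k + int u) \<and> 1 \<le> u'"

text \<open>Blocks are determined by their left ends, which form a periodic set. If there were as
  many of them as indices in a period, every index would be a left end, blocks would be singletons
  and no jump would be possible. The strict decrease makes the recursion of levels
  terminate.\<close>

lemma enumerates_ex:
  assumes "\<exists>k. R k \<or> L k"
  shows "\<exists>e \<rho> u'. enumerates e \<rho> u' \<and> u' < u"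
proof -
  define K where "K = {l. \<exists>r. block l r}"
  have per: "k + int u \<in> K \<longleftrightarrow> k \<in> K" for k
  proof
    assume "k + int u \<in> K"
    then obtain r where "block (k + int u) r" by (auto simp: K_def)
    then show "k \<in> K" using block_shift[of k "r - int u"] by (auto simp: K_def)
  next
    assume "k \<in> K"
    then show "k + int u \<in> K" using block_shift by (auto simp: K_def)
  qed
  have "K \<noteq> {}" using reach_block by (force simp: K_def)
  from periodic_int_set_enumeration[of u K, OF per u_ge1 this] obtain e u' where
    e: "\<And>k. e k < e (k + 1)" "range e = K" "\<And>k. e (k + int u') = e k + int u" "1 \<le> u'"
      and u': "u' = card (K \<inter> {0..<int u})" by blast
  have "\<forall>k. \<exists>r. block (e k) r" using e(2) by (auto simp: K_def)
  then obtain \<rho> where \<rho>: "\<And>k. block (e k) (\<rho> k)" by metis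
  have "\<rho> (k + int u') = \<rho> k + int u" for k
    using \<rho>[of k] \<rho>[of "k + int u'"] block_shift block_unique e(3) by metis
  moreover have "\<exists>k. l = e k \<and> r = \<rho> k" if "block l r" for l r
  proof -
    have "l \<in> range e" using that e(2) by (auto simp: K_def)
    then show ?thesis using that \<rho> block_unique by blast
  qed
  ultimately have "enumerates e \<rho> u'" using e \<rho> by (auto simp: enumerates_def)
  moreover have "u' < u"
  proof (rule ccontr)
    assume "\<not> u' < u"
    then have "card {0..<int u} \<le> card (K \<inter> {0..<int u})" using u' by simp
    then have "K \<inter> {0..<int u} = {0..<int u}" by (intro card_seteq) auto
    then have sub: "{0..<int u} \<subseteq> K" by blast
    have all: "k \<in> K" for k
    proof -
      have "k mod int u \<in> K" using sub u_ge1 by (auto simp: subset_iff)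
      then show ?thesis using periodic_int_mod[of "\<lambda>k. k \<in> K" u k, OF per] by simp
    qed
    have "\<not> R k \<and> \<not> L k" for k
    proof -
      obtain r r' where "block k r" "block (k + 1) r'" using all[of k] all[of "k + 1"] by (auto simp: K_def)
      moreover from this have "r < k + 1" using block_order[of k r "k + 1" r'] by simp
      ultimately show ?thesis by (auto simp: block_def)
    qed
    then show False using assms by blast
  qed
  ultimately show ?thesis by blast
qed

lemma enumerates_translate:
  assumes "enumerates e \<rho> u'"
  shows "enumerates (\<lambda>k. e (k + c)) (\<lambda>k. \<rho> (k + c)) u'"
proof -
  have *: "k + 1 + c = (k + c) + 1" "k + int u' + c = (k + c) + int u'" for k by auto
  have "\<exists>k. l = e (k + c) \<and> r = \<rho> (k + c)" if lr: "block l r" for l r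
  proof -
    obtain k where "l = e k" "r = \<rho> k" using assms lr unfolding enumerates_def by blast
    then show ?thesis by (intro exI[of _ "k - c"]) simp
  qed
  then show ?thesis using assms unfolding enumerates_def * by blast
qed

end

text \<open>The invariant of the recursion. The second property keeps control of the minima that were
  discarded at earlier levels: they lie strictly above, and descend across barriers below \<open>\<hh>\<close> into, a set of
  the present level.\<close>

locale metastable_family = family +
  assumes inner_barrier: "x \<in> F k \<Longrightarrow> y \<in> F k \<Longrightarrow> z \<in> {x..y} \<Longrightarrow> S z - S x < \<hh>"
    and dropped: "z \<in> Mins \<Longrightarrow> \<forall>k. z \<notin> F k \<Longrightarrow>
      \<exists>k. \<exists>y\<in>F k. S y < S z \<and> (\<forall>t\<in>{min z y..max z y}. S t - S z < \<hh>)"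
begin

lemma cover:
  assumes "k \<le> r" "z \<in> {Min (F k)..Max (F r)}"
  shows "(\<exists>i\<in>{k..r}. z \<in> {Min (F i)..Max (F i)}) \<or> (\<exists>i\<in>{k..<r}. z \<in> gap F i)"
  using assms
proof (induction r rule: int_ge_induct)
  case base
  then show ?case by auto
next
  case (step r)
  show ?case
  proof (cases "z \<le> Max (F r)")
    case True
    then have "(\<exists>i\<in>{k..r}. z \<in> {Min (F i)..Max (F i)}) \<or> (\<exists>i\<in>{k..<r}. z \<in> gap F i)"
      using step by simp
    then show ?thesis using step(1) by (meson atLeastAtMost_iff atLeastLessThan_iff order.strict_trans order_trans zle_add1_eq_le less_add_one le_less)
  next
    case False
    then show ?thesis
    proof (cases "z \<le> Min (F (r + 1))")
      case True
      then have "z \<in> gap F r" using False unfolding gap_def by (metis atLeastAtMost_iff linear)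
      then show ?thesis using step(1) by (metis atLeastLessThan_iff less_add_one)
    next
      case False
      then have "z \<in> {Min (F (r + 1))..Max (F (r + 1))}" using step(3) False unfolding atLeastAtMost_iff by linarith
      then show ?thesis using step(1) by (metis atLeastAtMost_iff le_add_same_cancel1 order_refl order_trans zero_le_one)
    qed
  qed
qed

lemma inner_S: "z \<in> {Min (F i)..Max (F i)} \<Longrightarrow> S z < pv i + \<hh>"
  using inner_barrier[OF F_Min_in F_Max_in] S_F[OF F_Min_in] by fastforce

text \<open>A jump over a barrier of the lowest height cannot lead to a shallower set, since the
  barrier for the way back is no lower than \<hh>. If the two depths agree, both barriers equal
  \<hh> and the jump is reversible.\<close>

lemma pv_right: "HR i = \<hh> \<Longrightarrow> pv (i + 1) \<le> pv i"
  and pv_left: "HL (i + 1) = \<hh> \<Longrightarrow> pv i \<le> pv (i + 1)"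
  and right_eq: "HR i = \<hh> \<Longrightarrow> pv (i + 1) = pv i \<Longrightarrow> HL (i + 1) = \<hh>"
  and left_eq: "HL (i + 1) = \<hh> \<Longrightarrow> pv (i + 1) = pv i \<Longrightarrow> HR i = \<hh>"
  using hh_le[of "i + 1"] hh_le[of i] by (auto simp: height_left_def height_right_def)

lemma pv_right_travel:
  assumes "k \<le> r" "\<forall>i\<in>{k..<r}. HR i = \<hh>"
  shows "pv r \<le> pv k"
  using assms
proof (induction r rule: int_ge_induct)
  case (step r)
  then show ?case using pv_right[of r] by fastforce
qed simp

lemma pv_left_travel:
  assumes "l \<le> k" "\<forall>i\<in>{l<..k}. HL i = \<hh>"
  shows "pv l \<le> pv k"
  using assms
proof (induction k rule: int_ge_induct)
  case (step k)
  then show ?case using pv_left[of k] by fastforce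
qed simp

text \<open>Every saddle passed lies exactly \<hh> above the depth of the set just left, and the
  depths do not increase along the way.\<close>

lemma S_right_travel:
  assumes "k \<le> r" "\<forall>i\<in>{k..<r}. HR i = \<hh>" "z \<in> {Min (F k)..Max (F r)}"
  shows "S z \<le> pv k + \<hh>"
proof -
  have le: "pv i \<le> pv k" if "i \<in> {k..r}" for i using pv_right_travel[of k i] assms that by auto
  from cover[OF assms(1,3)] show ?thesis
  proof
    assume "\<exists>i\<in>{k..r}. z \<in> {Min (F i)..Max (F i)}"
    then show ?thesis using le inner_S by (meson add_le_cancel_right less_imp_le order_trans)
  next
    assume "\<exists>i\<in>{k..<r}. z \<in> gap F i"
    then obtain i where i: "i \<in> {k..<r}" "z \<in> gap F i" by blast
    then have "HR i = \<hh>" using assms(2) by blast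
    then have "S z \<le> sad i" "sad i = pv i + \<hh>" using S_le_sad i by (auto simp: height_right_def)
    then show ?thesis using le[of i] i by auto
  qed
qed

lemma S_left_travel:
  assumes "l \<le> k" "\<forall>i\<in>{l<..k}. HL i = \<hh>" "z \<in> {Min (F l)..Max (F k)}"
  shows "S z \<le> pv k + \<hh>"
proof -
  have le: "pv i \<le> pv k" if "i \<in> {l..k}" for i using pv_left_travel[of i k] assms that by auto
  from cover[OF assms(1,3)] show ?thesis
  proof
    assume "\<exists>i\<in>{l..k}. z \<in> {Min (F i)..Max (F i)}"
    then show ?thesis using le inner_S by (meson add_le_cancel_right less_imp_le order_trans)
  next
    assume "\<exists>i\<in>{l..<k}. z \<in> gap F i"
    then obtain i where i: "i \<in> {l..<k}" "z \<in> gap F i" by blast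
    then have "HL (i + 1) = \<hh>" using assms(2) by auto
    then have "S z \<le> sad i" "sad i = pv (i + 1) + \<hh>" using S_le_sad i by (auto simp: height_left_def)
    then show ?thesis using le[of "i + 1"] i by auto
  qed
qed

end

locale branching_family = metastable_family +
  assumes not_all_right: "\<exists>k. HR k \<noteq> \<hh>" and not_all_left: "\<exists>k. HL k \<noteq> \<hh>"
begin

sublocale periodic_chain "\<lambda>k. HR k = \<hh>" "\<lambda>k. HL k = \<hh>" u
  using u_pos HR_shift[of _ 1] HL_shift[of _ 1] not_all_right not_all_left by unfold_locales auto

lemma chain_jumps_eq: "chain_jumps a b F = map_prod F F ` jumps"
  unfolding chain_jumps_def rate_pos_iff jumps_def by force

lemma block_pv:
  assumes "block l r" "i \<in> {l..r}"
  shows "pv i = pv l"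
  using pv_right_travel[of l i] pv_left_travel[of l i] assms by (force simp: block_def)

text \<open>The route of \<open>reach_block\<close> never gains depth value nor climbs more than
  \<hh> above the start. If it loses nothing, all its jumps are between equal depths and hence
  reversible, which forces k to belong to the block reached.\<close>

lemma travel_to_block:
  "\<exists>l r. block l r \<and> pv l \<le> pv k \<and> (k \<in> {l..r} \<or> pv l < pv k) \<and>
    (\<forall>x\<in>F k. \<forall>y\<in>F l. \<forall>z\<in>{min x y..max x y}. S z \<le> pv k + \<hh>)"
proof -
  obtain r0 l0 r1 where *: "k \<le> r0" "l0 \<le> r0" "r1 \<le> r0" "\<forall>i\<in>{k..<r0}. HR i = \<hh>" "\<forall>i\<in>{l0<..r0}. HL i = \<hh>"
    "block l0 r1"
    using reach_block[of k] by blast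
  have 1: "pv r0 \<le> pv k" using pv_right_travel * by blast
  have 2: "pv l0 \<le> pv r0" using pv_left_travel * by blast
  have "S z \<le> pv k + \<hh>" if "x \<in> F k" "y \<in> F l0" "z \<in> {min x y..max x y}" for x y z
  proof (cases "l0 \<le> k")
    case True
    have "y \<le> x \<or> l0 = k" using F_less[of l0 k y x] that True by fastforce
    have a1: "Min (F l0) \<le> z"
    proof -
      have "Min (F l0) \<le> y" using that(2) by simp
      moreover have "Min (F l0) \<le> x" using F_less[of l0 k "Min (F l0)" x] that(1) True F_Min_in
        by (cases "l0 = k") auto
      ultimately show ?thesis using that(3) by auto
    qed
    have a2: "z \<le> Max (F r0)"
    proof -
      have "x \<le> Max (F r0)" using F_less[of k r0 x "Max (F r0)"] that(1) *(1) F_Max_in by (cases "k = r0") auto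
      moreover have "y \<le> Max (F r0)" using F_less[of l0 r0 y "Max (F r0)"] that(2) *(2) F_Max_in by (cases "l0 = r0") auto
      ultimately show ?thesis using that(3) by auto
    qed
    show ?thesis using S_left_travel[of l0 r0 z] a1 a2 * 1 by fastforce
  next
    case False
    have a1: "Min (F k) \<le> z"
    proof -
      have "Min (F k) \<le> x" using that(1) by simp
      moreover have "Min (F k) \<le> y" using F_less[of k l0 "Min (F k)" y] that(2) False F_Min_in by auto
      ultimately show ?thesis using that(3) by auto
    qed
    have a2: "z \<le> Max (F r0)"
    proof -
      have "x \<le> Max (F r0)" using F_less[of k r0 x "Max (F r0)"] that(1) *(1) F_Max_in by (cases "k = r0") auto
      moreover have "y \<le> Max (F r0)" using F_less[of l0 r0 y "Max (F r0)"] that(2) *(2) F_Max_in by (cases "l0 = r0") auto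
      ultimately show ?thesis using that(3) by auto
    qed
    show ?thesis using S_right_travel[of k r0 z] a1 a2 * by fastforce
  qed
  moreover have "pv l0 < pv k" if "k \<notin> {l0..r1}"
  proof (rule ccontr)
    assume "\<not> pv l0 < pv k"
    then have eq: "pv r0 = pv k" "pv l0 = pv k" using 1 2 by auto
    have c1: "pv i = pv k" if "i \<in> {k..r0}" for i
    proof -
      have "pv i \<le> pv k" "pv r0 \<le> pv i" using pv_right_travel[of k i] pv_right_travel[of i r0] * that by auto
      then show ?thesis using eq by simp
    qed
    have c2: "pv i = pv k" if "i \<in> {l0..r0}" for i
    proof -
      have "pv i \<le> pv r0" "pv l0 \<le> pv i" using pv_left_travel[of l0 i] pv_left_travel[of i r0] * that by auto
      then show ?thesis using eq by simp
    qed
    show False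
    proof (cases "l0 \<le> k")
      case True
      \<comment> \<open>Equal depths make the left jumps reversible, so the block extends up to r0
        and contains k.\<close>
      have "HR i = \<hh>" if "i \<in> {l0..<r0}" for i
        using left_eq[of i] c2[of i] c2[of "i + 1"] *(5) that by auto
      then have "r1 = r0" using *(3,6) by (force simp: block_def)
      then show False using that True *(1) by simp
    next
      case False
      \<comment> \<open>Here l0 was crossed on the way to the right; reversing the jump into l0
        contradicts that l0 is blocked to the left.\<close>
      then have "HR (l0 - 1) = \<hh>" "pv (l0 - 1) = pv l0" using *(2,4) c1[of "l0 - 1"] c1[of l0] by auto
      then have "HL l0 = \<hh>" using right_eq[of "l0 - 1"] by simp
      then show False using *(6) by (simp add: block_def)
    qed
  qed
  ultimately show ?thesis using *(6) 1 2 by (intro exI[of _ l0] exI[of _ r1]) auto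
qed

text \<open>Within a block all depths agree and all crossings cost \<hh>, so the union over a block
  behaves like one set at the next level. The point is that the lowest barrier strictly
  increases.\<close>

lemma next_family:
  assumes en: "enumerates e \<rho> u'"
  defines "G \<equiv> \<lambda>k. \<Union> (F ` {e k..\<rho> k})"
  shows "metastable_family a b N m \<sigma> G u'"
proof -
  have e: "e k < e (k + 1)" "block (e k) (\<rho> k)" "block l r \<Longrightarrow> \<exists>k. l = e k \<and> r = \<rho> k"
    "e (k + int u') = e k + int u" "\<rho> (k + int u') = \<rho> k + int u" "1 \<le> u'" for k l r
    using en by (auto simp: enumerates_def)
  have le: "e k \<le> \<rho> k" for k using e(2)[of k] by (simp add: block_def)
  have lt: "\<rho> k < e (k + 1)" for k using block_order[OF e(2) e(2) e(1)] .
  have pvG: "S x = pv (e k)" if "x \<in> G k" for x k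
    using that block_pv[OF e(2)] S_F by (fastforce simp: G_def)
  interpret G: family a b N m \<sigma> G u'
  proof
    show "1 \<le> u'" by (rule e)
    show "G (k + int u') = (\<lambda>x. x + 1) ` G k" for k
    proof -
      have "{e (k + int u')..\<rho> (k + int u')} = (\<lambda>i. i + int u) ` {e k..\<rho> k}"
        unfolding e(4,5) by (rule image_add_atLeastAtMost'[symmetric])
      then show ?thesis unfolding G_def by (simp only: image_image image_UN F_shift1)
    qed
    show "finite (G k)" "G k \<subseteq> Mins" for k using F_Mins by (auto simp: G_def)
    show "G k \<noteq> {}" for k using le[of k] by (auto simp: G_def)
    show "x < y" if xy: "x \<in> G k" "y \<in> G (k + 1)" for x y k
    proof -
      obtain i j where "i \<in> {e k..\<rho> k}" "x \<in> F i" "j \<in> {e (k + 1)..\<rho> (k + 1)}" "y \<in> F j"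
        using xy by (auto simp: G_def)
      then show ?thesis using lt[of k] by (intro F_less[of i j]) auto
    qed
    show "S x = S y" if "x \<in> G k" "y \<in> G k" for x y k using pvG that by metis
  qed
  have Gsub: "F (e k) \<subseteq> G k" "F (\<rho> k) \<subseteq> G k" for k using le[of k] by (auto simp: G_def)
  have pv_G: "G.pv k = pv (e k)" "G.pv k = pv (\<rho> k)" for k
  proof -
    show 1: "G.pv k = pv (e k)" using pvG[OF G.F_Min_in] G.S_F[OF G.F_Min_in] by metis
    show "G.pv k = pv (\<rho> k)" using block_pv[OF e(2), of "\<rho> k" k] le[of k] 1 by simp
  qed
  \<comment> \<open>The gap between two consecutive new sets contains the old gaps adjacent to both
    of them.\<close>
  have sad1: "sad (\<rho> k) \<le> G.sad k" "sad (e (k + 1) - 1) \<le> G.sad k" for k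
  proof -
    have l1: "Max (G k) \<le> Max (F (\<rho> k))"
    proof -
      obtain i where i: "i \<in> {e k..\<rho> k}" "Max (G k) \<in> F i" using G.F_Max_in[of k] by (auto simp: G_def)
      show ?thesis
      proof (cases "i = \<rho> k")
        case True then show ?thesis using i(2) by (intro Max_ge) simp_all
      next
        case False then show ?thesis
          using F_less[of i "\<rho> k" "Max (G k)" "Max (F (\<rho> k))"] F_Max_in i by force
      qed
    qed
    have l2: "Min (F (e (k + 1))) \<le> Min (G (k + 1))"
    proof -
      obtain i where i: "i \<in> {e (k+1)..\<rho> (k+1)}" "Min (G (k+1)) \<in> F i" using G.F_Min_in[of "k+1"] by (auto simp: G_def)
      show ?thesis
      proof (cases "i = e (k+1)")
        case True then show ?thesis using i(2) by (intro Min_le) simp_all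
      next
        case False then show ?thesis
          using F_less[of "e (k+1)" i "Min (F (e (k+1)))" "Min (G (k+1))"] F_Min_in i by force
      qed
    qed
    have l3: "Max (F (\<rho> k)) \<le> Max (F (e (k+1) - 1))"
      using F_less[of "\<rho> k" "e (k+1) - 1" "Max (F (\<rho> k))" "Max (F (e (k+1) - 1))"] lt[of k] F_Max_in
      by (cases "\<rho> k = e (k+1) - 1") auto
    have l4: "Min (F (\<rho> k + 1)) \<le> Min (F (e (k+1)))"
      using F_less[of "\<rho> k + 1" "e (k+1)" "Min (F (\<rho> k + 1))" "Min (F (e (k+1)))"] lt[of k] F_Min_in
      by (cases "\<rho> k + 1 = e (k+1)") auto
    obtain x where x: "x \<in> gap F (\<rho> k)" "sad (\<rho> k) = S x" using saddle_ex by blast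
    have "x \<in> gap G k" using x(1) l1 l2 l4 unfolding gap_def atLeastAtMost_iff by linarith
    then show "sad (\<rho> k) \<le> G.sad k" using x(2) G.S_le_sad by simp
    obtain x where x: "x \<in> gap F (e (k+1) - 1)" "sad (e (k+1) - 1) = S x" using saddle_ex by blast
    have "e (k+1) - 1 + 1 = e (k+1)" by simp
    then have "x \<in> gap G k" using x(1) l1 l2 l3 unfolding gap_def atLeastAtMost_iff by (metis order_trans)
    then show "sad (e (k + 1) - 1) \<le> G.sad k" using x(2) G.S_le_sad by simp
  qed
  \<comment> \<open>At the ends of a block the outward barrier is not the lowest one, hence exceeds
    \<hh>. This strict gain turns the bounds by \<hh> obtained along old routes into the strict
    bounds of the invariant.\<close>
  have hh_less: "\<hh> < G.\<hh>"
  proof -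
    have "\<hh> < G.HR k" for k
    proof -
      have "\<hh> < HR (\<rho> k)" using hh_le[of "\<rho> k"] e(2)[of k] by (simp add: block_def le_less)
      then show ?thesis using sad1(1)[of k] by (simp add: height_right_def pv_G(2))
    qed
    moreover have "\<hh> < G.HL k" for k
    proof -
      have "\<hh> < HL (e k)" using hh_le[of "e k"] e(2)[of k] by (simp add: block_def le_less)
      then show ?thesis using sad1(2)[of "k - 1"] by (simp add: height_left_def pv_G(1))
    qed
    ultimately show ?thesis using G.hh_attained by metis
  qed
  show ?thesis
  proof
    fix x k y z assume xyz: "x \<in> G k" "y \<in> G k" "z \<in> {x..y}"
    obtain i where i: "i \<in> {e k..\<rho> k}" "x \<in> F i" using xyz by (auto simp: G_def)
    have "Min (F (e k)) \<le> x" using F_less[of "e k" i "Min (F (e k))" x] i F_Min_in by (cases "i = e k") auto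
    obtain j where j: "j \<in> {e k..\<rho> k}" "y \<in> F j" using xyz by (auto simp: G_def)
    have "y \<le> Max (F (\<rho> k))" using F_less[of j "\<rho> k" y "Max (F (\<rho> k))"] j F_Max_in by (cases "j = \<rho> k") auto
    have "S z \<le> pv (e k) + \<hh>"
      using S_right_travel[of "e k" "\<rho> k" z] le e(2)[of k] xyz \<open>Min (F (e k)) \<le> x\<close> \<open>y \<le> Max (F (\<rho> k))\<close>
      by (auto simp: block_def)
    then show "S z - S x < G.\<hh>" using pvG[OF xyz(1)] hh_less by simp
  next
    fix z assume z: "z \<in> Mins" "\<forall>k. z \<notin> G k"
    \<comment> \<open>Treats the sets discarded now. A minimum discarded earlier first descends to a
      set of the old level and continues from there; starting strictly lower, it stays within the
      new bound.\<close>
    have travel: "\<exists>k'. \<exists>y\<in>G k'. S y \<le> S x \<and> ((\<exists>k'. x \<in> G k') \<or> S y < S x) \<and> (\<forall>t\<in>{min x y..max x y}. S t \<le> S x + \<hh>)"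
      if x: "x \<in> F k" for x k
    proof -
      obtain l r where lr: "block l r" "pv l \<le> pv k" "k \<in> {l..r} \<or> pv l < pv k"
        "\<forall>x\<in>F k. \<forall>y\<in>F l. \<forall>z\<in>{min x y..max x y}. S z \<le> pv k + \<hh>"
        using travel_to_block by blast
      obtain k' where k': "l = e k'" "r = \<rho> k'" using e(3)[OF lr(1)] by blast
      obtain y where y: "y \<in> F l" using F_ne by blast
      have "y \<in> G k'" using y Gsub k' by auto
      moreover have "x \<in> G k'" if "k \<in> {l..r}" using that x k' by (auto simp: G_def)
      ultimately show ?thesis using lr x y S_F by (metis)
    qed
    show "\<exists>k. \<exists>y\<in>G k. S y < S z \<and> (\<forall>t\<in>{min z y..max z y}. S t - S z < G.\<hh>)"
    proof (cases "\<exists>k. z \<in> F k")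
      case True
      then obtain k where "z \<in> F k" by blast
      from travel[OF this] obtain k' y where y: "y \<in> G k'" "S y < S z" "\<forall>t\<in>{min z y..max z y}. S t \<le> S z + \<hh>"
        using z(2) by blast
      have "S t - S z < G.\<hh>" if "t \<in> {min z y..max z y}" for t using y(3) that hh_less by fastforce
      then show ?thesis using y by blast
    next
      case False
      then obtain k y where y: "y \<in> F k" "S y < S z" "\<forall>t\<in>{min z y..max z y}. S t - S z < \<hh>"
        using dropped[OF z(1)] by blast
      from travel[OF y(1)] obtain k' w where w: "w \<in> G k'" "S w \<le> S y" "\<forall>t\<in>{min y w..max y w}. S t \<le> S y + \<hh>"
        by blast
      have "S t - S z < G.\<hh>" if "t \<in> {min z w..max z w}" for t
      proof -
        have "t \<in> {min z y..max z y} \<or> t \<in> {min y w..max y w}" using that by (auto simp: min_def max_def split: if_splits)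
        then show ?thesis
        proof
          assume "t \<in> {min z y..max z y}" then show ?thesis using y(3) hh_less by fastforce
        next
          assume "t \<in> {min y w..max y w}"
          then have "S t \<le> S y + \<hh>" using w(3) by blast
          then show ?thesis using hh_less y(2) by simp
        qed
      qed
      moreover have "S w < S z" using w(2) y(2) by simp
      ultimately show ?thesis using w(1) by blast
    qed
  qed
qed

text \<open>The description in \<open>next_level\<close> has to be shown to have a unique solution.
  Existence comes from an enumeration of the blocks, uniqueness from the rigidity of increasing
  labellings.\<close>

lemma next_level_family:
  "\<exists>u'. metastable_family a b N m \<sigma> (next_level a b F) u' \<and> u' < u"
proof -
  have "\<exists>k. HR k = \<hh> \<or> HL k = \<hh>" using hh_attained by metis
  from enumerates_ex[OF this] obtain e0 \<rho>0 u' where en0: "enumerates e0 \<rho>0 u'" and u': "u' < u" by blast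
  define G0 where "G0 = (\<lambda>k. \<Union> (F ` {e0 k..\<rho>0 k}))"
  interpret G0: metastable_family a b N m \<sigma> G0 u' unfolding G0_def by (rule next_family[OF en0])
  \<comment> \<open>The enumeration starts at an arbitrary block. Every point has a translate in [0,
    1), where only finitely many minima lie, so a least nonnegative element z exists; relabelling
    from its index c gives the prescribed origin.\<close>
  have "\<exists>z\<in>\<Union> (range G0). 0 \<le> z \<and> (\<forall>y\<in>\<Union> (range G0). 0 \<le> y \<longrightarrow> z \<le> y)"
  proof -
    let ?A = "\<Union> (range G0) \<inter> {0..1}"
    obtain x where x: "x \<in> G0 0" using G0.F_ne by blast
    have "frac x \<in> G0 (0 + (- \<lfloor>x\<rfloor>) * int u')" unfolding G0.F_shift using x by (force simp: frac_def)
    then have ne: "?A \<noteq> {}" using frac_lt_1[of x] frac_ge_0[of x] by force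
    have fin: "finite ?A" by (rule finite_subset[OF _ finite_Mins[of 0 1]]) (use G0.F_Mins in auto)
    have "Min ?A \<in> ?A" using fin ne by (rule Min_in)
    moreover have "Min ?A \<le> y" if "y \<in> \<Union> (range G0)" "0 \<le> y" for y
    proof (cases "y \<le> 1")
      case True then show ?thesis using fin that by (intro Min_le) auto
    next
      case False then show ?thesis using \<open>Min ?A \<in> ?A\<close> by auto
    qed
    ultimately show ?thesis by (intro bexI[of _ "Min ?A"]) auto
  qed
  then obtain z c where z: "z \<in> G0 c" "0 \<le> z" "\<forall>y\<in>\<Union> (range G0). 0 \<le> y \<longrightarrow> z \<le> y" by blast
  define e where "e = (\<lambda>k. e0 (k + c))"
  define \<rho> where "\<rho> = (\<lambda>k. \<rho>0 (k + c))"
  have en: "enumerates e \<rho> u'" unfolding e_def \<rho>_def by (rule enumerates_translate[OF en0])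
  define G where "G = (\<lambda>k. \<Union> (F ` {e k..\<rho> k}))"
  interpret G: metastable_family a b N m \<sigma> G u' unfolding G_def by (rule next_family[OF en])
  have GG0: "G k = G0 (k + c)" for k by (simp add: G_def G0_def e_def \<rho>_def)
  have rGG0: "range G = range G0"
  proof
    show "range G0 \<subseteq> range G"
    proof
      fix A assume "A \<in> range G0"
      then obtain k where "A = G0 k" by blast
      then have "A = G (k - c)" by (simp add: GG0)
      then show "A \<in> range G" by blast
    qed
  qed (auto simp: GG0)
  have zG: "z \<in> G 0" "\<forall>y\<in>\<Union> (range G). 0 \<le> y \<longrightarrow> z \<le> y" using z rGG0 by (auto simp: GG0)
  have rangeG: "{\<Union> C |C. closed_irreducible (range F) (chain_jumps a b F) C} = range G"
  proof -
    have "(\<exists>l r. block l r \<and> C = F ` {l..r}) \<longleftrightarrow> (\<exists>k. C = F ` {e k..\<rho> k})" for C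
      using en unfolding enumerates_def by metis
    then have "closed_irreducible (range F) (chain_jumps a b F) C \<longleftrightarrow> (\<exists>k. C = F ` {e k..\<rho> k})" for C
      unfolding chain_jumps_eq closed_irreducible_image[OF inj_F] closed_irreducible_iff_block by metis
    then show ?thesis by (auto simp: G_def)
  qed
  have "next_level a b F = G"
    unfolding next_level_def rangeG
  proof (rule the_equality)
    show "range G = range G \<and> (\<forall>k. \<forall>x\<in>G k. \<forall>y\<in>G (k + 1). x < y) \<and>
      (\<exists>z\<in>G 0. 0 \<le> z \<and> (\<forall>y\<in>\<Union> (range G). 0 \<le> y \<longrightarrow> z \<le> y))"
      using G.F_step z(2) zG by blast
    \<comment> \<open>Another solution is G composed with an increasing surjection t, that is, a
      translation of the labels; both zeroth sets contain z, so t is the identity.\<close>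
    fix G' :: "int \<Rightarrow> real set"
    assume G': "range G' = range G \<and> (\<forall>k. \<forall>x\<in>G' k. \<forall>y\<in>G' (k + 1). x < y) \<and>
      (\<exists>z\<in>G' 0. 0 \<le> z \<and> (\<forall>y\<in>\<Union> (range G'). 0 \<le> y \<longrightarrow> z \<le> y))"
    have "\<forall>k::int. \<exists>j::int. G' k = G j" using G' by (metis rangeE rangeI)
    then obtain t :: "int \<Rightarrow> int" where t: "\<And>k. G' k = G (t k)" by metis
    have mono: "t k < t (k + 1)" for k
    proof (rule ccontr)
      assume "\<not> t k < t (k + 1)"
      obtain x where x: "x \<in> G' k" using t G.F_ne by (metis ex_in_conv)
      obtain y where y: "y \<in> G' (k + 1)" using t G.F_ne by (metis ex_in_conv)
      have "x < y" using G' x y by blast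
      then have "t k = t (k + 1)" using \<open>\<not> t k < t (k + 1)\<close> G.F_less[of "t (k + 1)" "t k" y x] x y t
        by (metis linorder_neqE_linordered_idom not_less_iff_gr_or_eq)
      then have "x \<in> G' (k + 1)" using x t by simp
      then show False using G' x by blast
    qed
    have "surj t"
    proof (rule surjI)
      fix j
      show "t (SOME k. G' k = G j) = j"
      proof -
        have "\<exists>k. G' k = G j" using G' by (metis rangeE rangeI)
        then have "G' (SOME k. G' k = G j) = G j" by (rule someI_ex)
        then show ?thesis using t G.inj_F by (metis injD)
      qed
    qed
    then have sh: "t k = t 0 + k" for k :: int using int_strict_mono_surj_shift mono by blast
    obtain z' where z': "z' \<in> G' 0" "0 \<le> z'" "\<forall>y\<in>\<Union> (range G'). 0 \<le> y \<longrightarrow> z' \<le> y" using G' by blast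
    have rr: "\<Union> (range G') = \<Union> (range G)" using G' by simp
    have "z' \<le> z" using z'(3) zG(1) z(2) unfolding rr by blast
    moreover have "z \<le> z'" using zG(2) z'(1,2) unfolding rr[symmetric] by blast
    ultimately have "z \<in> G (t 0)" using z'(1) t by simp
    then have "t 0 = 0" using G.F_disjoint zG(1) by blast
    then have "t k = k" for k :: int using sh[of k] by linarith
    then show "G' = G" using t by (intro ext) metis
  qed
  then show ?thesis using G.metastable_family_axioms u' by metis
qed

end

section \<open>The projected chain when all jumps in one direction are possible\<close>

context metastable_family
begin

abbreviation unique_class :: bool where
  "unique_class \<equiv> (\<exists>!C. closed_irreducible (proj_states F) (proj_jumps a b F) C)"

lemma unique_classI:
  assumes "\<And>k. (proj_jumps a b F)\<^sup>* `` {P k} = range P"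
  shows unique_class
proof (rule ex1I)
  show "closed_irreducible (proj_states F) (proj_jumps a b F) (range P)"
    using assms by (auto simp: closed_irreducible_def proj_states_eq)
  show "C = range P" if C: "closed_irreducible (proj_states F) (proj_jumps a b F) C" for C
  proof -
    obtain k where "P k \<in> C" using C by (force simp: closed_irreducible_def proj_states_eq)
    then have "(proj_jumps a b F)\<^sup>* `` {P k} = C" using C unfolding closed_irreducible_def by blast
    then show ?thesis using assms by simp
  qed
qed

text \<open>The projected chain can then run around the whole circle. Read contrapositively, failure
  of uniqueness supplies a blocked jump in each direction, which is what the construction of the
  next level requires.\<close>

lemma unique_class_if_all_right:
  assumes "\<And>k. HR k = \<hh>"
  shows unique_class
proof (rule unique_classI)
  fix k
  let ?E = "proj_jumps a b F"
  have step: "(P k, P (k + 1)) \<in> ?E" for k using rate_pos_iff assms by (auto simp: proj_jumps_def)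
  have reach: "(P k, P (k + int n)) \<in> ?E\<^sup>*" for n
  proof (induction n)
    case (Suc n)
    then show ?case using step[of "k + int n"] by (auto simp: algebra_simps intro: rtrancl_into_rtrancl)
  qed simp
  have "(P k, P l) \<in> ?E\<^sup>*" for l
  proof -
    \<comment> \<open>Moving the target l by |l - k| periods puts it to the right of k without
      changing the projected state.\<close>
    have "\<bar>l - k\<bar> * 1 \<le> \<bar>l - k\<bar> * int u" using u_pos by (intro mult_left_mono) auto
    then have "k \<le> l + \<bar>l - k\<bar> * int u" by (smt (verit))
    then have "k + int (nat (l + \<bar>l - k\<bar> * int u - k)) = l + \<bar>l - k\<bar> * int u" by simp
    then show ?thesis using reach[of "nat (l + \<bar>l - k\<bar> * int u - k)"] P_shift by simp
  qed
  moreover have "?E\<^sup>* `` {P k} \<subseteq> range P"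
  proof
    fix y assume "y \<in> ?E\<^sup>* `` {P k}"
    then have "(P k, y) \<in> ?E\<^sup>*" by simp
    then show "y \<in> range P" by induction (auto simp: proj_jumps_def)
  qed
  ultimately show "?E\<^sup>* `` {P k} = range P" by auto
qed

lemma unique_class_if_all_left:
  assumes "\<And>k. HL k = \<hh>"
  shows unique_class
proof (rule unique_classI)
  fix k
  let ?E = "proj_jumps a b F"
  have step: "(P k, P (k - 1)) \<in> ?E" for k using rate_pos_iff assms by (auto simp: proj_jumps_def)
  have reach: "(P k, P (k - int n)) \<in> ?E\<^sup>*" for n
  proof (induction n)
    case (Suc n)
    then show ?case using step[of "k - int n"] by (auto simp: algebra_simps intro: rtrancl_into_rtrancl)
  qed simp
  have "(P k, P l) \<in> ?E\<^sup>*" for l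
  proof -
    have "\<bar>l - k\<bar> * 1 \<le> \<bar>l - k\<bar> * int u" using u_pos by (intro mult_left_mono) auto
    then have "l + (- \<bar>l - k\<bar>) * int u \<le> k" by (smt (verit) mult_minus_left)
    then have "k - int (nat (k - (l + (- \<bar>l - k\<bar>) * int u))) = l + (- \<bar>l - k\<bar>) * int u" by simp
    then show ?thesis using reach[of "nat (k - (l + (- \<bar>l - k\<bar>) * int u))"] P_shift by metis
  qed
  moreover have "?E\<^sup>* `` {P k} \<subseteq> range P"
  proof
    fix y assume "y \<in> ?E\<^sup>* `` {P k}"
    then have "(P k, y) \<in> ?E\<^sup>*" by simp
    then show "y \<in> range P" by induction (auto simp: proj_jumps_def)
  qed
  ultimately show "?E\<^sup>* `` {P k} = range P" by auto
qed

end

section \<open>Induction over the levels\<close>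

context landscape
begin

text \<open>The sets are single points and no minimum has been discarded yet, so both parts of the
  invariant are immediate.\<close>

lemma level_one_family: "metastable_family a b N m \<sigma> (\<lambda>k. {m k}) N"
proof -
  interpret family a b N m \<sigma> "\<lambda>k. {m k}" N
  proof
    show "x < y" if "x \<in> {m k}" "y \<in> {m (k + 1)}" for x y k
      using that m_\<sigma>[of k] m_\<sigma>[of "k + 1"] by simp
  qed (use N_pos m_shift range_m in auto)
  show ?thesis
  proof
    show "S z - S x < \<hh>" if "x \<in> {m k}" "y \<in> {m k}" "z \<in> {x..y}" for x y z k
      using that hh_pos by simp
  qed (use range_m in auto)
qed

text \<open>As long as the projected chain has no unique closed class the next level exists and has
  fewer sets per period; the bound u + q \<le> N records this loss.\<close>

lemma level_family:
  assumes "\<And>p. 1 \<le> p \<Longrightarrow> p \<le> q \<Longrightarrow>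
    \<not> (\<exists>!C. closed_irreducible (proj_states (level a b m p)) (proj_jumps a b (level a b m p)) C)"
  shows "\<exists>u. metastable_family a b N m \<sigma> (level a b m (Suc q)) u \<and> u + q \<le> N"
  using assms
proof (induction q)
  case 0
  have "level a b m (Suc 0) = (\<lambda>k. {m k})" by simp
  then show ?case using level_one_family by (intro exI[of _ N]) simp
next
  case (Suc q)
  have "\<exists>u. metastable_family a b N m \<sigma> (level a b m (Suc q)) u \<and> u + q \<le> N"
    by (rule Suc.IH, rule Suc.prems) auto
  then obtain u where u: "metastable_family a b N m \<sigma> (level a b m (Suc q)) u" "u + q \<le> N" by blast
  interpret F: metastable_family a b N m \<sigma> "level a b m (Suc q)" u by (rule u(1))
  have nu: "\<not> F.unique_class" by (rule Suc.prems) auto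
  interpret F: branching_family a b N m \<sigma> "level a b m (Suc q)" u
  proof
    show "\<exists>k. F.HR k \<noteq> F.\<hh>" using F.unique_class_if_all_right nu by metis
    show "\<exists>k. F.HL k \<noteq> F.\<hh>" using F.unique_class_if_all_left nu by metis
  qed
  obtain u' where u': "metastable_family a b N m \<sigma> (next_level a b (level a b m (Suc q))) u'" "u' < u"
    using F.next_level_family by blast
  have "level a b m (Suc (Suc q)) = next_level a b (level a b m (Suc q))" by simp
  then show ?case using u' u(2) by (intro exI[of _ u']) (simp del: level.simps)
qed

lemma final_level_family:
  "\<exists>u. metastable_family a b N m \<sigma> (level a b m (final_level a b m)) u"
proof -
  let ?U = "\<lambda>p. 1 \<le> p \<and>
    (\<exists>!C. closed_irreducible (proj_states (level a b m p)) (proj_jumps a b (level a b m p)) C)"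
  have "\<exists>p. ?U p"
  proof (rule ccontr)
    assume no: "\<nexists>p. ?U p"
    \<comment> \<open>After N steps no set would be left, although every level has at least
      one.\<close>
    have "\<exists>u. metastable_family a b N m \<sigma> (level a b m (Suc N)) u \<and> u + N \<le> N"
    proof (rule level_family)
      fix p :: nat assume "1 \<le> p"
      then show "\<not> (\<exists>!C. closed_irreducible (proj_states (level a b m p)) (proj_jumps a b (level a b m p)) C)"
        using no by metis
    qed
    then obtain u where u: "metastable_family a b N m \<sigma> (level a b m (Suc N)) u" "u + N \<le> N" by blast
    then interpret metastable_family a b N m \<sigma> "level a b m (Suc N)" u by simp
    show False using u(2) u_pos by simp
  qed
  then have U: "?U (final_level a b m)" unfolding final_level_def by (rule LeastI_ex)
  then obtain q where q: "final_level a b m = Suc q" by (cases "final_level a b m") auto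
  have "\<exists>u. metastable_family a b N m \<sigma> (level a b m (Suc q)) u \<and> u + q \<le> N"
  proof (rule level_family)
    fix p :: nat assume p: "1 \<le> p" "p \<le> q"
    then have "\<not> ?U p" using not_less_Least[of p ?U] q unfolding final_level_def by linarith
    then show "\<not> (\<exists>!C. closed_irreducible (proj_states (level a b m p)) (proj_jumps a b (level a b m p)) C)"
      using p by metis
  qed
  then show ?thesis unfolding q by blast
qed

end

section \<open>Barriers in the nonreversible case\<close>

definition near :: "real \<Rightarrow> real set \<Rightarrow> real set" where
  "near r A = (\<Union>x\<in>A. {x - r..x + r})"

lemma compact_near: "finite A \<Longrightarrow> compact (near r A)"
  by (auto simp: near_def intro!: compact_UN)

lemma integrable_on_compact:
  fixes f :: "real \<Rightarrow> real"
  assumes "compact K" "continuous_on K f"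
  shows "f integrable_on K"
proof -
  have "set_integrable lborel K f"
    unfolding set_integrable_def using assms by (rule borel_integrable_compact)
  then show ?thesis using set_borel_integral_eq_integral(1) by blast
qed

lemma integral_abs_le:
  fixes f :: "real \<Rightarrow> real"
  assumes "f integrable_on {p..q}" "p \<le> q" "\<And>x. x \<in> {p..q} \<Longrightarrow> \<bar>f x\<bar> \<le> C"
  shows "\<bar>integral {p..q} f\<bar> \<le> C * (q - p)"
proof -
  have "0 \<le> C" using assms(3)[of p] assms(2) by (metis abs_ge_zero atLeastAtMost_iff order_refl order_trans)
  then show ?thesis
    using has_integral_bound_real[of C "{}" f "integral {p..q} f" p q] assms
    by (simp add: integrable_integral content_real)
qed

locale nonreversible_family = metastable_family +
  assumes B_pos: "0 < B" and all_right: "HR k = \<hh>"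
begin

text \<open>\<open>J k\<close> consists of the sets that can be reached from \<open>k\<close> by left jumps, because the depth is
  monotone in the index.\<close>

definition J :: "int \<Rightarrow> int set" where "J k = {j. j \<le> k \<and> pv j = pv k}"
definition Q :: "int \<Rightarrow> real set" where "Q k = \<Union> (F ` J k)"
text \<open>The reference point of the set k. The segments from \<open>ends k\<close> to
  \<open>ends (k + 1)\<close> tile the line, and each contains exactly one passage.\<close>

definition ends :: "int \<Rightarrow> real" where "ends k = Min (F k)"

lemma sad_eq: "sad k = pv k + \<hh>"
  using all_right[of k] by (simp add: height_right_def)

lemma pv_antimono: "k \<le> l \<Longrightarrow> pv l \<le> pv k"
  using pv_right_travel all_right by blast

lemma J_self: "k \<in> J k" by (simp add: J_def)

text \<open>One period to the left the depth value is higher by B > 0, so no set of equal depth lies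
  that far away.\<close>

lemma J_bounds: "J k \<subseteq> {k - int u<..k}"
proof -
  have "pv k < pv j" if "j \<le> k - int u" for j
    using pv_antimono[OF that] pv_shift[of k "-1"] B_pos by simp
  then have "\<not> j \<le> k - int u" if "j \<in> J k" for j using that unfolding J_def by force
  moreover have "j \<le> k" if "j \<in> J k" for j using that by (simp add: J_def)
  ultimately show ?thesis by (intro subsetI) (simp add: not_le)
qed

lemma finite_J: "finite (J k)"
  using J_bounds by (rule finite_subset) simp

lemma finite_Q: "finite (Q k)"
  using finite_J by (simp add: Q_def)

lemma J_rec: "J k = insert k (if pv (k - 1) = pv k then J (k - 1) else {})"
proof -
  have "j \<in> J k \<longleftrightarrow> j = k \<or> pv (k - 1) = pv k \<and> j \<in> J (k - 1)" for j
    using pv_antimono[of j "k - 1"] pv_antimono[of "k - 1" k] by (auto simp: J_def)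
  then show ?thesis by auto
qed

lemma HL_eq_iff: "HL k = \<hh> \<longleftrightarrow> pv (k - 1) = pv k"
  using sad_eq[of "k - 1"] by (auto simp: height_left_def)

lemma S_Q: "q \<in> Q k \<Longrightarrow> S q = pv k"
  using S_F by (force simp: Q_def J_def)

lemma S_W: "s \<in> W k \<Longrightarrow> S s = sad k"
  by (simp add: saddles_def)

lemma F_eventually_right: "\<exists>r\<ge>k. s \<le> Max (F r)"
proof -
  define n where "n = max 0 \<lceil>s - Max (F k)\<rceil>"
  have "s \<le> Max (F (k + n * int u))" unfolding Max_shift n_def by linarith
  moreover have "k \<le> k + n * int u" by (simp add: n_def)
  ultimately show ?thesis by blast
qed

text \<open>Going right from F j, the point s lies either in the hull of a later set, where S stays
  strictly below depth plus \<hh>, or in a gap, where S is at most depth plus \<hh>. Depth values do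
  not increase to the right, so equality needs a saddle and an unchanged depth.\<close>

lemma barrier_from_F:
  assumes "y \<in> F j" "y \<le> s"
  shows "S s - S y \<le> \<hh>" "S s - S y = \<hh> \<Longrightarrow> \<exists>k. s \<in> W k \<and> j \<in> J k"
proof -
  obtain r where r: "r \<ge> j" "s \<le> Max (F r)" using F_eventually_right by blast
  have "Min (F j) \<le> y" using assms(1) by (intro Min_le) simp_all
  then have "Min (F j) \<le> s" using assms(2) by linarith
  then have "s \<in> {Min (F j)..Max (F r)}" using r(2) unfolding atLeastAtMost_iff by blast
  from cover[OF r(1) this] have "S s - S y \<le> \<hh> \<and> (S s - S y = \<hh> \<longrightarrow> (\<exists>k. s \<in> W k \<and> j \<in> J k))"
  proof
    assume "\<exists>i\<in>{j..r}. s \<in> {Min (F i)..Max (F i)}"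
    then obtain i where i: "i \<ge> j" "s \<in> {Min (F i)..Max (F i)}" by (meson atLeastAtMost_iff)
    have "S s < pv i + \<hh>" by (rule inner_S[OF i(2)])
    moreover have "pv i \<le> S y" using pv_antimono[OF i(1)] S_F[OF assms(1)] by simp
    ultimately show ?thesis by simp
  next
    assume "\<exists>i\<in>{j..<r}. s \<in> gap F i"
    then obtain i where i: "i \<ge> j" "s \<in> gap F i" by (meson atLeastLessThan_iff)
    have "S s \<le> pv i + \<hh>" using S_le_sad[OF i(2)] sad_eq by simp
    moreover have "pv i \<le> S y" using pv_antimono[OF i(1)] S_F[OF assms(1)] by simp
    moreover have "s \<in> W i \<and> j \<in> J i" if "S s = sad i" "pv i = S y"
      using that i S_F[OF assms(1)] by (auto simp: saddles_def J_def)
    ultimately show ?thesis using sad_eq[of i]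
      by (smt (verit, best))
  qed
  then show "S s - S y \<le> \<hh>" "S s - S y = \<hh> \<Longrightarrow> \<exists>k. s \<in> W k \<and> j \<in> J k" by auto
qed

text \<open>A discarded minimum y is joined to a strictly lower point y' of the family below height
  S y + \<hh>. If s is not beyond y', that bound applies at s; otherwise the bound from y'
  does.\<close>

lemma barrier_from_Mins:
  assumes "y \<in> Mins" "y \<le> s"
  shows "S s - S y \<le> \<hh>" "S s - S y = \<hh> \<Longrightarrow> \<exists>k. s \<in> W k \<and> y \<in> Q k"
proof -
  have "S s - S y \<le> \<hh> \<and> (S s - S y = \<hh> \<longrightarrow> (\<exists>k. s \<in> W k \<and> y \<in> Q k))"
  proof (cases "\<exists>j. y \<in> F j")
    case True
    then show ?thesis using barrier_from_F assms(2) by (fastforce simp: Q_def)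
  next
    case False
    then obtain j y' where y': "y' \<in> F j" "S y' < S y" "\<forall>t\<in>{min y y'..max y y'}. S t - S y < \<hh>"
      using dropped[OF assms(1)] by blast
    have "S s - S y < \<hh>"
    proof (cases "y' \<le> s")
      case True
      then show ?thesis using barrier_from_F(1)[OF y'(1) True] y'(2) by simp
    next
      case False
      then show ?thesis using y'(3) assms(2) by auto
    qed
    then show ?thesis by simp
  qed
  then show "S s - S y \<le> \<hh>" "S s - S y = \<hh> \<Longrightarrow> \<exists>k. s \<in> W k \<and> y \<in> Q k" by auto
qed

text \<open>A shift to the left by a whole period does not lower S, so the infimum over the
  half-line is already attained within the last period.\<close>

lemma min_left_of:
  "\<exists>y\<le>s. \<forall>z\<le>s. S y \<le> S z"
proof -
  obtain y where y: "y \<in> {s-1..s}" "\<forall>z\<in>{s-1..s}. S y \<le> S z"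
    using continuous_attains_inf[of "{s-1..s}" S] S_cont by auto
  have "S y \<le> S z" if "z \<le> s" for z
  proof -
    define n where "n = \<lfloor>s - z\<rfloor>"
    have "z + of_int n \<in> {s-1..s}" unfolding n_def atLeastAtMost_iff by linarith
    then have "S y \<le> S (z + of_int n)" using y by blast
    also have "\<dots> \<le> S z" using that B_nonneg by (simp add: S_shift n_def)
    finally show ?thesis .
  qed
  then show ?thesis using y by auto
qed

lemma left_min_in_Mins:
  assumes "y < s" "\<forall>z\<le>s. S y \<le> S z"
  shows "y \<in> Mins"
  by (rule local_min_in_Mins[of "s - y"]) (use assms in auto)

text \<open>Compare y with a lowest point x of the half-line left of s. Unless x = s, it is a local
  minimum and the bound for minima applies. Equality forces y itself to be a lowest point, hence a
  minimum.\<close>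

lemma barrier:
  assumes "y \<le> s"
  shows "S s - S y \<le> \<hh>" "S s - S y = \<hh> \<Longrightarrow> \<exists>k. s \<in> W k \<and> y \<in> Q k"
proof -
  obtain x where x: "x \<le> s" "\<forall>z\<le>s. S x \<le> S z" using min_left_of by blast
  have xy: "S x \<le> S y" using x assms by blast
  show le: "S s - S y \<le> \<hh>"
  proof (cases "x = s")
    case True
    then show ?thesis using xy hh_pos by simp
  next
    case False
    then have "S s - S x \<le> \<hh>" using left_min_in_Mins[of x s] x barrier_from_Mins(1)[of x s] by simp
    then show ?thesis using xy by simp
  qed
  assume eq: "S s - S y = \<hh>"
  then have "x \<noteq> s" using xy hh_pos by auto
  then have "S s - S x \<le> \<hh>" using left_min_in_Mins[of x s] x barrier_from_Mins(1)[of x s] by simp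
  then have "S x = S y" using xy eq by simp
  then have "\<forall>z\<le>s. S y \<le> S z" using x by simp
  moreover have "y \<noteq> s" using eq hh_pos by auto
  ultimately have "y \<in> Mins" using left_min_in_Mins[of y s] assms by simp
  then show "\<exists>k. s \<in> W k \<and> y \<in> Q k" using barrier_from_Mins(2)[OF _ assms eq] by blast
qed

lemma W_between: "s \<in> W k \<Longrightarrow> Max (F k) < s \<and> s < Min (F (k + 1))"
  using W_interior[of k] unfolding subset_iff greaterThanLessThan_iff by blast

lemma Min_le_Max: "Min (F k) \<le> Max (F k)"
  by (rule Min_le[OF F_finite F_Max_in])

lemma ends_less: "k < l \<Longrightarrow> Max (F k) < Min (F l)"
  by (rule F_less[OF _ F_Max_in F_Min_in])

lemma W_index:
  assumes "s \<in> W i" "Min (F k) \<le> s" "s \<le> Min (F (k + 1))"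
  shows "i = k"
proof (rule ccontr)
  assume "i \<noteq> k"
  then consider "i < k" | "k < i" by linarith
  then show False
  proof cases
    case 1
    then have "Min (F (i + 1)) \<le> Min (F k)"
      using ends_less[of "i + 1" k] Min_le_Max[of "i + 1"] by (cases "i + 1 = k") (simp, linarith)
    then show False using W_between[OF assms(1)] assms(2) by linarith
  next
    case 2
    then have "Min (F (k + 1)) \<le> Min (F i)"
      using ends_less[of "k + 1" i] Min_le_Max[of "k + 1"] by (cases "k + 1 = i") (simp, linarith)
    then show False using W_between[OF assms(1)] assms(3) Min_le_Max[of i] by linarith
  qed
qed

text \<open>If q were at least one period behind s, then q + 1 would still be left of s and lower
  than q by B, giving a barrier of \<hh> + B. Hence the window from s - 1 to s of the integral
  kernel sees every critical minimum.\<close>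

lemma Q_W_order:
  assumes "q \<in> Q k" "s \<in> W k"
  shows "s - 1 < q" "q < s"
proof -
  obtain j where j: "j \<in> J k" "q \<in> F j" using assms(1) by (auto simp: Q_def)
  have "q \<le> Max (F k)"
  proof (cases "j = k")
    case True then show ?thesis using j(2) by (intro Max_ge) auto
  next
    case False
    then have "j < k" using j(1) by (auto simp: J_def)
    then show ?thesis using F_less[OF _ j(2) F_Max_in] by (simp add: less_imp_le)
  qed
  then show "q < s" using W_between[OF assms(2)] by linarith
  show "s - 1 < q"
  proof (rule ccontr)
    assume "\<not> s - 1 < q"
    then have "S s - S (q + 1) \<le> \<hh>" by (intro barrier) simp
    then show False using S_shift1[of q] S_Q[OF assms(1)] S_W[OF assms(2)] sad_eq[of k] B_pos by simp
  qed
qed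

lemma uniform_barrier:
  assumes "compact K" "K \<subseteq> {(s, y). y \<le> s}" "\<And>s y. (s, y) \<in> K \<Longrightarrow> S s - S y \<noteq> \<hh>"
  shows "\<exists>\<delta>>0. \<forall>(s, y)\<in>K. S s - S y \<le> \<hh> - \<delta>"
proof (cases "K = {}")
  case False
  have "continuous_on K (\<lambda>p. S (fst p) - S (snd p))"
    by (intro continuous_intros continuous_on_compose2[OF S_cont[of UNIV]]) auto
  from continuous_attains_sup[OF assms(1) False this] obtain p where
    p: "p \<in> K" "\<forall>q\<in>K. S (fst q) - S (snd q) \<le> S (fst p) - S (snd p)" by blast
  have "S (fst p) - S (snd p) < \<hh>"
    using barrier(1)[of "snd p" "fst p"] assms(2,3) p(1) by (cases p) force
  then show ?thesis using p(2)
    by (intro exI[of _ "\<hh> - (S (fst p) - S (snd p))"]) auto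
qed (auto intro: exI[of _ 1])

lemma barrier_off_saddles:
  assumes "\<And>k. W k \<inter> {p..q} = {}"
  shows "\<exists>\<delta>>0. \<forall>t\<in>{p..q}. \<forall>y\<in>{t-1..t}. S t - S y \<le> \<hh> - \<delta>"
proof -
  define K where "K = (\<lambda>(t, z). (t, t - z)) ` ({p..q} \<times> {0..1::real})"
  have "compact K" unfolding K_def
    by (intro compact_continuous_image compact_Times continuous_intros) (auto simp: case_prod_unfold intro!: continuous_intros)
  moreover have "S s - S y \<noteq> \<hh>" if "(s, y) \<in> K" for s y
  proof
    assume eq: "S s - S y = \<hh>"
    have "s \<in> {p..q}" "y \<le> s" using that by (auto simp: K_def)
    then show False using barrier(2)[OF _ eq] assms by blast
  qed
  moreover have "K \<subseteq> {(s, y). y \<le> s}" by (auto simp: K_def)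
  ultimately obtain \<delta> where \<delta>: "\<delta> > 0" "\<forall>(s, y)\<in>K. S s - S y \<le> \<hh> - \<delta>"
    using uniform_barrier[of K] by blast
  have "(t, y) \<in> K" if "t \<in> {p..q}" "y \<in> {t-1..t}" for t y
    unfolding K_def using that by (intro image_eqI[of _ _ "(t, t - y)"]) auto
  then show ?thesis using \<delta> by fast
qed

lemma barrier_off_critical_pairs:
  assumes "r > 0"
  shows "\<exists>\<delta>>0. \<forall>t\<in>{ends k..ends (k + 1)}. \<forall>y\<in>{t-1..t}.
    t \<notin> near r (W k) \<or> y \<notin> near r (Q k) \<longrightarrow> S t - S y \<le> \<hh> - \<delta>"
proof -
  define K0 where "K0 = (\<lambda>(t, z). (t, t - z)) ` ({ends k..ends (k + 1)} \<times> {0..1::real})"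
  \<comment> \<open>Open neighbourhoods are removed so that what remains is compact; they are
    contained in the closed intervals of \<open>near\<close>.\<close>
  define O1 where "O1 = (\<Union>s\<in>W k. {s - r<..<s + r})"
  define O2 where "O2 = (\<Union>s\<in>Q k. {s - r<..<s + r})"
  define K where "K = K0 - O1 \<times> O2"
  have "compact K0" unfolding K0_def
    by (intro compact_continuous_image compact_Times continuous_intros) (auto simp: case_prod_unfold intro!: continuous_intros)
  then have "compact K" unfolding K_def O1_def O2_def by (intro compact_diff open_Times) auto
  moreover have "S s - S y \<noteq> \<hh>" if "(s, y) \<in> K" for s y
  proof
    assume eq: "S s - S y = \<hh>"
    have sy: "y \<le> s" "Min (F k) \<le> s" "s \<le> Min (F (k + 1))" using that by (auto simp: K_def K0_def ends_def)
    obtain i where i: "s \<in> W i" "y \<in> Q i" using barrier(2)[OF sy(1) eq] by blast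
    then have "i = k" using W_index sy by blast
    then have "(s, y) \<in> O1 \<times> O2" using i assms by (force simp: O1_def O2_def)
    then show False using that by (simp add: K_def)
  qed
  moreover have "K \<subseteq> {(s, y). y \<le> s}" by (auto simp: K_def K0_def)
  ultimately obtain \<delta> where \<delta>: "\<delta> > 0" "\<forall>(s, y)\<in>K. S s - S y \<le> \<hh> - \<delta>"
    using uniform_barrier[of K] by blast
  have "S t - S y \<le> \<hh> - \<delta>" if "t \<in> {ends k..ends (k + 1)}" "y \<in> {t-1..t}" "t \<notin> near r (W k) \<or> y \<notin> near r (Q k)" for t y
  proof -
    have "(t, y) \<in> K0" unfolding K0_def using that by (intro image_eqI[of _ _ "(t, t - y)"]) auto
    moreover have "O1 \<subseteq> near r (W k)" "O2 \<subseteq> near r (Q k)" unfolding O1_def O2_def near_def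
      by (intro UN_mono order_refl, auto)+
    ultimately have "(t, y) \<in> K" using that(3) by (auto simp: K_def)
    then show ?thesis using \<delta>(2) by blast
  qed
  then show ?thesis using \<delta>(1) by blast
qed

section \<open>The integral kernel and its factorization near critical pairs\<close>

definition kappa :: "real \<Rightarrow> real" where "kappa \<epsilon> = 1 / (1 - exp (- B / \<epsilon>))"

definition kernel :: "real \<Rightarrow> (real \<Rightarrow> real) \<Rightarrow> real \<Rightarrow> real" where
  "kernel \<epsilon> v t = integral {t-1..t} (\<lambda>y. v y * exp ((S t - S y - \<hh>) / \<epsilon>) / a y)"

text \<open>The Laplace integrals over saddles (\<open>alpha\<close>) and over wells
  (\<open>beta\<close>). Each carries a factor 1 / sqrt \<epsilon>; together they absorb the
  prefactor 1/\<epsilon> of g', so the increment of g across a passage is about alpha *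
  beta.\<close>

definition alpha :: "int \<Rightarrow> real \<Rightarrow> real \<Rightarrow> real \<Rightarrow> real" where
  "alpha k r \<epsilon> s = integral ({ends k..s} \<inter> near r (W k)) (\<lambda>t. exp ((S t - sad k) / \<epsilon>)) / sqrt \<epsilon>"

definition beta :: "int \<Rightarrow> real \<Rightarrow> real \<Rightarrow> (real \<Rightarrow> real) \<Rightarrow> real" where
  "beta k r \<epsilon> v = integral (near r (Q k)) (\<lambda>y. v y * exp ((pv k - S y) / \<epsilon>) / a y) / sqrt \<epsilon>"

lemma kappa_pos: "\<epsilon> > 0 \<Longrightarrow> kappa \<epsilon> > 0"
  using B_pos by (simp add: kappa_def)

lemma kappa_tendsto: "(kappa \<longlongrightarrow> 1) (at_right 0)"
proof -
  have "((\<lambda>\<epsilon>. exp (- B / \<epsilon>)) \<longlongrightarrow> 0) (at_right 0)"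
  proof (rule filterlim_compose[OF exp_at_bot])
    show "filterlim (\<lambda>\<epsilon>. - B / \<epsilon>) at_bot (at_right 0)"
      using filterlim_tendsto_neg_mult_at_bot[OF tendsto_const _ filterlim_inverse_at_top_right, of "- B"] B_pos
      by (simp add: divide_inverse)
  qed
  then have "((\<lambda>\<epsilon>. 1 / (1 - exp (- B / \<epsilon>))) \<longlongrightarrow> 1 / (1 - 0)) (at_right 0)"
    by (intro tendsto_intros) auto
  then show ?thesis unfolding kappa_def[abs_def] by simp
qed

lemma a_cont: "continuous_on A a"
  using C2_torusD(4)[OF a_C2] continuous_on_subset by blast

lemma kernel_abs_le:
  assumes v: "continuous_on UNIV v" "\<And>y. \<bar>v y\<bar> \<le> C" and c0: "c0 > 0" "\<And>y. c0 \<le> a y" and eps: "\<epsilon> > 0"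
    and \<delta>: "\<And>y. y \<in> {t-1..t} \<Longrightarrow> S t - S y \<le> \<hh> - \<delta>"
  shows "\<bar>kernel \<epsilon> v t\<bar> \<le> C / c0 * exp (- \<delta> / \<epsilon>)"
proof -
  have "C \<ge> 0" using v(2)[of 0] by simp
  have "\<bar>v y * exp ((S t - S y - \<hh>) / \<epsilon>) / a y\<bar> \<le> C / c0 * exp (- \<delta> / \<epsilon>)" if "y \<in> {t-1..t}" for y
  proof -
    have "exp ((S t - S y - \<hh>) / \<epsilon>) \<le> exp (- \<delta> / \<epsilon>)"
      using \<delta>[OF that] eps unfolding exp_le_cancel_iff by (intro divide_right_mono) auto
    then have "\<bar>v y\<bar> * exp ((S t - S y - \<hh>) / \<epsilon>) / a y \<le> C * exp (- \<delta> / \<epsilon>) / c0"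
      using v(2)[of y] c0(2)[of y] c0(1) \<open>C \<ge> 0\<close> by (intro frac_le mult_mono) auto
    then show ?thesis using a_pos[of y] by (simp add: abs_mult)
  qed
  moreover have "(\<lambda>y. v y * exp ((S t - S y - \<hh>) / \<epsilon>) / a y) integrable_on {t-1..t}"
    using a_pos eps by (intro integrable_continuous_interval continuous_intros S_cont a_cont continuous_on_subset[OF v(1)])
      (auto simp: less_imp_neq[symmetric])
  ultimately show ?thesis unfolding kernel_def
    using integral_abs_le[of _ "t-1" t "C / c0 * exp (- \<delta> / \<epsilon>)"] by simp
qed

text \<open>Since sad k = pv k + \<hh>, the exponent S t - S y - \<hh> splits into S t - sad k and
  pv k - S y. Near a critical pair the double integral thus factorizes; elsewhere the integrand is
  exponentially small.\<close>

lemma kernel_approx: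
  assumes v: "continuous_on UNIV v" "\<And>y. \<bar>v y\<bar> \<le> C" and c0: "c0 > 0" "\<And>y. c0 \<le> a y" and eps: "\<epsilon> > 0"
    and \<delta>: "\<And>y. y \<in> {t-1..t} \<Longrightarrow> t \<notin> near r (W k) \<or> y \<notin> near r (Q k) \<Longrightarrow> S t - S y \<le> \<hh> - \<delta>"
    and sub: "t \<in> near r (W k) \<Longrightarrow> near r (Q k) \<subseteq> {t-1..t}"
  shows "\<bar>kernel \<epsilon> v t - (if t \<in> near r (W k) then exp ((S t - sad k) / \<epsilon>) else 0) * (sqrt \<epsilon> * beta k r \<epsilon> v)\<bar>
    \<le> C / c0 * exp (- \<delta> / \<epsilon>)"
proof (cases "t \<in> near r (W k)")
  case False
  then show ?thesis using kernel_abs_le[OF v c0 eps, of t \<delta>] \<delta> by simp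
next
  case True
  have "C \<ge> 0" using v(2)[of 0] by simp
  let ?f = "\<lambda>y. v y * exp ((S t - S y - \<hh>) / \<epsilon>) / a y"
  let ?g = "\<lambda>y. if y \<in> near r (Q k) then ?f y else 0"
  have cont: "continuous_on A ?f" for A
    using a_pos eps by (intro continuous_intros S_cont a_cont continuous_on_subset[OF v(1)])
      (auto simp: less_imp_neq[symmetric])
  have fint: "?f integrable_on {t-1..t}" by (intro integrable_continuous_interval cont)
  have nint: "?f integrable_on near r (Q k)"
    by (intro integrable_on_compact compact_near finite_Q cont)
  have inter: "near r (Q k) \<inter> {t-1..t} = near r (Q k)" using sub[OF True] by blast
  have gint: "?g integrable_on {t-1..t}"
    using nint integrable_restrict_Int[of "near r (Q k)" ?f "{t-1..t}"] inter by simp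
  have "integral (near r (Q k)) ?f = exp ((S t - sad k) / \<epsilon>) * (sqrt \<epsilon> * beta k r \<epsilon> v)"
  proof -
    have "?f y = exp ((S t - sad k) / \<epsilon>) * (v y * exp ((pv k - S y) / \<epsilon>) / a y)" for y
    proof -
      have "exp ((S t - S y - \<hh>) / \<epsilon>) = exp ((S t - sad k) / \<epsilon>) * exp ((pv k - S y) / \<epsilon>)"
        unfolding mult_exp_exp add_divide_distrib[symmetric] by (simp add: sad_eq)
      then show ?thesis by simp
    qed
    then have "integral (near r (Q k)) ?f = exp ((S t - sad k) / \<epsilon>) *
       integral (near r (Q k)) (\<lambda>y. v y * exp ((pv k - S y) / \<epsilon>) / a y)" by (simp only: integral_mult_right)
    then show ?thesis using eps by (simp add: beta_def)
  qed
  moreover have "integral (near r (Q k)) ?f = integral {t-1..t} ?g"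
    using integral_restrict_Int[of "{t-1..t}" "near r (Q k)" ?f] inter by (simp add: Int_commute)
  ultimately have "kernel \<epsilon> v t - (if t \<in> near r (W k) then exp ((S t - sad k) / \<epsilon>) else 0) * (sqrt \<epsilon> * beta k r \<epsilon> v)
      = integral {t-1..t} (\<lambda>y. ?f y - ?g y)"
    using True by (simp add: kernel_def integral_diff[OF fint gint])
  moreover have "\<bar>?f y - ?g y\<bar> \<le> C / c0 * exp (- \<delta> / \<epsilon>)" if y: "y \<in> {t-1..t}" for y
  proof (cases "y \<in> near r (Q k)")
    case True
    then show ?thesis using \<open>C \<ge> 0\<close> c0 by simp
  next
    case False
    have "exp ((S t - S y - \<hh>) / \<epsilon>) \<le> exp (- \<delta> / \<epsilon>)"
      using \<delta>[OF y] False eps unfolding exp_le_cancel_iff by (intro divide_right_mono) auto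
    then have "\<bar>v y\<bar> * exp ((S t - S y - \<hh>) / \<epsilon>) / a y \<le> C * exp (- \<delta> / \<epsilon>) / c0"
      using v(2)[of y] c0(2)[of y] c0(1) \<open>C \<ge> 0\<close> by (intro frac_le mult_mono) auto
    then show ?thesis using a_pos[of y] False by (simp add: abs_mult)
  qed
  ultimately show ?thesis
    using integral_abs_le[OF integrable_diff[OF fint gint], of "C / c0 * exp (- \<delta> / \<epsilon>)"] by simp
qed

lemma small_radius:
  "eventually (\<lambda>r. (\<forall>t\<in>near r (W k). near r (Q k) \<subseteq> {t-1..t}) \<and> near r (W k) \<subseteq> {ends k..ends (k + 1)} \<and>
     pairwise (\<lambda>x y. {x - r..x + r} \<inter> {y - r..y + r} = {}) (W k) \<and>
     pairwise (\<lambda>x y. {x - r..x + r} \<inter> {y - r..y + r} = {}) (Q k)) (at_right 0)"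
proof -
  have ev: "eventually (\<lambda>r. 2 * r < c) (at_right (0::real))" if "c > 0" for c
    using that by (auto simp: eventually_at_right_field intro!: exI[of _ "c/2"])
  have pair: "eventually (\<lambda>r. pairwise (\<lambda>x y. {x - r..x + r} \<inter> {y - r..y + r} = {}) A) (at_right (0::real))"
    if "finite A" for A :: "real set"
  proof -
    have p: "eventually (\<lambda>r. \<forall>x\<in>A. \<forall>y\<in>A. x \<noteq> y \<longrightarrow> 2 * r < \<bar>x - y\<bar>) (at_right 0)"
    proof (intro eventually_ball_finite that ballI)
      fix x y :: real
      show "eventually (\<lambda>r. x \<noteq> y \<longrightarrow> 2 * r < \<bar>x - y\<bar>) (at_right 0)"
        using ev[of "\<bar>x - y\<bar>"] by (cases "x = y") auto
    qed
    show ?thesis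
      by (rule eventually_mono[OF p]) (force simp: pairwise_def)
  qed
  have 1: "eventually (\<lambda>r. \<forall>s\<in>W k. \<forall>q\<in>Q k. 2 * r < s - q \<and> 2 * r < q - (s - 1)) (at_right 0)"
    using Q_W_order by (intro eventually_ball_finite finite_Q W_finite ballI eventually_conj ev) auto
  have 2: "eventually (\<lambda>r. \<forall>s\<in>W k. 2 * r < s - ends k \<and> 2 * r < ends (k + 1) - s) (at_right 0)"
  proof (intro eventually_ball_finite W_finite ballI eventually_conj ev)
    fix s assume "s \<in> W k"
    from W_between[OF this] show "0 < s - ends k" "0 < ends (k + 1) - s"
      using Min_le_Max[of k] unfolding ends_def by linarith+
  qed
  have 3: "eventually (\<lambda>r. r > 0) (at_right (0::real))" by (simp add: eventually_at_right_less)
  show ?thesis using 1 2 3 pair[OF W_finite, of k] pair[OF finite_Q, of k]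
  proof eventually_elim
    case (elim r)
    have "near r (Q k) \<subseteq> {t-1..t}" if t: "t \<in> near r (W k)" for t
    proof
      fix y assume "y \<in> near r (Q k)"
      then obtain q where q: "q \<in> Q k" "y \<in> {q - r..q + r}" by (auto simp: near_def)
      obtain s where s: "s \<in> W k" "t \<in> {s - r..s + r}" using t by (auto simp: near_def)
      have "2 * r < s - q \<and> 2 * r < q - (s - 1)" using elim(1) q s by blast
      then show "y \<in> {t-1..t}" using q(2) s(2) by auto
    qed
    moreover have "near r (W k) \<subseteq> {ends k..ends (k + 1)}"
    proof
      fix y assume "y \<in> near r (W k)"
      then obtain s where s: "s \<in> W k" "y \<in> {s - r..s + r}" by (auto simp: near_def)
      have "2 * r < s - ends k \<and> 2 * r < ends (k + 1) - s" using elim(2) s by blast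
      then show "y \<in> {ends k..ends (k + 1)}" using s(2) elim(3) by auto
    qed
    ultimately show ?case using elim by blast
  qed
qed

text \<open>The constants \<delta> and K depend only on the landscape, the passage and r. This
  uniformity allows functions v and g that change with \<epsilon>, in particular v built from the
  unknown \<phi> \<epsilon>.\<close>

lemma increment_approx:
  assumes r: "r > 0" and sub: "\<forall>t\<in>near r (W k). near r (Q k) \<subseteq> {t-1..t}"
  shows "\<exists>\<delta>>0. \<exists>K. \<forall>\<epsilon>>0. \<forall>C v g s. continuous_on UNIV v \<longrightarrow> (\<forall>y. \<bar>v y\<bar> \<le> C) \<longrightarrow>
     (\<forall>t. (g has_real_derivative kappa \<epsilon> / \<epsilon> * kernel \<epsilon> v t) (at t)) \<longrightarrow> s \<in> {ends k..ends (k + 1)} \<longrightarrow>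
     \<bar>g s - g (ends k) - kappa \<epsilon> * alpha k r \<epsilon> s * beta k r \<epsilon> v\<bar> \<le> kappa \<epsilon> * C * K * (exp (- \<delta> / \<epsilon>) / \<epsilon>)"
proof -
  obtain c0 where c0: "c0 > 0" "\<And>y. c0 \<le> a y" using a_lower by blast
  obtain \<delta> where \<delta>: "\<delta> > 0" "\<forall>t\<in>{ends k..ends (k + 1)}. \<forall>y\<in>{t-1..t}.
    t \<notin> near r (W k) \<or> y \<notin> near r (Q k) \<longrightarrow> S t - S y \<le> \<hh> - \<delta>"
    using barrier_off_critical_pairs[OF r] by blast
  define K where "K = (ends (k + 1) - ends k) / c0"
  show ?thesis
  proof (rule exI[of _ \<delta>], rule conjI[OF \<delta>(1)], rule exI[of _ K], intro allI impI)
    fix \<epsilon> C s :: real and v g :: "real \<Rightarrow> real"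
    assume eps: "\<epsilon> > 0" and v: "continuous_on UNIV v" "\<forall>y. \<bar>v y\<bar> \<le> C"
      and g: "\<forall>t. (g has_real_derivative kappa \<epsilon> / \<epsilon> * kernel \<epsilon> v t) (at t)"
      and s: "s \<in> {ends k..ends (k + 1)}"
    let ?w = "\<lambda>t. if t \<in> near r (W k) then exp ((S t - sad k) / \<epsilon>) else 0"
    let ?b = "sqrt \<epsilon> * beta k r \<epsilon> v"
    have "C \<ge> 0" using v(2) by (metis abs_ge_zero order_trans)
    have "((\<lambda>t. kappa \<epsilon> / \<epsilon> * kernel \<epsilon> v t) has_integral (g s - g (ends k))) {ends k..s}"
      using s g by (intro fundamental_theorem_of_calculus)
        (auto simp flip: has_real_derivative_iff_has_vector_derivative intro: has_field_derivative_at_within)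
    from has_integral_mult_right[OF this, of "\<epsilon> / kappa \<epsilon>"]
    have h1: "(kernel \<epsilon> v has_integral (\<epsilon> / kappa \<epsilon> * (g s - g (ends k)))) {ends k..s}"
      using eps kappa_pos[OF eps] by simp
    have "(\<lambda>t. exp ((S t - sad k) / \<epsilon>)) integrable_on ({ends k..s} \<inter> near r (W k))"
      by (intro integrable_on_compact compact_Int compact_near W_finite continuous_intros S_cont) (use eps in auto)
    then have wi: "?w integrable_on {ends k..s}"
      using integrable_restrict_Int[of "near r (W k)" "\<lambda>t. exp ((S t - sad k) / \<epsilon>)" "{ends k..s}"]
      by (simp add: Int_commute)
    have "integral {ends k..s} ?w = sqrt \<epsilon> * alpha k r \<epsilon> s"
      using integral_restrict_Int[of "{ends k..s}" "near r (W k)" "\<lambda>t. exp ((S t - sad k) / \<epsilon>)"] eps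
      by (simp add: alpha_def Int_commute)
    then have "(?w has_integral sqrt \<epsilon> * alpha k r \<epsilon> s) {ends k..s}" using wi by (metis integrable_integral)
    from has_integral_diff[OF h1 has_integral_mult_left[OF this, of ?b]]
    have h2: "((\<lambda>t. kernel \<epsilon> v t - ?w t * ?b) has_integral
        (\<epsilon> / kappa \<epsilon> * (g s - g (ends k)) - sqrt \<epsilon> * alpha k r \<epsilon> s * ?b)) {ends k..s}" .
    have "\<bar>kernel \<epsilon> v t - ?w t * ?b\<bar> \<le> C / c0 * exp (- \<delta> / \<epsilon>)" if "t \<in> {ends k..s}" for t
      using that s \<delta>(2) sub by (intro kernel_approx[OF v(1) _ c0 eps]) (use v(2) in auto)
    then have "\<bar>\<epsilon> / kappa \<epsilon> * (g s - g (ends k)) - sqrt \<epsilon> * alpha k r \<epsilon> s * ?b\<bar> \<le> C / c0 * exp (- \<delta> / \<epsilon>) * (s - ends k)"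
      using integral_abs_le[of "\<lambda>t. kernel \<epsilon> v t - ?w t * ?b" "ends k" s "C / c0 * exp (- \<delta> / \<epsilon>)"] h2 s
      by (simp add: has_integral_integrable integral_unique)
    also have "\<dots> \<le> C / c0 * exp (- \<delta> / \<epsilon>) * (ends (k + 1) - ends k)"
      using s c0 \<open>C \<ge> 0\<close> by (intro mult_left_mono) auto
    also have "\<dots> = C * K * exp (- \<delta> / \<epsilon>)" by (simp add: K_def)
    finally have le: "\<bar>\<epsilon> / kappa \<epsilon> * (g s - g (ends k)) - sqrt \<epsilon> * alpha k r \<epsilon> s * ?b\<bar> \<le> C * K * exp (- \<delta> / \<epsilon>)" .
    have "sqrt \<epsilon> * alpha k r \<epsilon> s * ?b = (sqrt \<epsilon> * sqrt \<epsilon>) * (alpha k r \<epsilon> s * beta k r \<epsilon> v)" by (simp only: ac_simps)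
    also have "\<dots> = \<epsilon> * (alpha k r \<epsilon> s * beta k r \<epsilon> v)" using eps by simp
    finally have "g s - g (ends k) - kappa \<epsilon> * alpha k r \<epsilon> s * beta k r \<epsilon> v =
        kappa \<epsilon> / \<epsilon> * (\<epsilon> / kappa \<epsilon> * (g s - g (ends k)) - sqrt \<epsilon> * alpha k r \<epsilon> s * ?b)"
      using eps kappa_pos[OF eps] by (simp add: field_simps)
    then have "\<bar>g s - g (ends k) - kappa \<epsilon> * alpha k r \<epsilon> s * beta k r \<epsilon> v\<bar> =
        kappa \<epsilon> / \<epsilon> * \<bar>\<epsilon> / kappa \<epsilon> * (g s - g (ends k)) - sqrt \<epsilon> * alpha k r \<epsilon> s * ?b\<bar>"
      using eps kappa_pos[OF eps] by (simp add: abs_mult)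
    also have "\<dots> \<le> kappa \<epsilon> / \<epsilon> * (C * K * exp (- \<delta> / \<epsilon>))"
      using eps kappa_pos[OF eps] by (intro mult_left_mono le) auto
    finally show "\<bar>g s - g (ends k) - kappa \<epsilon> * alpha k r \<epsilon> s * beta k r \<epsilon> v\<bar> \<le> kappa \<epsilon> * C * K * (exp (- \<delta> / \<epsilon>) / \<epsilon>)"
      by (simp add: mult.assoc)
  qed
qed

end

section \<open>Laplace asymptotics of increments\<close>

lemma second_order_quotient:
  fixes f :: "real \<Rightarrow> real"
  assumes f': "\<And>y. (f has_real_derivative f' y) (at y)" and f'': "(f' has_real_derivative D) (at x)"
    and "f' x = 0"
  shows "((\<lambda>y. (f y - f x) / (y - x)^2) \<longlongrightarrow> D / 2) (at x)"
proof (rule lhopital)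
  show "((\<lambda>y. f y - f x) \<longlongrightarrow> 0) (at x)"
    using DERIV_isCont[OF f'[of x]] by (simp add: isCont_def LIM_zero_iff)
  show "((\<lambda>y. (y - x)^2) \<longlongrightarrow> 0) (at x)" by (auto intro!: tendsto_eq_intros)
  show "eventually (\<lambda>y. (y - x)^2 \<noteq> 0) (at x)" "eventually (\<lambda>y. 2 * (y - x) \<noteq> 0) (at x)"
    by (auto simp: eventually_at intro!: exI[of _ 1])
  show "eventually (\<lambda>y. ((\<lambda>y. f y - f x) has_real_derivative f' y) (at y)) (at x)"
    by (intro always_eventually allI) (auto intro!: derivative_eq_intros f')
  show "eventually (\<lambda>y. ((\<lambda>y. (y - x)^2) has_real_derivative 2 * (y - x)) (at y)) (at x)"
    by (intro always_eventually allI) (auto intro!: derivative_eq_intros)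
  have "((\<lambda>y. (f' y - f' x) / (y - x)) \<longlongrightarrow> D) (at x)" using f'' by (simp add: has_field_derivative_iff)
  then have "((\<lambda>y. (f' y - f' x) / (y - x) / 2) \<longlongrightarrow> D / 2) (at x)" by (intro tendsto_intros) auto
  then show "((\<lambda>y. f' y / (2 * (y - x))) \<longlongrightarrow> D / 2) (at x)" using assms(3) by (simp add: mult.commute)
qed

lemma gaussian_integral:
  assumes "c > 0"
  shows "integrable lborel (\<lambda>z::real. exp (- c * z^2))" "(\<integral>z. exp (- c * z^2) \<partial>lborel) = sqrt (pi / c)"
proof -
  define s where "s = sqrt (1 / (2 * c))"
  have s: "s > 0" "s^2 = 1 / (2 * c)" using assms by (auto simp: s_def)
  have eq: "exp (- c * z^2) = sqrt (pi / c) * normal_density 0 s z" for z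
    using assms by (simp add: normal_density_def s(2) real_sqrt_divide field_simps)
  have n: "has_bochner_integral lborel (normal_density 0 s) 1"
    using integrable_normal_density[OF s(1), of 0] integral_normal_density[OF s(1), of 0]
    by (simp add: has_bochner_integral_iff)
  show "integrable lborel (\<lambda>z::real. exp (- c * z^2))" "(\<integral>z. exp (- c * z^2) \<partial>lborel) = sqrt (pi / c)"
    unfolding eq using n by (auto simp: has_bochner_integral_iff)
qed

text \<open>Joint convergence along \<open>\<epsilon> \<rightarrow> 0\<close> and \<open>y \<rightarrow> q\<close> is what survives the rescaling \<open>y = q + sqrt \<epsilon> * z\<close> in
  Laplace's method; the centre \<open>c \<epsilon>\<close> need not converge.\<close>

definition tracks :: "(real \<Rightarrow> real \<Rightarrow> real) \<Rightarrow> (real \<Rightarrow> real) \<Rightarrow> real \<Rightarrow> bool" where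
  "tracks f c q \<longleftrightarrow> ((\<lambda>(\<epsilon>, y). f \<epsilon> y - c \<epsilon>) \<longlongrightarrow> 0) (at_right 0 \<times>\<^sub>F nhds q)"

lemma tracks_sequentially:
  assumes "tracks f c q" "filterlim e (at_right 0) sequentially" "y \<longlonglongrightarrow> q"
  shows "(\<lambda>n. f (e n) (y n) - c (e n)) \<longlonglongrightarrow> 0"
proof -
  have "filterlim (\<lambda>n. (e n, y n)) (at_right 0 \<times>\<^sub>F nhds q) sequentially"
    using assms(2,3) by (intro filterlim_Pair) auto
  from filterlim_compose[OF assms(1)[unfolded tracks_def] this] show ?thesis by simp
qed

text \<open>After rescaling y = q + sqrt \<epsilon> * z the quadratic lower bound on T supplies a
  Gaussian majorant. The limit is taken along sequences so that dominated convergence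
  applies.\<close>

lemma laplace_asymptotics:
  fixes T :: "real \<Rightarrow> real" and f :: "real \<Rightarrow> real \<Rightarrow> real"
  assumes r: "r > 0" and T: "continuous_on UNIV T" "T q = 0"
    and T2: "((\<lambda>y. T y / (y - q)^2) \<longlongrightarrow> D / 2) (at q)" "D > 0"
    and quad: "c1 > 0" "\<And>y. \<bar>y - q\<bar> \<le> r \<Longrightarrow> T y \<ge> c1 * (y - q)^2"
    and f: "\<And>\<epsilon>. \<epsilon> > 0 \<Longrightarrow> continuous_on UNIV (f \<epsilon>)" "\<And>\<epsilon> y. \<epsilon> > 0 \<Longrightarrow> \<bar>f \<epsilon> y\<bar> \<le> C"
    and c: "\<And>\<epsilon>. \<epsilon> > 0 \<Longrightarrow> \<bar>c \<epsilon>\<bar> \<le> C"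
    and lim: "tracks f c q"
  shows "((\<lambda>\<epsilon>. integral {q-r..q+r} (\<lambda>y. f \<epsilon> y * exp (- T y / \<epsilon>)) / sqrt \<epsilon> - c \<epsilon> * sqrt (2 * pi / D)) \<longlongrightarrow> 0) (at_right 0)"
  unfolding tendsto_at_iff_sequentially
proof (intro allI impI)
  fix e :: "nat \<Rightarrow> real" assume e: "\<forall>n. e n \<in> {0<..} - {0}" "e \<longlonglongrightarrow> 0"
  have pos: "e n > 0" for n using e(1) by auto
  have er: "filterlim e (at_right 0) sequentially"
    using e(2) by (auto simp: filterlim_at pos less_imp_neq[OF pos, symmetric] intro!: always_eventually)
  have C0: "C \<ge> 0" using c[of 1] by simp
  define F where "F = (\<lambda>n y. indicator {q-r..q+r} y *\<^sub>R (f (e n) y * exp (- T y / e n)))"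
  have cont: "continuous_on A (\<lambda>y. f (e n) y * exp (- T y / e n))" for n A
    using pos[of n] by (intro continuous_intros continuous_on_subset[OF f(1)] continuous_on_subset[OF T(1)]) auto
  have Fint: "integrable lborel (F n)" for n
    unfolding F_def by (intro borel_integrable_compact cont) auto
  have FI: "integral {q-r..q+r} (\<lambda>y. f (e n) y * exp (- T y / e n)) = integral\<^sup>L lborel (F n)" for n
    using set_borel_integral_eq_integral(2)[of "{q-r..q+r}" "\<lambda>y. f (e n) y * exp (- T y / e n)"] Fint[of n]
    by (simp add: F_def set_integrable_def set_lebesgue_integral_def)
  \<comment> \<open>The rescaled integrand minus its Gaussian approximation with the moving centre;
    its integral is the quantity that has to vanish.\<close>
  define h where "h = (\<lambda>n z. F n (q + sqrt (e n) * z) - c (e n) * exp (- (D/2) * z^2))"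
  have int1: "integrable lborel (\<lambda>z. F n (q + sqrt (e n) * z))" for n
    using lborel_integrable_real_affine[OF Fint, of "sqrt (e n)" n q] pos[of n] by simp
  have g: "integrable lborel (\<lambda>z::real. exp (- (D/2) * z^2))"
      "(\<integral>z. exp (- (D/2) * z^2) \<partial>lborel) = sqrt (2 * pi / D)"
    using gaussian_integral[of "D/2"] T2(2) by (auto simp: mult.commute)
  have inth: "integrable lborel (h n)" for n
    unfolding h_def using int1 g(1) by (intro Bochner_Integration.integrable_diff integrable_mult_right) auto
  have eq: "integral {q-r..q+r} (\<lambda>y. f (e n) y * exp (- T y / e n)) / sqrt (e n) - c (e n) * sqrt (2 * pi / D)
      = integral\<^sup>L lborel (h n)" for n
  proof -
    have "integral\<^sup>L lborel (F n) = sqrt (e n) * (\<integral>z. F n (q + sqrt (e n) * z) \<partial>lborel)"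
      using lborel_integral_real_affine[of "sqrt (e n)" "F n" q] pos[of n] by simp
    then have "integral\<^sup>L lborel (F n) / sqrt (e n) = (\<integral>z. F n (q + sqrt (e n) * z) \<partial>lborel)"
      using pos[of n] by simp
    moreover have "integral\<^sup>L lborel (h n) = (\<integral>z. F n (q + sqrt (e n) * z) \<partial>lborel) - c (e n) * sqrt (2 * pi / D)"
      unfolding h_def g(2)[symmetric] by (subst Bochner_Integration.integral_diff[OF int1]) (use g(1) in auto)
    ultimately show ?thesis unfolding FI by simp
  qed
  define w where "w = (\<lambda>z::real. C * exp (- c1 * z^2) + C * exp (- (D/2) * z^2))"
  have wint: "integrable lborel w"
    unfolding w_def using gaussian_integral(1)[OF quad(1)] g(1) by (intro Bochner_Integration.integrable_add integrable_mult_right) auto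
  have bound: "norm (h n z) \<le> w z" for n z
  proof -
    have "\<bar>F n (q + sqrt (e n) * z)\<bar> \<le> C * exp (- c1 * z^2)"
    proof (cases "q + sqrt (e n) * z \<in> {q-r..q+r}")
      case True
      then have "T (q + sqrt (e n) * z) \<ge> c1 * (sqrt (e n) * z)^2" using quad(2)[of "q + sqrt (e n) * z"] by auto
      then have "T (q + sqrt (e n) * z) \<ge> c1 * z^2 * e n" using pos[of n] by (simp add: power_mult_distrib mult.commute mult.left_commute)
      then have "- T (q + sqrt (e n) * z) / e n \<le> - c1 * z^2" using pos[of n] by (simp add: field_simps)
      then have "exp (- T (q + sqrt (e n) * z) / e n) \<le> exp (- c1 * z^2)" by simp
      then show ?thesis using f(2)[OF pos[of n], of "q + sqrt (e n) * z"] True C0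
        by (auto simp: F_def abs_mult intro!: mult_mono)
    qed (use C0 in \<open>simp add: F_def\<close>)
    moreover have "\<bar>c (e n) * exp (- (D/2) * z^2)\<bar> \<le> C * exp (- (D/2) * z^2)"
      using c[OF pos[of n]] by (simp add: abs_mult)
    ultimately show ?thesis unfolding h_def w_def real_norm_def by linarith
  qed
  have lim0: "(\<lambda>n. h n z) \<longlonglongrightarrow> 0" for z
  proof -
    have y: "(\<lambda>n. q + sqrt (e n) * z) \<longlonglongrightarrow> q"
      using tendsto_add[OF tendsto_const[of q] tendsto_mult[OF tendsto_real_sqrt[OF e(2)] tendsto_const[of z]]] by simp
    have "(\<lambda>n. f (e n) (q + sqrt (e n) * z) - c (e n)) \<longlonglongrightarrow> 0"
      by (rule tracks_sequentially[OF lim er y])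
    have E: "(\<lambda>n. exp (- T (q + sqrt (e n) * z) / e n)) \<longlonglongrightarrow> exp (- (D/2) * z^2)"
    proof (cases "z = 0")
      case True
      then show ?thesis using T(2) by simp
    next
      case False
      have "filterlim (\<lambda>n. q + sqrt (e n) * z) (at q) sequentially"
        using y False pos by (auto simp: filterlim_at less_imp_neq[symmetric] intro!: always_eventually)
      from filterlim_compose[OF T2(1) this]
      have "(\<lambda>n. T (q + sqrt (e n) * z) / (sqrt (e n) * z)^2) \<longlonglongrightarrow> D / 2" by simp
      moreover have "(sqrt (e n) * z)^2 = e n * z^2" for n using pos[of n] by (simp add: power_mult_distrib)
      ultimately have "(\<lambda>n. T (q + sqrt (e n) * z) / (e n * z^2)) \<longlonglongrightarrow> D / 2" by simp
      then have "(\<lambda>n. exp (- (T (q + sqrt (e n) * z) / (e n * z^2)) * z^2)) \<longlonglongrightarrow> exp (- (D / 2) * z^2)"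
        by (intro tendsto_exp tendsto_mult tendsto_minus tendsto_const)
      moreover have "- (T (q + sqrt (e n) * z) / (e n * z^2)) * z^2 = - T (q + sqrt (e n) * z) / e n" for n
        using False pos[of n] by (simp add: field_simps)
      ultimately show ?thesis by simp
    qed
    have "(\<lambda>n. (f (e n) (q + sqrt (e n) * z) - c (e n)) * exp (- T (q + sqrt (e n) * z) / e n)
        + c (e n) * (exp (- T (q + sqrt (e n) * z) / e n) - exp (- (D/2) * z^2))) \<longlonglongrightarrow> 0"
    proof (rule tendsto_add_zero)
      show "(\<lambda>n. (f (e n) (q + sqrt (e n) * z) - c (e n)) * exp (- T (q + sqrt (e n) * z) / e n)) \<longlonglongrightarrow> 0"
        using tendsto_mult[OF tracks_sequentially[OF lim er y] E] by simp
      have d: "(\<lambda>n. exp (- T (q + sqrt (e n) * z) / e n) - exp (- (D/2) * z^2)) \<longlonglongrightarrow> 0"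
        using tendsto_diff[OF E tendsto_const[of "exp (- (D/2) * z^2)"]] by simp
      \<comment> \<open>The centre c is merely bounded, so it may only multiply a null
        sequence.\<close>
      have "Bfun (\<lambda>n. c (e n)) sequentially"
        using c pos by (intro BfunI[where K = C]) (auto intro!: always_eventually)
      from bounded_bilinear.Bfun_prod_Zfun[OF bounded_bilinear_mult this, of "\<lambda>n. exp (- T (q + sqrt (e n) * z) / e n) - exp (- (D/2) * z^2)"]
      show "(\<lambda>n. c (e n) * (exp (- T (q + sqrt (e n) * z) / e n) - exp (- (D/2) * z^2))) \<longlonglongrightarrow> 0"
        using d by (simp add: tendsto_Zfun_iff)
    qed
    moreover have "eventually (\<lambda>n. (f (e n) (q + sqrt (e n) * z) - c (e n)) * exp (- T (q + sqrt (e n) * z) / e n)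
        + c (e n) * (exp (- T (q + sqrt (e n) * z) / e n) - exp (- (D/2) * z^2)) = h n z) sequentially"
    proof -
      have "eventually (\<lambda>n. q + sqrt (e n) * z \<in> {q-r<..<q+r}) sequentially"
        by (rule topological_tendstoD[OF y]) (use r in auto)
      then show ?thesis by eventually_elim (auto simp: h_def F_def algebra_simps)
    qed
    ultimately show ?thesis by (rule Lim_transform_eventually)
  qed
  have "(\<lambda>n. integral\<^sup>L lborel (h n)) \<longlonglongrightarrow> integral\<^sup>L lborel (\<lambda>z::real. 0::real)"
    by (rule integral_dominated_convergence[where w = w])
      (use inth wint lim0 bound in auto)
  then show "((\<lambda>\<epsilon>. integral {q-r..q+r} (\<lambda>y. f \<epsilon> y * exp (- T y / \<epsilon>)) / sqrt \<epsilon> - c \<epsilon> * sqrt (2 * pi / D)) \<circ> e) \<longlonglongrightarrow> 0"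
    unfolding comp_def eq by simp
qed

lemma tracks_continuous:
  assumes "isCont f q"
  shows "tracks (\<lambda>\<epsilon>. f) (\<lambda>\<epsilon>. f q) q"
proof -
  have "filterlim f (nhds (f q)) (nhds q)" using assms by (simp add: isCont_def tendsto_at_iff_tendsto_nhds)
  from filterlim_compose[OF this filterlim_snd]
  have "((\<lambda>p. f (snd p) - f q) \<longlongrightarrow> 0) (at_right 0 \<times>\<^sub>F nhds q)"
    by (simp add: LIM_zero_iff)
  then show ?thesis by (simp add: tracks_def case_prod_unfold)
qed

lemma tracks_const: "tracks (\<lambda>\<epsilon> y. c \<epsilon>) c q"
  by (simp add: tracks_def case_prod_unfold)

lemma tracks_diff: "tracks f c q \<Longrightarrow> tracks g d q \<Longrightarrow> tracks (\<lambda>\<epsilon> y. f \<epsilon> y - g \<epsilon> y) (\<lambda>\<epsilon>. c \<epsilon> - d \<epsilon>) q"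
  unfolding tracks_def case_prod_unfold by (drule (1) tendsto_diff) (simp add: algebra_simps)

lemma tracks_cmult: "tracks f c q \<Longrightarrow> tracks (\<lambda>\<epsilon> y. d * f \<epsilon> y) (\<lambda>\<epsilon>. d * c \<epsilon>) q"
  unfolding tracks_def case_prod_unfold
  by (drule tendsto_mult_left[where c = d]) (simp add: algebra_simps)

lemma tracks_shift_center:
  assumes "tracks f c q" "((\<lambda>\<epsilon>. c \<epsilon> - d \<epsilon>) \<longlongrightarrow> 0) (at_right 0)"
  shows "tracks f d q"
proof -
  have "((\<lambda>p. c (fst p) - d (fst p)) \<longlongrightarrow> 0) (at_right 0 \<times>\<^sub>F nhds q)"
    by (rule filterlim_compose[OF assms(2) filterlim_fst])
  from tendsto_add[OF assms(1)[unfolded tracks_def case_prod_unfold] this] show ?thesis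
    unfolding tracks_def case_prod_unfold by simp
qed

lemma integral_near:
  fixes f :: "real \<Rightarrow> real"
  assumes "finite A" "pairwise (\<lambda>x y. {x - r..x + r} \<inter> {y - r..y + r} = {}) A" "continuous_on UNIV f"
  shows "integral (\<Union>x\<in>A. {x - r..x + r}) f = (\<Sum>x\<in>A. integral {x - r..x + r} f)"
proof (rule integral_unique, rule has_integral_UN[OF assms(1)])
  show "(f has_integral integral {x - r..x + r} f) {x - r..x + r}" for x
    by (intro integrable_integral integrable_continuous_interval continuous_on_subset[OF assms(3)]) auto
  show "pairwise (\<lambda>x y. negligible ({x - r..x + r} \<inter> {y - r..y + r})) A"
    by (rule pairwise_mono[OF assms(2)]) auto
qed

lemma exp_over_tendsto:
  assumes "\<delta> > 0"
  shows "((\<lambda>\<epsilon>. exp (- \<delta> / \<epsilon>) / \<epsilon>) \<longlongrightarrow> 0) (at_right (0::real))"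
proof -
  have "((\<lambda>x. x * exp (- (\<delta> * x))) \<longlongrightarrow> 0) at_top"
  proof -
    have "filterlim (\<lambda>x. \<delta> * x) at_top at_top" using assms
      by (intro filterlim_tendsto_pos_mult_at_top[OF tendsto_const _ filterlim_ident])
    from filterlim_compose[OF tendsto_power_div_exp_0[of 1] this]
    have "((\<lambda>x. \<delta> * x / exp (\<delta> * x)) \<longlongrightarrow> 0) at_top" by simp
    from tendsto_mult_left[OF this, of "1 / \<delta>"]
    have "((\<lambda>x. 1 / \<delta> * (\<delta> * x / exp (\<delta> * x))) \<longlongrightarrow> 0) at_top" by simp
    moreover have "1 / \<delta> * (\<delta> * x / exp (\<delta> * x)) = x * exp (- (\<delta> * x))" for x
      using assms by (simp add: exp_minus field_simps)
    ultimately show ?thesis by simp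
  qed
  from filterlim_compose[OF this filterlim_inverse_at_top_right]
  show ?thesis by (simp add: divide_inverse mult.commute)
qed

lemma Bfun_tendsto_mult_zero:
  fixes f g :: "'c \<Rightarrow> real"
  assumes "Bfun f \<F>" "(g \<longlongrightarrow> 0) \<F>"
  shows "((\<lambda>x. f x * g x) \<longlongrightarrow> 0) \<F>"
  using bounded_bilinear.Bfun_prod_Zfun[OF bounded_bilinear_mult assms(1)] assms(2) by (simp add: tendsto_Zfun_iff)

section \<open>Increments between neighbouring wells\<close>

context nonreversible_family
begin

lemma Q_Mins: "q \<in> Q k \<Longrightarrow> q \<in> Mins"
  using F_Mins by (auto simp: Q_def)

definition good_radius :: "int \<Rightarrow> real \<Rightarrow> bool" where
  "good_radius k r \<longleftrightarrow> r > 0 \<and> (\<forall>t\<in>near r (W k). near r (Q k) \<subseteq> {t-1..t}) \<and>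
     near r (W k) \<subseteq> {ends k..ends (k + 1)} \<and>
     pairwise (\<lambda>x y. {x - r..x + r} \<inter> {y - r..y + r} = {}) (W k) \<and>
     pairwise (\<lambda>x y. {x - r..x + r} \<inter> {y - r..y + r} = {}) (Q k) \<and>
     (\<forall>q\<in>Q k. \<forall>y. \<bar>y - q\<bar> \<le> r \<longrightarrow> S y - S q \<ge> S2 q / 4 * (y - q)^2) \<and>
     (\<forall>q\<in>W k. \<forall>y. \<bar>y - q\<bar> \<le> r \<longrightarrow> S q - S y \<ge> - S2 q / 4 * (y - q)^2)"

lemma good_radius_ex: "\<exists>r. good_radius k r"
proof -
  have Qe: "eventually (\<lambda>r. \<forall>q\<in>Q k. \<forall>y. \<bar>y - q\<bar> \<le> r \<longrightarrow> S y - S q \<ge> S2 q / 4 * (y - q)^2) (at_right 0)"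
  proof (intro eventually_ball_finite finite_Q ballI)
    fix q assume "q \<in> Q k"
    then obtain e where e: "e > 0" "\<forall>y. \<bar>y - q\<bar> \<le> e \<longrightarrow> S y - S q \<ge> S2 q / 4 * (y - q)^2"
      using Mins_quadratic[OF Q_Mins] by blast
    then show "eventually (\<lambda>r. \<forall>y. \<bar>y - q\<bar> \<le> r \<longrightarrow> S y - S q \<ge> S2 q / 4 * (y - q)^2) (at_right 0)"
      unfolding eventually_at_right_field by (intro exI[of _ e]) fastforce
  qed
  have We: "eventually (\<lambda>r. \<forall>q\<in>W k. \<forall>y. \<bar>y - q\<bar> \<le> r \<longrightarrow> S q - S y \<ge> - S2 q / 4 * (y - q)^2) (at_right 0)"
  proof (intro eventually_ball_finite W_finite ballI)
    fix q assume "q \<in> W k"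
    then obtain e where e: "e > 0" "\<forall>y. \<bar>y - q\<bar> \<le> e \<longrightarrow> S q - S y \<ge> - S2 q / 4 * (y - q)^2"
      using Maxs_quadratic W_Maxs by blast
    then show "eventually (\<lambda>r. \<forall>y. \<bar>y - q\<bar> \<le> r \<longrightarrow> S q - S y \<ge> - S2 q / 4 * (y - q)^2) (at_right 0)"
      unfolding eventually_at_right_field by (intro exI[of _ e]) fastforce
  qed
  have pos: "eventually (\<lambda>r. r > 0) (at_right (0::real))" by (simp add: eventually_at_right_less)
  have "eventually (good_radius k) (at_right 0)"
    using Qe We pos small_radius[of k] unfolding good_radius_def by eventually_elim blast
  then show ?thesis using eventually_happens' trivial_limit_at_right_real by blast
qed

definition radius :: "int \<Rightarrow> real" where "radius k = (SOME r. good_radius k r)"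

lemma radius: "good_radius k (radius k)"
  unfolding radius_def using good_radius_ex by (rule someI_ex)

lemma weight1_eq: "weight1 a b q = 1 / a q * sqrt (2 * pi / S2 q)"
  by (simp add: weight1_def deriv2_S)

lemma S2_quotient:
  assumes "b q = 0"
  shows "((\<lambda>y. (S y - S q) / (y - q)^2) \<longlongrightarrow> S2 q / 2) (at q)"
  using assms by (intro second_order_quotient[OF S_deriv S_deriv2]) auto

text \<open>Laplace's method at each q in Q k with the phase S - S q and the amplitude v / a: the
  factor 1 / a q times the Gaussian integral with curvature S'' is \<open>weight1\<close>.
  Boundedness of c replaces its convergence.\<close>

lemma beta_limit:
  assumes v: "\<And>\<epsilon>. \<epsilon> > 0 \<Longrightarrow> continuous_on UNIV (v \<epsilon>)" "\<And>\<epsilon> y. \<epsilon> > 0 \<Longrightarrow> \<bar>v \<epsilon> y\<bar> \<le> C"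
    and c: "\<And>\<epsilon> q. \<epsilon> > 0 \<Longrightarrow> q \<in> Q k \<Longrightarrow> \<bar>c \<epsilon> q\<bar> \<le> C"
    and lim: "\<And>q. q \<in> Q k \<Longrightarrow> tracks v (\<lambda>\<epsilon>. c \<epsilon> q) q"
  shows "((\<lambda>\<epsilon>. beta k (radius k) \<epsilon> (v \<epsilon>) - (\<Sum>q\<in>Q k. weight1 a b q * c \<epsilon> q)) \<longlongrightarrow> 0) (at_right 0)"
proof -
  define r where "r = radius k"
  note R = radius[of k, folded r_def, unfolded good_radius_def]
  obtain c0 where c0: "c0 > 0" "\<And>y. c0 \<le> a y" using a_lower by blast
  have C0: "C \<ge> 0" using v(2)[of 1 0] by simp
  have single: "((\<lambda>\<epsilon>. integral {q-r..q+r} (\<lambda>y. v \<epsilon> y / a y * exp (- (S y - S q) / \<epsilon>)) / sqrt \<epsilon>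
      - c \<epsilon> q / a q * sqrt (2 * pi / S2 q)) \<longlongrightarrow> 0) (at_right 0)" if q: "q \<in> Q k" for q
  proof (rule laplace_asymptotics[where C = "C / c0" and ?c1.0 = "S2 q / 4"])
    show "r > 0" "S2 q / 4 > 0" "S2 q > 0" using R S2_Mins[OF Q_Mins[OF q]] by auto
    show "continuous_on UNIV (\<lambda>y. S y - S q)" by (intro continuous_intros S_cont)
    show "((\<lambda>y. (S y - S q) / (y - q)\<^sup>2) \<longlongrightarrow> S2 q / 2) (at q)"
      using Q_Mins[OF q] by (intro S2_quotient) (simp add: Mins_def)
    show "S2 q / 4 * (y - q)^2 \<le> S y - S q" if "\<bar>y - q\<bar> \<le> r" for y using R q that by blast
    show "continuous_on UNIV (\<lambda>y. v \<epsilon> y / a y)" if "\<epsilon> > 0" for \<epsilon>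
      using a_pos by (intro continuous_intros v(1) that a_cont) (auto simp: less_imp_neq[symmetric])
    show "\<bar>v \<epsilon> y / a y\<bar> \<le> C / c0" if "\<epsilon> > 0" for \<epsilon> y
    proof -
      have "\<bar>v \<epsilon> y\<bar> / a y \<le> C / c0" by (intro frac_le v(2) that c0 C0)
      then show ?thesis using a_pos[of y] by simp
    qed
    show "\<bar>c \<epsilon> q / a q\<bar> \<le> C / c0" if "\<epsilon> > 0" for \<epsilon>
    proof -
      have "\<bar>c \<epsilon> q\<bar> / a q \<le> C / c0" by (intro frac_le c that c0 C0 q)
      then show ?thesis using a_pos[of q] by simp
    qed
    show "tracks (\<lambda>\<epsilon> y. v \<epsilon> y / a y) (\<lambda>\<epsilon>. c \<epsilon> q / a q) q"
    proof -
      have ia: "isCont (\<lambda>y. 1 / a y) q"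
        using a_cont[of UNIV] a_pos[of q] by (intro continuous_intros) (auto simp: continuous_on_eq_continuous_at)
      have "((\<lambda>p. 1 / a (snd p)) \<longlongrightarrow> 1 / a q) (at_right 0 \<times>\<^sub>F nhds q)"
        by (rule filterlim_compose[OF _ filterlim_snd])
          (use ia tendsto_at_iff_tendsto_nhds[of "\<lambda>y. 1 / a y" q] in \<open>simp add: isCont_def\<close>)
      note ia' = this
      have 1: "((\<lambda>p. (v (fst p) (snd p) - c (fst p) q) * (1 / a (snd p))) \<longlongrightarrow> 0 * (1 / a q)) (at_right 0 \<times>\<^sub>F nhds q)"
        using lim[OF q] by (intro tendsto_mult ia') (simp add: tracks_def case_prod_unfold)
      have "eventually (\<lambda>\<epsilon>. \<bar>c \<epsilon> q\<bar> \<le> C) (at_right 0)"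
        using c[OF _ q] eventually_at_right_less[of 0] by (rule eventually_mono[rotated]) auto
      then have "eventually (\<lambda>p. \<bar>c (fst p) q\<bar> \<le> C) (at_right 0 \<times>\<^sub>F nhds q)"
        by (rule eventually_compose_filterlim[OF _ filterlim_fst])
      then have B: "Bfun (\<lambda>p. c (fst p) q) (at_right 0 \<times>\<^sub>F nhds q)"
        by (intro BfunI[where K = C]) simp
      have "((\<lambda>p. 1 / a (snd p) - 1 / a q) \<longlongrightarrow> 0) (at_right 0 \<times>\<^sub>F nhds q)"
        using ia' by (simp add: LIM_zero_iff)
      then have 2: "((\<lambda>p. c (fst p) q * (1 / a (snd p) - 1 / a q)) \<longlongrightarrow> 0) (at_right 0 \<times>\<^sub>F nhds q)"
        using bounded_bilinear.Bfun_prod_Zfun[OF bounded_bilinear_mult B] by (simp add: tendsto_Zfun_iff)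
      show ?thesis unfolding tracks_def case_prod_unfold
        using tendsto_add[OF 1 2] by (simp add: algebra_simps)
    qed
  qed auto
  have "((\<lambda>\<epsilon>. \<Sum>q\<in>Q k. integral {q-r..q+r} (\<lambda>y. v \<epsilon> y / a y * exp (- (S y - S q) / \<epsilon>)) / sqrt \<epsilon>
      - c \<epsilon> q / a q * sqrt (2 * pi / S2 q)) \<longlongrightarrow> 0) (at_right 0)"
    by (intro tendsto_null_sum single)
  moreover have "eventually (\<lambda>\<epsilon>. (\<Sum>q\<in>Q k. integral {q-r..q+r} (\<lambda>y. v \<epsilon> y / a y * exp (- (S y - S q) / \<epsilon>)) / sqrt \<epsilon>
      - c \<epsilon> q / a q * sqrt (2 * pi / S2 q)) = beta k r \<epsilon> (v \<epsilon>) - (\<Sum>q\<in>Q k. weight1 a b q * c \<epsilon> q)) (at_right 0)"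
    using eventually_at_right_less[of 0]
  proof eventually_elim
    case (elim \<epsilon>)
    have "continuous_on UNIV (\<lambda>y. v \<epsilon> y * exp ((pv k - S y) / \<epsilon>) / a y)"
      using elim a_pos by (intro continuous_intros v(1) a_cont S_cont) (auto simp: less_imp_neq[symmetric])
    moreover have "pairwise (\<lambda>x y. {x - r..x + r} \<inter> {y - r..y + r} = {}) (Q k)" using R by blast
    ultimately have "beta k r \<epsilon> (v \<epsilon>) = (\<Sum>q\<in>Q k. integral {q-r..q+r} (\<lambda>y. v \<epsilon> y * exp ((pv k - S y) / \<epsilon>) / a y)) / sqrt \<epsilon>"
      unfolding beta_def near_def by (subst integral_near[OF finite_Q]) auto
    also have "\<dots> = (\<Sum>q\<in>Q k. integral {q-r..q+r} (\<lambda>y. v \<epsilon> y / a y * exp (- (S y - S q) / \<epsilon>)) / sqrt \<epsilon>)"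
      unfolding sum_divide_distrib by (intro sum.cong refl) (simp add: S_Q)
    finally show ?case by (simp add: sum_subtractf weight1_eq mult.commute)
  qed
  ultimately show ?thesis unfolding r_def[symmetric] by (rule Lim_transform_eventually)
qed

lemma alpha_limit: "((\<lambda>\<epsilon>. alpha k (radius k) \<epsilon> (ends (k + 1))) \<longlongrightarrow> saddle_weight a b F k) (at_right 0)"
proof -
  define r where "r = radius k"
  note R = radius[of k, folded r_def, unfolded good_radius_def]
  have single: "((\<lambda>\<epsilon>. integral {q-r..q+r} (\<lambda>y. 1 * exp (- (S q - S y) / \<epsilon>)) / sqrt \<epsilon>
      - 1 * sqrt (2 * pi / - S2 q)) \<longlongrightarrow> 0) (at_right 0)" if q: "q \<in> W k" for q
  proof (rule laplace_asymptotics[where C = 1 and ?c1.0 = "- S2 q / 4"])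
    have qM: "q \<in> Maxs" using q W_Maxs by blast
    show "r > 0" "- S2 q / 4 > 0" "- S2 q > 0" using R S2_Maxs[OF qM] by auto
    show "continuous_on UNIV (\<lambda>y. S q - S y)" by (intro continuous_intros S_cont)
    have "((\<lambda>y. - ((S y - S q) / (y - q)\<^sup>2)) \<longlongrightarrow> - (S2 q / 2)) (at q)"
      using qM by (intro tendsto_minus S2_quotient) (simp add: Maxs_def)
    moreover have "- ((S y - S q) / (y - q)\<^sup>2) = (S q - S y) / (y - q)\<^sup>2" for y by (simp add: minus_divide_left)
    ultimately show "((\<lambda>y. (S q - S y) / (y - q)\<^sup>2) \<longlongrightarrow> - S2 q / 2) (at q)" by simp
    show "- S2 q / 4 * (y - q)^2 \<le> S q - S y" if "\<bar>y - q\<bar> \<le> r" for y using R q that by blast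
    show "tracks (\<lambda>\<epsilon> y. 1) (\<lambda>\<epsilon>. 1) q" by (rule tracks_const)
  qed auto
  have "((\<lambda>\<epsilon>. \<Sum>q\<in>W k. integral {q-r..q+r} (\<lambda>y. 1 * exp (- (S q - S y) / \<epsilon>)) / sqrt \<epsilon>
      - 1 * sqrt (2 * pi / - S2 q)) \<longlongrightarrow> 0) (at_right 0)"
    by (intro tendsto_null_sum single)
  moreover have "eventually (\<lambda>\<epsilon>. (\<Sum>q\<in>W k. integral {q-r..q+r} (\<lambda>y. 1 * exp (- (S q - S y) / \<epsilon>)) / sqrt \<epsilon>
      - 1 * sqrt (2 * pi / - S2 q)) = alpha k r \<epsilon> (ends (k + 1)) - saddle_weight a b F k) (at_right 0)"
    using eventually_at_right_less[of 0]
  proof eventually_elim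
    case (elim \<epsilon>)
    have i: "{ends k..ends (k + 1)} \<inter> near r (W k) = near r (W k)" using R by blast
    have "continuous_on UNIV (\<lambda>y. exp ((S y - sad k) / \<epsilon>))"
      using elim by (intro continuous_intros S_cont) auto
    moreover have "pairwise (\<lambda>x y. {x - r..x + r} \<inter> {y - r..y + r} = {}) (W k)" using R by blast
    ultimately have "alpha k r \<epsilon> (ends (k + 1)) = (\<Sum>q\<in>W k. integral {q-r..q+r} (\<lambda>y. exp ((S y - sad k) / \<epsilon>))) / sqrt \<epsilon>"
      unfolding alpha_def i unfolding near_def by (subst integral_near[OF W_finite]) auto
    also have "\<dots> = (\<Sum>q\<in>W k. integral {q-r..q+r} (\<lambda>y. 1 * exp (- (S q - S y) / \<epsilon>)) / sqrt \<epsilon>)"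
      unfolding sum_divide_distrib by (intro sum.cong refl) (simp add: S_W)
    finally show ?case by (simp add: sum_subtractf saddle_weight_def deriv2_S)
  qed
  ultimately have "((\<lambda>\<epsilon>. alpha k r \<epsilon> (ends (k + 1)) - saddle_weight a b F k) \<longlongrightarrow> 0) (at_right 0)"
    by (rule Lim_transform_eventually)
  then show ?thesis by (simp add: LIM_zero_iff r_def)
qed

text \<open>Integrated form of the equation with generator applied to g equal to v, for right-hand
  sides bounded uniformly in \<epsilon>. All asymptotics of g follow from this alone.\<close>

definition controlled :: "(real \<Rightarrow> real \<Rightarrow> real) \<Rightarrow> (real \<Rightarrow> real \<Rightarrow> real) \<Rightarrow> real \<Rightarrow> bool" where
  "controlled g v C \<longleftrightarrow> (\<forall>\<epsilon>>0. continuous_on UNIV (v \<epsilon>) \<and> (\<forall>y. \<bar>v \<epsilon> y\<bar> \<le> C) \<and>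
     (\<forall>t. (g \<epsilon> has_real_derivative kappa \<epsilon> / \<epsilon> * kernel \<epsilon> (v \<epsilon>) t) (at t)))"

lemma increment_error:
  assumes "controlled g v C"
  shows "\<exists>err. (err \<longlongrightarrow> 0) (at_right 0) \<and> (\<forall>\<epsilon>>0. \<forall>s\<in>{ends k..ends (k + 1)}.
     \<bar>g \<epsilon> s - g \<epsilon> (ends k) - kappa \<epsilon> * alpha k (radius k) \<epsilon> s * beta k (radius k) \<epsilon> (v \<epsilon>)\<bar> \<le> err \<epsilon>)"
proof -
  have R: "radius k > 0" "\<forall>t\<in>near (radius k) (W k). near (radius k) (Q k) \<subseteq> {t-1..t}"
    using radius[of k] by (auto simp: good_radius_def)
  obtain \<delta> K where \<delta>: "\<delta> > 0" "\<forall>\<epsilon>>0. \<forall>C v g s. continuous_on UNIV v \<longrightarrow> (\<forall>y. \<bar>v y\<bar> \<le> C) \<longrightarrow>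
     (\<forall>t. (g has_real_derivative kappa \<epsilon> / \<epsilon> * kernel \<epsilon> v t) (at t)) \<longrightarrow> s \<in> {ends k..ends (k + 1)} \<longrightarrow>
     \<bar>g s - g (ends k) - kappa \<epsilon> * alpha k (radius k) \<epsilon> s * beta k (radius k) \<epsilon> v\<bar> \<le> kappa \<epsilon> * C * K * (exp (- \<delta> / \<epsilon>) / \<epsilon>)"
    using increment_approx[OF R] by blast
  have "((\<lambda>\<epsilon>. kappa \<epsilon> * C * K * (exp (- \<delta> / \<epsilon>) / \<epsilon>)) \<longlongrightarrow> 1 * C * K * 0) (at_right 0)"
    by (intro tendsto_mult kappa_tendsto exp_over_tendsto \<delta>(1) tendsto_const)
  then show ?thesis using \<delta>(2) assms unfolding controlled_def
    by (intro exI[of _ "\<lambda>\<epsilon>. kappa \<epsilon> * C * K * (exp (- \<delta> / \<epsilon>) / \<epsilon>)"]) auto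
qed

lemma ends_mono: "ends k \<le> ends (k + 1)"
  using Max_less_Min[of k] Min_le_Max[of k] unfolding ends_def by linarith

lemma increment_limit:
  assumes ctl: "controlled g v C"
    and c: "\<And>\<epsilon> q. \<epsilon> > 0 \<Longrightarrow> q \<in> Q k \<Longrightarrow> \<bar>c \<epsilon> q\<bar> \<le> C"
    and lim: "\<And>q. q \<in> Q k \<Longrightarrow> tracks v (\<lambda>\<epsilon>. c \<epsilon> q) q"
  shows "((\<lambda>\<epsilon>. g \<epsilon> (ends (k + 1)) - g \<epsilon> (ends k) - saddle_weight a b F k * (\<Sum>q\<in>Q k. weight1 a b q * c \<epsilon> q)) \<longlongrightarrow> 0) (at_right 0)"
proof -
  let ?A = "\<lambda>\<epsilon>. kappa \<epsilon> * alpha k (radius k) \<epsilon> (ends (k + 1))"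
  let ?b = "\<lambda>\<epsilon>. beta k (radius k) \<epsilon> (v \<epsilon>)"
  let ?s = "\<lambda>\<epsilon>. \<Sum>q\<in>Q k. weight1 a b q * c \<epsilon> q"
  obtain err where err: "(err \<longlongrightarrow> 0) (at_right 0)" "\<forall>\<epsilon>>0. \<forall>s\<in>{ends k..ends (k + 1)}.
     \<bar>g \<epsilon> s - g \<epsilon> (ends k) - kappa \<epsilon> * alpha k (radius k) \<epsilon> s * ?b \<epsilon>\<bar> \<le> err \<epsilon>"
    using increment_error[OF ctl] by blast
  have 1: "((\<lambda>\<epsilon>. g \<epsilon> (ends (k + 1)) - g \<epsilon> (ends k) - ?A \<epsilon> * ?b \<epsilon>) \<longlongrightarrow> 0) (at_right 0)"
  proof (rule Lim_null_comparison[OF _ err(1)])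
    show "eventually (\<lambda>\<epsilon>. norm (g \<epsilon> (ends (k + 1)) - g \<epsilon> (ends k) - ?A \<epsilon> * ?b \<epsilon>) \<le> err \<epsilon>) (at_right 0)"
      using eventually_at_right_less[of 0] by eventually_elim (use err(2) ends_mono[of k] in auto)
  qed
  have A: "(?A \<longlongrightarrow> 1 * saddle_weight a b F k) (at_right 0)"
    by (intro tendsto_mult kappa_tendsto alpha_limit)
  have "((\<lambda>\<epsilon>. ?b \<epsilon> - ?s \<epsilon>) \<longlongrightarrow> 0) (at_right 0)"
    by (rule beta_limit[OF _ _ c lim]) (use ctl in \<open>auto simp: controlled_def\<close>)
  from tendsto_mult[OF A this] have 2: "((\<lambda>\<epsilon>. ?A \<epsilon> * (?b \<epsilon> - ?s \<epsilon>)) \<longlongrightarrow> 0) (at_right 0)" by simp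
  have Bs: "Bfun ?s (at_right 0)"
  proof (rule BfunI)
    show "eventually (\<lambda>\<epsilon>. norm (?s \<epsilon>) \<le> (\<Sum>q\<in>Q k. \<bar>weight1 a b q\<bar> * C)) (at_right 0)"
      using eventually_at_right_less[of 0]
    proof eventually_elim
      case (elim \<epsilon>)
      show ?case unfolding real_norm_def
        by (rule order_trans[OF sum_abs]) (auto simp: abs_mult intro!: sum_mono mult_left_mono c elim)
    qed
  qed
  have "((\<lambda>\<epsilon>. ?A \<epsilon> - saddle_weight a b F k) \<longlongrightarrow> 0) (at_right 0)" using A by (simp add: LIM_zero_iff)
  \<comment> \<open>With increment I the three null terms are I - A * b, A * (b - s) and s * (A -
    sw); their sum is I - sw * s. Only boundedness of s is available, hence this splitting.\<close>
  from Bfun_tendsto_mult_zero[OF Bs this] tendsto_add[OF 1 2]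
  have "((\<lambda>\<epsilon>. g \<epsilon> (ends (k + 1)) - g \<epsilon> (ends k) - ?A \<epsilon> * ?b \<epsilon> + ?A \<epsilon> * (?b \<epsilon> - ?s \<epsilon>)
    + ?s \<epsilon> * (?A \<epsilon> - saddle_weight a b F k)) \<longlongrightarrow> 0 + 0 + 0) (at_right 0)"
    by (intro tendsto_add[of _ "0 + 0"]) auto
  then show ?thesis by (simp add: algebra_simps)
qed

lemma alpha_mono:
  assumes "\<epsilon> > 0" "s \<in> {ends k..ends (k + 1)}"
  shows "0 \<le> alpha k r \<epsilon> s" "alpha k r \<epsilon> s \<le> alpha k r \<epsilon> (ends (k + 1))"
proof -
  have int: "(\<lambda>t. exp ((S t - sad k) / \<epsilon>)) integrable_on ({p..q} \<inter> near r (W k))" for p q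
    by (intro integrable_on_compact compact_Int compact_near W_finite continuous_intros S_cont) (use assms in auto)
  show "0 \<le> alpha k r \<epsilon> s" unfolding alpha_def
    using assms by (intro divide_nonneg_nonneg integral_nonneg int) auto
  show "alpha k r \<epsilon> s \<le> alpha k r \<epsilon> (ends (k + 1))" unfolding alpha_def
    using assms by (intro divide_right_mono integral_subset_le int) auto
qed

text \<open>Between two wells \<open>g\<close> is close to a convex combination of its values at the two ends, since
  the weight \<open>alpha\<close> increases across the saddles. This gives bounds on the whole circle.\<close>

lemma interpolation:
  assumes ctl: "controlled g v C" and "\<eta> > 0"
  shows "eventually (\<lambda>\<epsilon>. \<forall>s\<in>{ends k..ends (k + 1)}. \<exists>p\<in>{0..1}.
    \<bar>g \<epsilon> s - (g \<epsilon> (ends k) + p * (g \<epsilon> (ends (k + 1)) - g \<epsilon> (ends k)))\<bar> \<le> \<eta>) (at_right 0)"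
proof -
  let ?r = "radius k"
  let ?b = "\<lambda>\<epsilon>. beta k ?r \<epsilon> (v \<epsilon>)"
  obtain err where err: "(err \<longlongrightarrow> 0) (at_right 0)" "\<forall>\<epsilon>>0. \<forall>s\<in>{ends k..ends (k + 1)}.
     \<bar>g \<epsilon> s - g \<epsilon> (ends k) - kappa \<epsilon> * alpha k (radius k) \<epsilon> s * ?b \<epsilon>\<bar> \<le> err \<epsilon>"
    using increment_error[OF ctl] by blast
  have e1: "eventually (\<lambda>\<epsilon>. err \<epsilon> < \<eta> / 2) (at_right 0)"
    using order_tendstoD(2)[OF err(1), of "\<eta> / 2"] assms(2) by simp
  have e2: "eventually (\<lambda>\<epsilon>. alpha k ?r \<epsilon> (ends (k + 1)) > 0) (at_right 0)"
    using order_tendstoD(1)[OF alpha_limit saddle_weight_pos] .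
  show ?thesis using e1 e2 eventually_at_right_less[of 0]
  proof eventually_elim
    case (elim \<epsilon>)
    show ?case
    proof
      fix s assume s: "s \<in> {ends k..ends (k + 1)}"
      define p where "p = alpha k ?r \<epsilon> s / alpha k ?r \<epsilon> (ends (k + 1))"
      have p: "p \<in> {0..1}" using alpha_mono[OF elim(3) s, of ?r] elim(2) by (auto simp: p_def)
      define X where "X = g \<epsilon> s - g \<epsilon> (ends k) - kappa \<epsilon> * alpha k ?r \<epsilon> s * ?b \<epsilon>"
      define Y where "Y = g \<epsilon> (ends (k + 1)) - g \<epsilon> (ends k) - kappa \<epsilon> * alpha k ?r \<epsilon> (ends (k + 1)) * ?b \<epsilon>"
      have E: "\<bar>g \<epsilon> s - g \<epsilon> (ends k) - kappa \<epsilon> * alpha k ?r \<epsilon> s * ?b \<epsilon>\<bar> \<le> \<eta> / 2"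
        if "s \<in> {ends k..ends (k + 1)}" for s
        using err(2)[rule_format, OF elim(3) that] elim(1) by linarith
      have XY: "\<bar>X\<bar> \<le> \<eta> / 2" "\<bar>Y\<bar> \<le> \<eta> / 2"
        using E[OF s] E[of "ends (k + 1)"] ends_mono[of k] unfolding X_def Y_def by auto
      have pa: "p * alpha k ?r \<epsilon> (ends (k + 1)) = alpha k ?r \<epsilon> s" using elim(2) by (simp add: p_def)
      \<comment> \<open>The choice of p makes the terms with \<open>beta\<close> cancel, so its size
        is irrelevant here.\<close>
      have "X - p * Y = g \<epsilon> s - (g \<epsilon> (ends k) + p * (g \<epsilon> (ends (k + 1)) - g \<epsilon> (ends k)))
          - kappa \<epsilon> * ?b \<epsilon> * (alpha k ?r \<epsilon> s - p * alpha k ?r \<epsilon> (ends (k + 1)))"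
        unfolding X_def Y_def by (simp add: algebra_simps)
      then have "g \<epsilon> s - (g \<epsilon> (ends k) + p * (g \<epsilon> (ends (k + 1)) - g \<epsilon> (ends k))) = X - p * Y"
        unfolding pa by simp
      moreover have "\<bar>p * Y\<bar> \<le> 1 * (\<eta> / 2)" unfolding abs_mult using p XY(2) by (intro mult_mono) auto
      ultimately have "\<bar>g \<epsilon> s - (g \<epsilon> (ends k) + p * (g \<epsilon> (ends (k + 1)) - g \<epsilon> (ends k)))\<bar> \<le> \<eta>"
        using XY(1) by linarith
      then show "\<exists>p\<in>{0..1}. \<bar>g \<epsilon> s - (g \<epsilon> (ends k) + p * (g \<epsilon> (ends (k + 1)) - g \<epsilon> (ends k)))\<bar> \<le> \<eta>"
        using p by blast
    qed
  qed
qed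

text \<open>The interval from p0 to p1 reaches halfway from the hull of F k to the nearest saddle on
  either side and contains no saddle, so the kernel is exponentially small there and g is
  asymptotically constant around the set.\<close>

lemma tracks_well:
  assumes ctl: "controlled g v C" and q: "q \<in> F k"
  shows "tracks g (\<lambda>\<epsilon>. g \<epsilon> (ends k)) q"
proof -
  define wl where "wl = Max (W (k - 1))"
  define wr where "wr = Min (W k)"
  define xr where "xr = Max (F k)"
  define p0 where "p0 = (wl + ends k) / 2"
  define p1 where "p1 = (xr + wr) / 2"
  have Wm: "wl \<in> W (k - 1)" "wr \<in> W k"
    unfolding wl_def wr_def using W_ne by (auto intro: Max_in Min_in)
  have o: "wl < ends k" "xr < wr"
    using W_between[OF Wm(1)] W_between[OF Wm(2)] unfolding ends_def xr_def by simp_all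
  have qe: "ends k \<le> q" "q \<le> xr" unfolding ends_def xr_def by (auto intro: Min_le Max_ge q)
  have off: "W i \<inter> {p0..p1} = {}" for i
  proof (rule ccontr)
    assume "W i \<inter> {p0..p1} \<noteq> {}"
    then obtain s where s: "s \<in> W i" "p0 \<le> s" "s \<le> p1" by auto
    have Wk: "Min (F (k - 1)) < wl" "wr < Min (F (k + 1))"
      using W_between[OF Wm(1)] W_between[OF Wm(2)] Min_le_Max[of "k - 1"] by (blast intro: le_less_trans)+
    show False
    proof (cases "s \<le> ends k")
      case True
      have "wl < s" using s(2) o(1) unfolding p0_def by (simp add: field_simps)
      then have "Min (F (k - 1)) \<le> s" using Wk(1) by (blast intro: less_imp_le less_trans)
      moreover have "s \<le> Min (F (k - 1 + 1))" using True unfolding ends_def by simp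
      ultimately have "i = k - 1" using W_index[OF s(1)] by blast
      then have "s \<le> wl" unfolding wl_def using s(1) by (intro Max_ge) auto
      then show False using \<open>wl < s\<close> by simp
    next
      case False
      have "s < wr" using s(3) o unfolding p1_def by (simp add: field_simps)
      moreover from this have "s \<le> Min (F (k + 1))" using Wk(2) by (blast intro: less_imp_le less_trans)
      moreover have "Min (F k) \<le> s" using False unfolding ends_def by (metis less_imp_le not_le)
      ultimately have "s < wr" "Min (F k) \<le> s" "s \<le> Min (F (k + 1))" by blast+
      then have "i = k" using W_index[OF s(1)] by blast
      then have "wr \<le> s" unfolding wr_def using s(1) by (intro Min_le) auto
      then show False using \<open>s < wr\<close> by simp
    qed
  qed
  obtain \<delta> where \<delta>: "\<delta> > 0" "\<forall>t\<in>{p0..p1}. \<forall>y\<in>{t-1..t}. S t - S y \<le> \<hh> - \<delta>"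
    using barrier_off_saddles[OF off] by blast
  obtain c0 where c0: "c0 > 0" "\<And>y. c0 \<le> a y" using a_lower by blast
  define err where "err = (\<lambda>\<epsilon>. kappa \<epsilon> * (C / c0) * (p1 - p0) * (exp (- \<delta> / \<epsilon>) / \<epsilon>))"
  have "(err \<longlongrightarrow> 1 * (C / c0) * (p1 - p0) * 0) (at_right 0)" unfolding err_def
    by (intro tendsto_mult kappa_tendsto exp_over_tendsto \<delta>(1) tendsto_const)
  then have err0: "(err \<longlongrightarrow> 0) (at_right 0)" by simp
  have bd: "\<bar>g \<epsilon> y - g \<epsilon> (ends k)\<bar> \<le> err \<epsilon>" if eps: "\<epsilon> > 0" and y: "y \<in> {p0..p1}" for \<epsilon> y
  proof -
    have C0: "C \<ge> 0" using ctl eps unfolding controlled_def by (metis abs_ge_zero order_trans)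
    let ?L = "kappa \<epsilon> / \<epsilon> * (C / c0 * exp (- \<delta> / \<epsilon>))"
    have L0: "?L \<ge> 0" using kappa_pos[OF eps] eps C0 c0 by simp
    have kb: "\<bar>kernel \<epsilon> (v \<epsilon>) t\<bar> \<le> C / c0 * exp (- \<delta> / \<epsilon>)" if "t \<in> {p0..p1}" for t
      by (rule kernel_abs_le[OF _ _ c0 eps]) (use ctl eps \<delta>(2) that in \<open>auto simp: controlled_def\<close>)
    have "norm (g \<epsilon> y - g \<epsilon> (ends k)) \<le> ?L * norm (y - ends k)"
    proof (rule field_differentiable_bound[where S = "{p0..p1}"])
      show "(g \<epsilon> has_field_derivative kappa \<epsilon> / \<epsilon> * kernel \<epsilon> (v \<epsilon>) t) (at t within {p0..p1})" for t
        using ctl eps by (auto simp: controlled_def intro: has_field_derivative_at_within)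
      show "norm (kappa \<epsilon> / \<epsilon> * kernel \<epsilon> (v \<epsilon>) t) \<le> ?L" if "t \<in> {p0..p1}" for t
        unfolding real_norm_def abs_mult using kappa_pos[OF eps] eps by (intro mult_mono kb[OF that]) auto
      show "ends k \<in> {p0..p1}" using o qe unfolding p0_def p1_def by (auto simp: field_simps)
    qed (use y in auto)
    also have "\<dots> \<le> ?L * (p1 - p0)"
    proof (rule mult_left_mono[OF _ L0])
      have "ends k \<in> {p0..p1}" using o qe unfolding p0_def p1_def by (auto simp: field_simps)
      then show "norm (y - ends k) \<le> p1 - p0" using y by auto
    qed
    also have "\<dots> = err \<epsilon>" by (simp add: err_def ac_simps)
    finally show ?thesis by simp
  qed
  have in01: "eventually (\<lambda>y. y \<in> {p0<..<p1}) (nhds q)"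
    by (rule eventually_nhds_in_open) (use o qe in \<open>auto simp: p0_def p1_def field_simps\<close>)
  show ?thesis unfolding tracks_def
  proof (rule Lim_null_comparison)
    show "((\<lambda>p. err (fst p)) \<longlongrightarrow> 0) (at_right 0 \<times>\<^sub>F nhds q)"
      by (rule filterlim_compose[OF err0 filterlim_fst])
    show "eventually (\<lambda>p. norm (case p of (\<epsilon>, y) \<Rightarrow> g \<epsilon> y - g \<epsilon> (ends k)) \<le> err (fst p)) (at_right 0 \<times>\<^sub>F nhds q)"
      using eventually_prodI[OF eventually_at_right_less[of 0] in01]
      by (rule eventually_mono) (use bd in auto)
  qed
qed

end

section \<open>The limiting generator and the Poisson equation\<close>

lemma periodic_sum_shift:
  fixes f :: "int \<Rightarrow> real"
  assumes "\<And>k. f (k + int u) = f k"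
  shows "sum f {c..<c + int u} = sum f {0..<int u}"
proof -
  have step: "sum f {c + 1..<c + 1 + int u} = sum f {c..<c + int u}" for c
  proof (cases "u = 0")
    case False
    have "{c..<c + int u} = insert c {c + 1..<c + int u}"
      "{c + 1..<c + 1 + int u} = insert (c + int u) {c + 1..<c + int u}" using False by auto
    then show ?thesis using assms by simp
  qed simp
  show ?thesis
  proof (induction c rule: int_induct[where k = 0])
    case (step2 i)
    then show ?case using step[of "i - 1"] by simp
  qed (use step in auto)
qed

lemma periodic_int_attains_max:
  fixes f :: "int \<Rightarrow> real"
  assumes "\<And>k. f (k + int u) = f k" "1 \<le> u"
  shows "\<exists>k. \<forall>j. f j \<le> f k"
proof -
  have fin: "finite (range f)" by (rule periodic_int_finite_range(2)[of f u, OF assms])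
  then have "Max (range f) \<in> range f" by (intro Max_in) auto
  then obtain k where "Max (range f) = f k" by auto
  then show ?thesis using fin by (metis Max_ge rangeI)
qed

context nonreversible_family
begin

abbreviation "wt \<equiv> well_weight a b F"
abbreviation "sw \<equiv> saddle_weight a b F"

text \<open>The generator of the limiting chain on indices; on u-periodic functions it is the
  projected generator.\<close>

definition gen :: "(int \<Rightarrow> real) \<Rightarrow> int \<Rightarrow> real" where
  "gen f k = rate a b F k (k + 1) * (f (k + 1) - f k) + rate a b F k (k - 1) * (f (k - 1) - f k)"

definition well_mean :: "(real \<Rightarrow> real) \<Rightarrow> int \<Rightarrow> real" where
  "well_mean f k = (\<Sum>q\<in>F k. weight1 a b q * f q) / wt k"

lemma proj_gen_eq: "proj_gen a b F f k = gen (\<lambda>k. f (P k)) k"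
  by (simp add: proj_gen_def gen_def)

lemma rate_right_pos: "0 < rate a b F k (k + 1)" and rate_left_nonneg: "0 \<le> rate a b F k (k - 1)"
  using rate_pos_iff all_right well_weight_pos[of k] saddle_weight_pos[of "k - 1"]
  by (auto simp: rate_left less_imp_le)

text \<open>Divergence form: the generator weighted by \<open>wt\<close> is the difference of the
  fluxes through the two adjacent passages, the left one being open only between sets of equal
  depth.\<close>

lemma gen_flux: "wt k * gen f k = (f (k + 1) - f k) / sw k - of_bool (pv (k - 1) = pv k) * ((f k - f (k - 1)) / sw (k - 1))"
  using well_weight_pos[of k] saddle_weight_pos[of k] saddle_weight_pos[of "k - 1"]
  unfolding gen_def rate_right rate_left HL_eq_iff all_right by (auto simp: field_simps)

lemma weight1_shift: "weight1 a b (x + of_int n) = weight1 a b x"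
  by (simp add: weight1_eq a_periodic S2_periodic)

lemma wt_shift: "wt (k + n * int u) = wt k"
  unfolding well_weight_def F_shift by (subst sum.reindex) (auto simp: weight1_shift inj_on_def)

lemma sw_shift: "sw (k + n * int u) = sw k"
proof -
  have "W (k + n * int u) = (\<lambda>x. x + of_int n) ` W k"
  proof -
    have "x + of_int n \<in> W (k + n * int u) \<longleftrightarrow> x \<in> W k" for x
      by (simp add: saddles_def gap_shift S_shift sad_shift)
    from this[of "x - of_int n" for x] show ?thesis by (force simp: image_iff)
  qed
  then show ?thesis unfolding saddle_weight_def deriv2_S
    by (simp add: sum.reindex inj_on_def S2_periodic)
qed

lemma rate_shift: "rate a b F (k + n * int u) (k + n * int u + 1) = rate a b F k (k + 1)"
  "rate a b F (k + n * int u) (k + n * int u - 1) = rate a b F k (k - 1)"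
proof -
  have "k + n * int u - 1 = k - 1 + n * int u" by simp
  then have "sw (k + n * int u - 1) = sw (k - 1)" by (simp only: sw_shift)
  then show "rate a b F (k + n * int u) (k + n * int u + 1) = rate a b F k (k + 1)"
    "rate a b F (k + n * int u) (k + n * int u - 1) = rate a b F k (k - 1)"
    unfolding rate_right rate_left by (simp_all add: wt_shift sw_shift HR_shift HL_shift)
qed

lemma gen_periodic:
  assumes "\<And>k. f (k + int u) = f k"
  shows "gen f (k + int u) = gen f k"
  using rate_shift[of k 1] assms[of k] assms[of "k + 1"] assms[of "k - 1"]
  by (simp add: gen_def algebra_simps)

lemma ends_shift: "ends (k + n * int u) = ends k + of_int n"
  by (simp add: ends_def Min_shift)

lemma ends_in: "ends k \<in> F k"
  unfolding ends_def by (rule F_Min_in)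

lemma J_sum_rec:
  "sum f (J k) = f k + (if pv (k - 1) = pv k then sum f (J (k - 1)) else (0::real))"
proof -
  have "k \<notin> J (k - 1)" by (simp add: J_def)
  then show ?thesis by (subst J_rec) (simp add: finite_J)
qed

text \<open>The fluxes telescope along J k, whose leftmost set has no flux to the left. This is the
  discrete counterpart of integrating the equation up to the passage k.\<close>

lemma J_sum_gen: "(\<Sum>j\<in>J k. wt j * gen f j) = (f (k + 1) - f k) / sw k"
proof (induction "card (J k)" arbitrary: k rule: less_induct)
  case less
  show ?case
  proof (cases "pv (k - 1) = pv k")
    case True
    have "k \<notin> J (k - 1)" by (simp add: J_def)
    then have "card (J (k - 1)) < card (J k)" using J_rec[of k] True finite_J[of "k - 1"] by simp
    from less[OF this] show ?thesis using True by (subst J_sum_rec) (simp add: gen_flux)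
  next
    case False
    then show ?thesis by (subst J_sum_rec) (simp add: gen_flux)
  qed
qed

lemma Q_sum: "(\<Sum>q\<in>Q k. weight1 a b q * f q) = (\<Sum>j\<in>J k. wt j * well_mean f j)"
proof -
  have "(\<Sum>q\<in>Q k. weight1 a b q * f q) = (\<Sum>j\<in>J k. \<Sum>q\<in>F j. weight1 a b q * f q)"
    unfolding Q_def using F_disjoint finite_J by (intro sum.UNION_disjoint) auto
  then show ?thesis using well_weight_pos by (simp add: well_mean_def less_imp_neq[symmetric])
qed

lemma well_mean_const: "(\<And>q. q \<in> F k \<Longrightarrow> f q = c) \<Longrightarrow> well_mean f k = c"
  using well_weight_pos[of k] by (simp add: well_mean_def well_weight_def flip: sum_distrib_right)

lemma well_mean_linear:
  "well_mean (\<lambda>x. f x + g x) k = well_mean f k + well_mean g k"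
  "well_mean (\<lambda>x. f x - g x) k = well_mean f k - well_mean g k"
  "well_mean (\<lambda>x. c * f x) k = c * well_mean f k"
  by (simp_all add: well_mean_def sum.distrib sum_subtractf add_divide_distrib diff_divide_distrib
      distrib_left right_diff_distrib sum_distrib_left mult.left_commute sum_divide_distrib)

lemma increment_limit_index:
  assumes ctl: "controlled g v C"
    and c: "\<And>\<epsilon> j. \<epsilon> > 0 \<Longrightarrow> \<bar>c \<epsilon> j\<bar> \<le> C"
    and lim: "\<And>q j. q \<in> F j \<Longrightarrow> tracks v (\<lambda>\<epsilon>. c \<epsilon> j) q"
  shows "((\<lambda>\<epsilon>. g \<epsilon> (ends (k + 1)) - g \<epsilon> (ends k) - sw k * (\<Sum>j\<in>J k. wt j * c \<epsilon> j)) \<longlongrightarrow> 0) (at_right 0)"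
proof -
  define i where "i = (\<lambda>q. THE j. q \<in> F j)"
  have i: "i q = j" if "q \<in> F j" for q j
    unfolding i_def using that F_disjoint by blast
  have "(\<Sum>q\<in>Q k. weight1 a b q * c \<epsilon> (i q)) = (\<Sum>j\<in>J k. wt j * c \<epsilon> j)" for \<epsilon>
    unfolding Q_sum by (intro sum.cong refl arg_cong2[of _ _ _ _ "(*)"] well_mean_const) (simp add: i)
  moreover have "((\<lambda>\<epsilon>. g \<epsilon> (ends (k + 1)) - g \<epsilon> (ends k) - sw k * (\<Sum>q\<in>Q k. weight1 a b q * c \<epsilon> (i q))) \<longlongrightarrow> 0) (at_right 0)"
    by (rule increment_limit[OF ctl]) (use c lim i in \<open>auto simp: Q_def\<close>)
  ultimately show ?thesis by simp
qed

text \<open>The increments determine c summed over J k; taking the difference for k and k - 1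
  recovers c at k, by the same recursion that expresses the generator through fluxes.\<close>

lemma gen_limit:
  assumes ctl: "controlled g v C"
    and c: "\<And>\<epsilon> j. \<epsilon> > 0 \<Longrightarrow> \<bar>c \<epsilon> j\<bar> \<le> C"
    and lim: "\<And>q j. q \<in> F j \<Longrightarrow> tracks v (\<lambda>\<epsilon>. c \<epsilon> j) q"
  shows "((\<lambda>\<epsilon>. gen (\<lambda>k. g \<epsilon> (ends k)) k - c \<epsilon> k) \<longlongrightarrow> 0) (at_right 0)"
proof -
  let ?d = "\<lambda>\<epsilon> k. (g \<epsilon> (ends (k + 1)) - g \<epsilon> (ends k)) / sw k - (\<Sum>j\<in>J k. wt j * c \<epsilon> j)"
  have D: "((\<lambda>\<epsilon>. ?d \<epsilon> k) \<longlongrightarrow> 0) (at_right 0)" for k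
  proof -
    from tendsto_divide[OF increment_limit_index[where k = k, OF ctl c lim] tendsto_const[of "sw k"]] saddle_weight_pos[of k]
    have "((\<lambda>\<epsilon>. (g \<epsilon> (ends (k + 1)) - g \<epsilon> (ends k) - sw k * (\<Sum>j\<in>J k. wt j * c \<epsilon> j)) / sw k) \<longlongrightarrow> 0) (at_right 0)"
      by simp
    then show ?thesis using saddle_weight_pos[of k] by (simp add: diff_divide_distrib)
  qed
  have "((\<lambda>\<epsilon>. (?d \<epsilon> k - of_bool (pv (k - 1) = pv k) * ?d \<epsilon> (k - 1)) / wt k) \<longlongrightarrow> (0 - of_bool (pv (k - 1) = pv k) * 0) / wt k) (at_right 0)"
    using well_weight_pos[of k] by (intro tendsto_intros D) auto
  moreover have "(?d \<epsilon> k - of_bool (pv (k - 1) = pv k) * ?d \<epsilon> (k - 1)) / wt k = gen (\<lambda>k. g \<epsilon> (ends k)) k - c \<epsilon> k" for \<epsilon>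
  proof -
    have "?d \<epsilon> k - of_bool (pv (k - 1) = pv k) * ?d \<epsilon> (k - 1) = wt k * gen (\<lambda>k. g \<epsilon> (ends k)) k - wt k * c \<epsilon> k"
      unfolding gen_flux J_sum_rec[where k = k] by (auto simp: algebra_simps)
    then show ?thesis using well_weight_pos[of k] by (simp add: diff_divide_distrib less_imp_neq[symmetric])
  qed
  ultimately show ?thesis by simp
qed

lemma gen_at_max: "(\<And>j. f j \<le> f k) \<Longrightarrow> gen f k \<le> 0"
  unfolding gen_def using rate_right_pos[of k] rate_left_nonneg[of k]
  by (intro add_nonpos_nonpos mult_nonneg_nonpos) auto

lemma gen_diff: "gen (\<lambda>k. f k - g k) k = gen f k - gen g k"
  and gen_uminus: "gen (\<lambda>k. - f k) k = - gen f k"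
  by (simp_all add: gen_def algebra_simps)

text \<open>Maximum principle: at a maximum of f the generator is nonpositive, which bounds f from
  above there; the same is applied to -f.\<close>

lemma resolvent_bound:
  assumes per: "\<And>k. f (k + int u) = f k" and lam: "lam > 0"
    and bd: "\<And>k. \<bar>gen f k - lam * f k\<bar> \<le> lam * \<eta>"
  shows "\<bar>f k\<bar> \<le> \<eta>"
proof -
  have upper: "f k \<le> \<eta>" if per: "\<And>k. f (k + int u) = f k" and bd: "\<And>k. \<bar>gen f k - lam * f k\<bar> \<le> lam * \<eta>" for f k
  proof -
    obtain k0 where k0: "\<forall>j. f j \<le> f k0" using periodic_int_attains_max[of f u] per u_pos by blast
    have "gen f k0 \<le> 0" using gen_at_max k0 by blast
    then have "lam * f k0 \<le> lam * \<eta>" using bd[of k0] by linarith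
    then show ?thesis using lam k0 by (metis mult_le_cancel_left_pos order_trans)
  qed
  have "- f k \<le> \<eta>"
    by (rule upper) (use per bd in \<open>auto simp: gen_uminus abs_minus_commute\<close>)
  then show ?thesis using upper[OF per bd] by (simp add: abs_le_iff)
qed

lemma cover_ends: "\<exists>n k. k \<in> {0..<int u} \<and> x + of_int n \<in> {ends k..ends (k + 1)}"
proof -
  define n where "n = - \<lfloor>x - ends 0\<rfloor>"
  have y: "ends 0 \<le> x + of_int n" "x + of_int n \<le> ends (int u)"
    using ends_shift[of 0 1] unfolding n_def by (simp_all, linarith+)
  have "\<exists>k\<in>{0..<int (Suc j)}. y \<in> {ends k..ends (k + 1)}" if "ends 0 \<le> y" "y \<le> ends (int (Suc j))" for j y
    using that
  proof (induction j)
    case (Suc j)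
    show ?case
    proof (cases "y \<le> ends (int (Suc j))")
      case True
      then show ?thesis using Suc by fastforce
    next
      case False
      then show ?thesis using Suc.prems by (intro bexI[of _ "int (Suc j)"]) (auto simp: algebra_simps)
    qed
  qed auto
  from this[of "x + of_int n" "u - 1"] y u_pos
  have "\<exists>k\<in>{0..<int u}. x + of_int n \<in> {ends k..ends (k + 1)}" by simp
  then show ?thesis by blast
qed

lemma interpolation_periodic:
  assumes ctl: "controlled g v C" and "\<eta> > 0" and per: "\<And>\<epsilon>. \<epsilon> > 0 \<Longrightarrow> periodic1 (g \<epsilon>)"
  shows "eventually (\<lambda>\<epsilon>. \<forall>x. \<exists>k. \<exists>p\<in>{0..1}.
    \<bar>g \<epsilon> x - ((1 - p) * g \<epsilon> (ends k) + p * g \<epsilon> (ends (k + 1)))\<bar> \<le> \<eta>) (at_right 0)"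
proof -
  have "eventually (\<lambda>\<epsilon>. \<forall>k\<in>{0..<int u}. \<forall>s\<in>{ends k..ends (k + 1)}. \<exists>p\<in>{0..1}.
    \<bar>g \<epsilon> s - (g \<epsilon> (ends k) + p * (g \<epsilon> (ends (k + 1)) - g \<epsilon> (ends k)))\<bar> \<le> \<eta>) (at_right 0)"
    using interpolation[OF ctl assms(2)] by (intro eventually_ball_finite) auto
  then show ?thesis using eventually_at_right_less[of 0]
  proof eventually_elim
    case (elim \<epsilon>)
    show ?case
    proof
      fix x
      obtain n k where nk: "k \<in> {0..<int u}" "x + of_int n \<in> {ends k..ends (k + 1)}" using cover_ends by blast
      obtain p where p: "p \<in> {0..1}"
        "\<bar>g \<epsilon> (x + of_int n) - (g \<epsilon> (ends k) + p * (g \<epsilon> (ends (k + 1)) - g \<epsilon> (ends k)))\<bar> \<le> \<eta>"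
        using elim(1) nk by blast
      have "g \<epsilon> (x + of_int n) = g \<epsilon> x" using periodic1_of_int per elim(2) by blast
      then show "\<exists>k. \<exists>p\<in>{0..1}. \<bar>g \<epsilon> x - ((1 - p) * g \<epsilon> (ends k) + p * g \<epsilon> (ends (k + 1)))\<bar> \<le> \<eta>"
        using p by (intro exI[of _ k] bexI[of _ p]) (auto simp: algebra_simps)
    qed
  qed
qed

section \<open>Explicit integration and the Poisson equation on the circle\<close>

abbreviation "\<theta> \<equiv> time_scale a b F"

text \<open>With the integrating factor exp (- S / \<epsilon>) the equation becomes D' = w. The
  constant of integration is fixed by periodicity of g', and solving for D produces the factor
  \<open>kappa\<close>, the inverse of 1 - exp (- B / \<epsilon>).\<close>

lemma derivative_of_generator:
  assumes eps: "\<epsilon> > 0" and g: "C2_torus g" and v: "\<And>x. v x = \<theta> \<epsilon> * diff_gen a b \<epsilon> g x" "continuous_on UNIV v"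
  shows "(g has_real_derivative kappa \<epsilon> / \<epsilon> * kernel \<epsilon> v t) (at t)"
proof -
  note G = C2_torusD[OF g]
  have th: "\<theta> \<epsilon> > 0" by (simp add: time_scale_def)
  define D where "D = (\<lambda>t. exp (- S t / \<epsilon>) * deriv g t)"
  define w where "w = (\<lambda>y. v y * exp (- S y / \<epsilon>) / (\<theta> \<epsilon> * \<epsilon> * a y))"
  have D': "(D has_real_derivative w t) (at t)" for t
  proof -
    have "((\<lambda>t. exp (- S t / \<epsilon>) * deriv g t) has_real_derivative
        exp (- S t / \<epsilon>) * (- (- (b t / a t)) / \<epsilon>) * deriv g t + deriv (deriv g) t * exp (- S t / \<epsilon>)) (at t)"
      by (intro DERIV_mult G(3) DERIV_chain2[OF DERIV_exp] DERIV_cdivide DERIV_minus S_deriv)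
    moreover have "exp (- S t / \<epsilon>) * (- (- (b t / a t)) / \<epsilon>) * deriv g t + deriv (deriv g) t * exp (- S t / \<epsilon>) = w t"
      unfolding w_def v(1) diff_gen_def using th eps a_pos[of t] by (simp add: field_simps)
    ultimately show ?thesis by (simp add: D_def)
  qed
  have "(w has_integral (D t - D (t - 1))) {t-1..t}"
    by (intro fundamental_theorem_of_calculus)
      (auto simp flip: has_real_derivative_iff_has_vector_derivative intro: has_field_derivative_at_within D')
  \<comment> \<open>S is higher by B one period earlier while g' is periodic.\<close>
  moreover have "D (t - 1) = exp (- B / \<epsilon>) * D t"
  proof -
    have "deriv g (t - 1) = deriv g t" using periodic1_of_int[OF periodic1_deriv[OF G(1)], of t "-1"] by simp
    moreover have "S (t - 1) = S t + B" using S_shift[of t "-1"] by simp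
    ultimately show ?thesis unfolding D_def by (simp add: diff_divide_distrib add_divide_distrib flip: exp_add)
  qed
  ultimately have w: "(w has_integral ((1 - exp (- B / \<epsilon>)) * D t)) {t-1..t}" by (simp add: algebra_simps)
  have "(\<lambda>y. v y * exp ((S t - S y - \<hh>) / \<epsilon>) / a y) = (\<lambda>y. \<epsilon> * exp (S t / \<epsilon>) * w y)"
  proof
    fix y
    have "exp ((S t - S y - \<hh>) / \<epsilon>) = exp (S t / \<epsilon>) * exp (- S y / \<epsilon>) * exp (- \<hh> / \<epsilon>)"
      unfolding mult_exp_exp add_divide_distrib[symmetric] by simp
    also have "exp (- \<hh> / \<epsilon>) = 1 / \<theta> \<epsilon>" by (simp add: time_scale_def exp_minus divide_inverse)
    finally have "exp ((S t - S y - \<hh>) / \<epsilon>) = exp (S t / \<epsilon>) * exp (- S y / \<epsilon>) / \<theta> \<epsilon>" by simp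
    then show "v y * exp ((S t - S y - \<hh>) / \<epsilon>) / a y = \<epsilon> * exp (S t / \<epsilon>) * w y"
      using eps th by (simp add: w_def)
  qed
  then have "kernel \<epsilon> v t = \<epsilon> * exp (S t / \<epsilon>) * ((1 - exp (- B / \<epsilon>)) * D t)"
    unfolding kernel_def using integral_unique[OF has_integral_mult_right[OF w, of "\<epsilon> * exp (S t / \<epsilon>)"]] by simp
  moreover have "exp (S t / \<epsilon>) * D t = deriv g t" by (simp add: D_def exp_minus)
  ultimately have "kernel \<epsilon> v t = \<epsilon> * (1 - exp (- B / \<epsilon>)) * deriv g t" by (simp add: mult.commute mult.left_commute)
  moreover have "kappa \<epsilon> * (1 - exp (- B / \<epsilon>)) = 1" using eps B_pos by (simp add: kappa_def)
  ultimately have "kappa \<epsilon> / \<epsilon> * kernel \<epsilon> v t = deriv g t"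
    using eps by (simp add: mult.assoc[symmetric])
  then show ?thesis using G(2) by simp
qed

lemma controlled_of_generator:
  assumes "\<And>\<epsilon>. \<epsilon> > 0 \<Longrightarrow> C2_torus (g \<epsilon>)" "\<And>\<epsilon> x. \<epsilon> > 0 \<Longrightarrow> v \<epsilon> x = \<theta> \<epsilon> * diff_gen a b \<epsilon> (g \<epsilon>) x"
    "\<And>\<epsilon>. \<epsilon> > 0 \<Longrightarrow> continuous_on UNIV (v \<epsilon>)" "\<And>\<epsilon> x. \<epsilon> > 0 \<Longrightarrow> \<bar>v \<epsilon> x\<bar> \<le> C"
  shows "controlled g v C"
  unfolding controlled_def
  by (intro allI impI conjI derivative_of_generator) (use assms in auto)

text \<open>The converse direction. Moving the window of integration by one period multiplies the
  integral by exp (B / \<epsilon>), which the prefactor exp (S / \<epsilon>) undoes; differentiating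
  gives the first-order equation that g' has to satisfy.\<close>

lemma poisson_kernel_periodic:
  assumes eps: "\<epsilon> > 0" and f: "periodic1 f" "continuous_on UNIV f"
  defines "T \<equiv> \<lambda>s. kappa \<epsilon> / \<epsilon> * kernel \<epsilon> f s"
  shows "T (s + 1) = T s"
    "(T has_real_derivative - (b s / (a s * \<epsilon>)) * T s + f s / (\<theta> \<epsilon> * \<epsilon> * a s)) (at s)"
proof -
  define w where "w = (\<lambda>y. f y * exp (- S y / \<epsilon>) / a y)"
  have wc: "continuous_on UNIV w" unfolding w_def
    using a_pos eps by (intro continuous_intros f S_cont a_cont) (auto simp: less_imp_neq[symmetric])
  have wsh: "w (y + 1) = exp (B / \<epsilon>) * w y" for y
  proof -
    have "exp (- S (y + 1) / \<epsilon>) = exp (B / \<epsilon>) * exp (- S y / \<epsilon>)"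
      unfolding mult_exp_exp add_divide_distrib[symmetric] by (simp add: S_shift1)
    moreover have "f (y + 1) = f y" "a (y + 1) = a y" using f(1) a_periodic[of y 1] by (auto simp: periodic1_def)
    ultimately show ?thesis by (simp add: w_def)
  qed
  have T: "T s = kappa \<epsilon> / \<epsilon> * (exp ((S s - \<hh>) / \<epsilon>) * (primitive w s - primitive w (s - 1)))" for s
  proof -
    have "(w has_integral primitive w s - primitive w (s - 1)) {s-1..s}"
      by (rule primitive_diff_eq_integral[OF wc]) simp
    from integral_unique[OF has_integral_mult_right[OF this, of "exp ((S s - \<hh>) / \<epsilon>)"]]
    have "integral {s-1..s} (\<lambda>y. exp ((S s - \<hh>) / \<epsilon>) * w y) = exp ((S s - \<hh>) / \<epsilon>) * (primitive w s - primitive w (s - 1))" .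
    moreover have "exp ((S s - \<hh>) / \<epsilon>) * w y = f y * exp ((S s - S y - \<hh>) / \<epsilon>) / a y" for y
    proof -
      have "exp ((S s - S y - \<hh>) / \<epsilon>) = exp ((S s - \<hh>) / \<epsilon>) * exp (- S y / \<epsilon>)"
        unfolding mult_exp_exp add_divide_distrib[symmetric] by (simp add: algebra_simps)
      then show ?thesis by (simp add: w_def)
    qed
    ultimately show ?thesis by (simp add: T_def kernel_def)
  qed
  have psh: "primitive w (s + 1) - primitive w s = exp (B / \<epsilon>) * (primitive w s - primitive w (s - 1))" for s
  proof -
    have "((\<lambda>s. primitive w (s + 1) - exp (B / \<epsilon>) * primitive w s) has_real_derivative 0) (at s)" for s
    proof -
      have "((\<lambda>s. primitive w (s + 1)) has_real_derivative w (s + 1)) (at s)"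
        using primitive_has_derivative[OF wc, of "s + 1"] DERIV_shift[of "primitive w" _ s 1] by simp
      from DERIV_diff[OF this DERIV_cmult[OF primitive_has_derivative[OF wc, of s], of "exp (B / \<epsilon>)"]]
      show ?thesis by (simp add: wsh)
    qed
    then have "primitive w (s + 1) - exp (B / \<epsilon>) * primitive w s = primitive w (s - 1 + 1) - exp (B / \<epsilon>) * primitive w (s - 1)"
      by (intro DERIV_isconst_all) auto
    then show ?thesis by (simp add: algebra_simps)
  qed
  have "exp ((S s + - B - \<hh>) / \<epsilon>) * exp (B / \<epsilon>) = exp ((S s - \<hh>) / \<epsilon>)" for s
    unfolding mult_exp_exp add_divide_distrib[symmetric] by simp
  then show "T (s + 1) = T s"
    unfolding T using psh[of s] S_shift1[of s] by (simp add: mult.assoc[symmetric])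
  have ws1: "w (s - 1) = exp (- B / \<epsilon>) * w s"
    using wsh[of "s - 1"] by (simp add: exp_minus field_simps)
  have "((\<lambda>s. primitive w (s - 1)) has_real_derivative w (s - 1)) (at s)"
    using primitive_has_derivative[OF wc, of "s - 1"] DERIV_shift[of "primitive w" _ s "-1"] by simp
  note pd = DERIV_diff[OF primitive_has_derivative[OF wc, of s] this]
  have "((\<lambda>s. exp ((S s - \<hh>) / \<epsilon>)) has_real_derivative exp ((S s - \<hh>) / \<epsilon>) * ((- (b s / a s) - 0) / \<epsilon>)) (at s)"
    by (intro DERIV_chain2[OF DERIV_exp] DERIV_cdivide DERIV_diff S_deriv DERIV_const)
  note td = DERIV_cmult[OF DERIV_mult[OF this pd], of "kappa \<epsilon> / \<epsilon>"]
  have kf: "kappa \<epsilon> * (1 - exp (- B / \<epsilon>)) = 1" using eps B_pos by (simp add: kappa_def)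
  have ef: "exp ((S s - \<hh>) / \<epsilon>) * w s = f s / (\<theta> \<epsilon> * a s)"
    unfolding w_def time_scale_def by (simp add: diff_divide_distrib exp_diff exp_minus)
  have "kappa \<epsilon> / \<epsilon> * (exp ((S s - \<hh>) / \<epsilon>) * ((- (b s / a s) - 0) / \<epsilon>) * (primitive w s - primitive w (s - 1)) +
      (w s - w (s - 1)) * exp ((S s - \<hh>) / \<epsilon>)) = - (b s / (a s * \<epsilon>)) * T s + f s / (\<theta> \<epsilon> * \<epsilon> * a s)"
  proof -
    have "kappa \<epsilon> / \<epsilon> * ((w s - w (s - 1)) * exp ((S s - \<hh>) / \<epsilon>)) =
        (kappa \<epsilon> * (1 - exp (- B / \<epsilon>))) * (exp ((S s - \<hh>) / \<epsilon>) * w s) / \<epsilon>"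
    proof -
      have "(w s - exp (- B / \<epsilon>) * w s) * exp ((S s - \<hh>) / \<epsilon>) = (1 - exp (- B / \<epsilon>)) * (exp ((S s - \<hh>) / \<epsilon>) * w s)"
        by (simp add: algebra_simps)
      then show ?thesis unfolding ws1 by simp
    qed
    also have "\<dots> = f s / (\<theta> \<epsilon> * \<epsilon> * a s)" unfolding kf ef by simp
    finally have 2: "kappa \<epsilon> / \<epsilon> * ((w s - w (s - 1)) * exp ((S s - \<hh>) / \<epsilon>)) = f s / (\<theta> \<epsilon> * \<epsilon> * a s)" .
    have 1: "kappa \<epsilon> / \<epsilon> * (exp ((S s - \<hh>) / \<epsilon>) * ((- (b s / a s) - 0) / \<epsilon>) * (primitive w s - primitive w (s - 1)))
        = - (b s / (a s * \<epsilon>)) * T s"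
      unfolding T by (simp add: ac_simps)
    show ?thesis unfolding distrib_left 1 2 ..
  qed
  note eq = this
  have Teq: "T = (\<lambda>s. kappa \<epsilon> / \<epsilon> * (exp ((S s - \<hh>) / \<epsilon>) * (primitive w s - primitive w (s - 1))))"
    using T by blast
  show "(T has_real_derivative - (b s / (a s * \<epsilon>)) * T s + f s / (\<theta> \<epsilon> * \<epsilon> * a s)) (at s)"
    using DERIV_cong[OF td eq] Teq by simp
qed

lemma kernel_mono_abs:
  assumes f: "continuous_on UNIV f" "\<And>y. \<bar>f y\<bar> \<le> K" and eps: "\<epsilon> > 0"
  shows "\<bar>kernel \<epsilon> f s\<bar> \<le> K * kernel \<epsilon> (\<lambda>_. 1) s"
proof -
  have c: "continuous_on A (\<lambda>y. g y * exp ((S s - S y - \<hh>) / \<epsilon>) / a y)" if "continuous_on UNIV g" for g A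
    using a_pos eps by (intro continuous_intros S_cont a_cont continuous_on_subset[OF that]) (auto simp: less_imp_neq[symmetric])
  have "norm (kernel \<epsilon> f s) \<le> integral {s-1..s} (\<lambda>y. K * (1 * exp ((S s - S y - \<hh>) / \<epsilon>) / a y))"
    unfolding kernel_def
  proof (rule integral_norm_bound_integral)
    fix y
    have "\<bar>f y\<bar> * (exp ((S s - S y - \<hh>) / \<epsilon>) / a y) \<le> K * (exp ((S s - S y - \<hh>) / \<epsilon>) / a y)"
      using f(2)[of y] a_pos[of y] by (intro mult_right_mono) auto
    then show "norm (f y * exp ((S s - S y - \<hh>) / \<epsilon>) / a y) \<le> K * (1 * exp ((S s - S y - \<hh>) / \<epsilon>) / a y)"
      using a_pos[of y] by (simp add: abs_mult)
  qed (use f in \<open>auto intro!: integrable_continuous_interval c continuous_intros\<close>)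
  then show ?thesis unfolding integral_mult_right by (simp add: kernel_def)
qed

lemma kernel_one_pos:
  assumes eps: "\<epsilon> > 0"
  shows "0 < kernel \<epsilon> (\<lambda>_. 1) s"
proof -
  have c: "continuous_on A (\<lambda>y. 1 * exp ((S s - S y - \<hh>) / \<epsilon>) / a y)" for A
    using a_pos eps by (intro continuous_intros S_cont a_cont) (auto simp: less_imp_neq[symmetric])
  have ne: "{s-1..s} \<noteq> {}" by simp
  obtain y0 where y0: "\<forall>y\<in>{s-1..s}. 1 * exp ((S s - S y0 - \<hh>) / \<epsilon>) / a y0 \<le> 1 * exp ((S s - S y - \<hh>) / \<epsilon>) / a y"
    using continuous_attains_inf[OF compact_Icc ne c] by blast
  have "integral {s-1..s} (\<lambda>y. 1 * exp ((S s - S y0 - \<hh>) / \<epsilon>) / a y0) \<le> kernel \<epsilon> (\<lambda>_. 1) s"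
    unfolding kernel_def using y0 by (intro integral_le integrable_continuous_interval c) auto
  moreover have "0 < 1 * exp ((S s - S y0 - \<hh>) / \<epsilon>) / a y0" using a_pos[of y0] by simp
  ultimately show ?thesis by (simp add: content_real)
qed

text \<open>A primitive of the periodic solution T f is periodic only if its mean vanishes.
  Subtracting c times the solution for the constant 1 achieves this, and positivity of the kernel
  gives both solvability for c and the bound by K.\<close>

lemma poisson_solution:
  assumes eps: "\<epsilon> > 0" and f: "periodic1 f" "continuous_on UNIV f" "\<And>x. \<bar>f x\<bar> \<le> K"
  shows "\<exists>g c. C2_torus g \<and> (\<forall>x. \<theta> \<epsilon> * diff_gen a b \<epsilon> g x = f x - c) \<and> \<bar>c\<bar> \<le> K"
proof -
  define T where "T = (\<lambda>f s. kappa \<epsilon> / \<epsilon> * kernel \<epsilon> f s)"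
  have f1: "periodic1 (\<lambda>_. 1)" "continuous_on UNIV (\<lambda>_. 1::real)" by (auto simp: periodic1_def)
  have Tf: "T f (s + 1) = T f s"
    "(T f has_real_derivative - (b s / (a s * \<epsilon>)) * T f s + f s / (\<theta> \<epsilon> * \<epsilon> * a s)) (at s)" for s
    unfolding T_def using poisson_kernel_periodic[OF eps f(1,2)] by blast+
  have T1: "T (\<lambda>_. 1) (s + 1) = T (\<lambda>_. 1) s"
    "(T (\<lambda>_. 1) has_real_derivative - (b s / (a s * \<epsilon>)) * T (\<lambda>_. 1) s + 1 / (\<theta> \<epsilon> * \<epsilon> * a s)) (at s)" for s
    unfolding T_def using poisson_kernel_periodic[OF eps f1] by blast+
  have cf: "continuous_on A (T f)" for A
    by (intro continuous_at_imp_continuous_on ballI DERIV_isCont[OF Tf(2)])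
  have c1: "continuous_on A (T (\<lambda>_. 1))" for A
    by (intro continuous_at_imp_continuous_on ballI DERIV_isCont[OF T1(2)])
  define If where "If = integral {0..1} (T f)"
  define I1 where "I1 = integral {0..1} (T (\<lambda>_. 1))"
  have kp: "kappa \<epsilon> / \<epsilon> > 0" using kappa_pos[OF eps] eps by simp
  have "T (\<lambda>_. 1) s > 0" for s unfolding T_def by (rule mult_pos_pos[OF kp kernel_one_pos[OF eps]])
  then have I1: "I1 > 0"
  proof -
    obtain y0 where y0: "\<forall>y\<in>{0..1}. T (\<lambda>_. 1) y0 \<le> T (\<lambda>_. 1) y"
      using continuous_attains_inf[of "{0..1::real}" "T (\<lambda>_. 1)"] c1 by auto
    have "integral {0..1} (\<lambda>y::real. T (\<lambda>_. 1) y0) \<le> I1"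
      unfolding I1_def using y0 by (intro integral_le integrable_continuous_interval c1) auto
    then show ?thesis using \<open>\<And>s. T (\<lambda>_. 1) s > 0\<close>[of y0] by simp
  qed
  have abs: "\<bar>T f s\<bar> \<le> K * T (\<lambda>_. 1) s" for s
  proof -
    have "kappa \<epsilon> / \<epsilon> * \<bar>kernel \<epsilon> f s\<bar> \<le> kappa \<epsilon> / \<epsilon> * (K * kernel \<epsilon> (\<lambda>_. 1) s)"
      using kernel_mono_abs[OF f(2,3) eps] kp by (intro mult_left_mono) auto
    moreover have "\<bar>T f s\<bar> = kappa \<epsilon> / \<epsilon> * \<bar>kernel \<epsilon> f s\<bar>"
      unfolding T_def abs_mult[of "kappa \<epsilon> / \<epsilon>"] abs_of_pos[OF kp] by (rule refl)
    ultimately show ?thesis unfolding T_def by (simp only: mult.left_commute)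
  qed
  have "norm If \<le> integral {0..1} (\<lambda>s. K * T (\<lambda>_. 1) s)"
    unfolding If_def using abs
    by (intro integral_norm_bound_integral integrable_continuous_interval cf c1 continuous_intros) auto
  then have IfK: "\<bar>If\<bar> \<le> K * I1" by (simp add: I1_def)
  define c where "c = If / I1"
  have cK: "\<bar>c\<bar> \<le> K" using IfK I1 by (simp add: c_def field_simps)
  define g1 where "g1 = (\<lambda>s. T f s - c * T (\<lambda>_. 1) s)"
  have g1c: "continuous_on UNIV g1" unfolding g1_def by (intro continuous_intros cf c1)
  define g2 where "g2 = (\<lambda>s. - (b s / (a s * \<epsilon>)) * g1 s + (f s - c) / (\<theta> \<epsilon> * \<epsilon> * a s))"
  define g where "g = primitive g1"
  have gd: "(g has_real_derivative g1 x) (at x)" for x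
    unfolding g_def by (rule primitive_has_derivative[OF g1c])
  have g1d: "(g1 has_real_derivative g2 x) (at x)" for x
  proof -
    have "(g1 has_real_derivative (- (b x / (a x * \<epsilon>)) * T f x + f x / (\<theta> \<epsilon> * \<epsilon> * a x))
        - c * (- (b x / (a x * \<epsilon>)) * T (\<lambda>_. 1) x + 1 / (\<theta> \<epsilon> * \<epsilon> * a x))) (at x)"
      unfolding g1_def by (intro DERIV_diff DERIV_cmult Tf T1)
    moreover have "(- (b x / (a x * \<epsilon>)) * T f x + f x / (\<theta> \<epsilon> * \<epsilon> * a x))
        - c * (- (b x / (a x * \<epsilon>)) * T (\<lambda>_. 1) x + 1 / (\<theta> \<epsilon> * \<epsilon> * a x)) = g2 x"
      by (simp add: g2_def g1_def algebra_simps diff_divide_distrib)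
    ultimately show ?thesis by simp
  qed
  have th: "\<theta> \<epsilon> > 0" by (simp add: time_scale_def)
  have g2c: "continuous_on UNIV g2"
    unfolding g2_def using a_pos eps th
    by (intro continuous_intros g1c f a_cont C2_torusD(4)[OF b_C2]) (auto simp: less_imp_neq[symmetric])
  have gper: "periodic1 g"
  proof -
    have "((\<lambda>x. g (x + 1) - g x) has_real_derivative 0) (at x)" for x
    proof -
      have "((\<lambda>x. g (x + 1)) has_real_derivative g1 (x + 1)) (at x)"
        using gd[of "x + 1"] DERIV_shift[of g _ x 1] by simp
      from DERIV_diff[OF this gd[of x]] show ?thesis using Tf(1) T1(1) by (simp add: g1_def)
    qed
    then have *: "g (x + 1) - g x = g (0 + 1) - g 0" for x by (intro DERIV_isconst_all) auto
    have "(g1 has_integral g 1 - g 0) {0..1}"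
      unfolding g_def by (rule primitive_diff_eq_integral[OF g1c]) simp
    moreover have "(g1 has_integral If - c * I1) {0..1}"
      unfolding g1_def If_def I1_def
      by (intro has_integral_diff has_integral_mult_right integrable_integral integrable_continuous_interval cf c1)
    ultimately have "g 1 - g 0 = If - c * I1" by (rule has_integral_unique)
    also have "\<dots> = 0" using I1 by (simp add: c_def)
    finally show ?thesis using * by (simp add: periodic1_def)
  qed
  note C2 = C2_torusI[OF gper gd g1d g2c]
  have "\<theta> \<epsilon> * diff_gen a b \<epsilon> g x = f x - c" for x
    unfolding diff_gen_def C2(3) unfolding C2(2) g2_def using th eps a_pos[of x] by (simp add: field_simps)
  then show ?thesis using C2(1) cK by blast
qed

end

section \<open>The tilted stationary state\<close>

definition torus_cont :: "(real \<Rightarrow> real) \<Rightarrow> bool" where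
  "torus_cont f \<longleftrightarrow> periodic1 f \<and> continuous_on UNIV f"

lemma torus_cont_intros:
  "torus_cont (\<lambda>x. c)"
  "torus_cont f \<Longrightarrow> torus_cont g \<Longrightarrow> torus_cont (\<lambda>x. f x + g x)"
  "torus_cont f \<Longrightarrow> torus_cont g \<Longrightarrow> torus_cont (\<lambda>x. f x - g x)"
  "torus_cont f \<Longrightarrow> torus_cont g \<Longrightarrow> torus_cont (\<lambda>x. f x * g x)"
  "torus_cont f \<Longrightarrow> torus_cont g \<Longrightarrow> (\<And>x. g x > 0) \<Longrightarrow> torus_cont (\<lambda>x. f x / g x)"
  "(\<And>i. i \<in> I \<Longrightarrow> torus_cont (p i)) \<Longrightarrow> torus_cont (\<lambda>x. \<Sum>i\<in>I. p i x)"
  by (auto simp: torus_cont_def periodic1_def less_imp_neq[symmetric] intro!: continuous_intros)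

lemma torus_cont_C2:
  assumes "C2_torus f"
  shows "torus_cont f" "torus_cont (deriv f)" "torus_cont (deriv (deriv f))"
  using C2_torusD[OF assms] by (auto simp: torus_cont_def intro: periodic1_deriv)

lemma torus_cont_bounded: "torus_cont f \<Longrightarrow> \<exists>C>0. \<forall>x. \<bar>f x\<bar> \<le> C"
  using periodic1_bounded by (auto simp: torus_cont_def)

lemma torus_cont_measurable:
  assumes "torus_cont f" "torus_prob \<mu>"
  shows "f \<in> borel_measurable \<mu>"
proof -
  have "f \<in> borel_measurable borel"
    using assms(1) by (auto simp: torus_cont_def intro: borel_measurable_continuous_onI)
  then have "f \<in> borel_measurable torus_borel"
    unfolding torus_borel_def by (rule measurable_restrict_space1)
  then show ?thesis
    using assms(2) measurable_cong_sets[of \<mu> torus_borel borel borel] by (auto simp: torus_prob_def)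
qed

lemma torus_cont_integrable:
  assumes "torus_cont f" "torus_prob \<mu>"
  shows "integrable \<mu> f"
proof -
  interpret prob_space \<mu> using assms(2) by (simp add: torus_prob_def)
  obtain C where "\<forall>x. \<bar>f x\<bar> \<le> C" using torus_cont_bounded[OF assms(1)] by blast
  then show ?thesis
    by (intro integrable_const_bound[where B = C] torus_cont_measurable assms) auto
qed

lemma C2_torus_attains_min:
  assumes "C2_torus f"
  shows "\<exists>x. (\<forall>y. f x \<le> f y) \<and> deriv f x = 0 \<and> 0 \<le> deriv (deriv f) x"
proof -
  note D = C2_torusD[OF assms]
  have per: "periodic1 (\<lambda>x. - f x)" using D(1) by (simp add: periodic1_def)
  have cont: "continuous_on UNIV (\<lambda>x. - deriv (deriv f) x)" by (intro continuous_intros D)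
  note neg = C2_torusI[OF per DERIV_minus[OF D(2)] DERIV_minus[OF D(3)] cont]
  show ?thesis using C2_torus_attains_max[OF neg(1)] unfolding neg(3) unfolding neg(2) by auto
qed

lemma C2_torus_divide:
  assumes g: "C2_torus g" and p: "C2_torus p" and pos: "\<And>x. p x > 0"
  defines "f1 \<equiv> \<lambda>x. (deriv g x * p x - g x * deriv p x) / (p x * p x)"
  defines "f2 \<equiv> \<lambda>x. ((deriv (deriv g) x * p x - g x * deriv (deriv p) x) * (p x * p x)
    - (deriv g x * p x - g x * deriv p x) * (2 * p x * deriv p x)) / ((p x * p x) * (p x * p x))"
  shows "C2_torus (\<lambda>x. g x / p x)" "deriv (\<lambda>x. g x / p x) = f1" "deriv (deriv (\<lambda>x. g x / p x)) = f2"
proof -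
  note G = C2_torusD[OF g] and P = C2_torusD[OF p]
  have nz: "p x \<noteq> 0" for x using pos[of x] by simp
  have per: "periodic1 (\<lambda>x. g x / p x)" using G(1) P(1) by (simp add: periodic1_def)
  have 1: "((\<lambda>x. g x / p x) has_real_derivative f1 x) (at x)" for x
    unfolding f1_def by (intro DERIV_divide G P nz)
  have 2: "(f1 has_real_derivative f2 x) (at x)" for x
  proof -
    have "((\<lambda>x. deriv g x * p x - g x * deriv p x) has_real_derivative
        (deriv (deriv g) x * p x + deriv p x * deriv g x) - (deriv g x * deriv p x + deriv (deriv p) x * g x)) (at x)"
      by (intro DERIV_diff DERIV_mult G P)
    note D = DERIV_divide[OF this DERIV_mult[OF P(2) P(2)]]
    have "p x * p x \<noteq> 0" using nz[of x] by simp
    from D[OF this] show ?thesis unfolding f1_def f2_def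
      by (rule DERIV_cong) (simp add: algebra_simps)
  qed
  have 3: "continuous_on UNIV f2"
    unfolding f2_def using nz by (intro continuous_intros G P) auto
  show "C2_torus (\<lambda>x. g x / p x)" "deriv (\<lambda>x. g x / p x) = f1" "deriv (deriv (\<lambda>x. g x / p x)) = f2"
    using C2_torusI[OF per 1 2 3] by blast+
qed

lemma C2_torus_add_const:
  assumes "C2_torus g"
  shows "C2_torus (\<lambda>x. g x + c)" "diff_gen a b \<epsilon> (\<lambda>x. g x + c) = diff_gen a b \<epsilon> g"
proof -
  note G = C2_torusD[OF assms]
  have per: "periodic1 (\<lambda>x. g x + c)" using G(1) by (simp add: periodic1_def)
  have d: "((\<lambda>x. g x + c) has_real_derivative deriv g x) (at x)" for x
    using DERIV_add[OF G(2) DERIV_const] by simp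
  note C = C2_torusI[OF per d G(3) G(6)]
  show "C2_torus (\<lambda>x. g x + c)" "diff_gen a b \<epsilon> (\<lambda>x. g x + c) = diff_gen a b \<epsilon> g"
    using C by (auto simp: diff_gen_def)
qed

text \<open>The Doob transform: conjugating L by p produces the additional drift 2 * \<epsilon> * a
  * p' / p and a potential term, which appears here as the multiple of L p.\<close>

lemma tilted_gen_quotient:
  assumes g: "C2_torus g" and p: "C2_torus p" and pos: "\<And>x. p x > 0"
  shows "tilted_gen a b \<epsilon> p (\<lambda>x. g x / p x) x = (diff_gen a b \<epsilon> g x - g x / p x * diff_gen a b \<epsilon> p x) / p x"
proof -
  have "p x \<noteq> 0" using pos[of x] by simp
  then show ?thesis
    unfolding tilted_gen_def diff_gen_def C2_torus_divide(3)[OF assms] unfolding C2_torus_divide(2)[OF assms]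
    by (simp add: divide_simps) (simp add: algebra_simps power2_eq_square)
qed

lemma periodic_sum_diff:
  fixes f :: "int \<Rightarrow> real"
  assumes "\<And>k. f (k + int u) = f k"
  shows "(\<Sum>k\<in>{0..<int u}. f (k + 1) - f k) = 0"
proof -
  have "(\<Sum>k\<in>{0..<int u}. f (k + 1)) = sum f {1..<1 + int u}"
    by (rule sum.reindex_bij_witness[of _ "\<lambda>k. k - 1" "\<lambda>k. k + 1"]) auto
  also have "\<dots> = sum f {0..<int u}" using periodic_sum_shift[of f u 1, OF assms] by simp
  finally show ?thesis by (simp add: sum_subtractf)
qed

text \<open>Like \<open>tracks\<close>, but with a fixed limit instead of a moving centre, so that
  products and quotients can be taken.\<close>

definition near_limit :: "(real \<Rightarrow> real \<Rightarrow> real) \<Rightarrow> real \<Rightarrow> real \<Rightarrow> bool" where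
  "near_limit f q L \<longleftrightarrow> ((\<lambda>p. f (fst p) (snd p)) \<longlongrightarrow> L) (at_right 0 \<times>\<^sub>F nhds q)"

lemma near_limit_tracks:
  assumes "tracks f c q" "(c \<longlongrightarrow> L) (at_right 0)"
  shows "near_limit f q L"
proof -
  have "tracks f (\<lambda>_. L) q"
    using assms(2) by (intro tracks_shift_center[OF assms(1)]) (simp add: LIM_zero_iff)
  then show ?thesis by (simp add: tracks_def near_limit_def case_prod_unfold LIM_zero_iff)
qed

lemma near_limit_continuous:
  assumes "torus_cont f"
  shows "near_limit (\<lambda>\<epsilon>. f) q (f q)"
proof (rule near_limit_tracks[OF tracks_continuous tendsto_const])
  show "isCont f q" using assms by (simp add: torus_cont_def continuous_on_eq_continuous_at)
qed

lemma near_limit_intros: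
  "near_limit (\<lambda>\<epsilon> x. c) q c"
  "near_limit f q K \<Longrightarrow> near_limit g q L \<Longrightarrow> near_limit (\<lambda>\<epsilon> x. f \<epsilon> x + g \<epsilon> x) q (K + L)"
  "near_limit f q K \<Longrightarrow> near_limit g q L \<Longrightarrow> near_limit (\<lambda>\<epsilon> x. f \<epsilon> x - g \<epsilon> x) q (K - L)"
  "near_limit f q K \<Longrightarrow> near_limit g q L \<Longrightarrow> near_limit (\<lambda>\<epsilon> x. f \<epsilon> x * g \<epsilon> x) q (K * L)"
  "near_limit f q K \<Longrightarrow> near_limit g q L \<Longrightarrow> L \<noteq> 0 \<Longrightarrow> near_limit (\<lambda>\<epsilon> x. f \<epsilon> x / g \<epsilon> x) q (K / L)"
  unfolding near_limit_def by (auto intro: tendsto_intros)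

section \<open>Poisson equations whose solutions converge on the wells\<close>

context nonreversible_family
begin

definition poisson_family ::
    "(real \<Rightarrow> real) \<Rightarrow> (int \<Rightarrow> real) \<Rightarrow> (real \<Rightarrow> real \<Rightarrow> real) \<Rightarrow> (real \<Rightarrow> real) \<Rightarrow> bool" where
  "poisson_family f H g c \<longleftrightarrow>
    (\<forall>\<epsilon>>0. C2_torus (g \<epsilon>) \<and> (\<forall>x. \<theta> \<epsilon> * diff_gen a b \<epsilon> (g \<epsilon>) x = f x - c \<epsilon>)) \<and>
    (\<exists>K. controlled g (\<lambda>\<epsilon> x. f x - c \<epsilon>) K) \<and> (c \<longlongrightarrow> 0) (at_right 0) \<and>
    (\<forall>k. ((\<lambda>\<epsilon>. g \<epsilon> (ends k)) \<longlongrightarrow> H k) (at_right 0))"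

lemma poisson_familyD:
  assumes "poisson_family f H g c"
  shows "\<epsilon> > 0 \<Longrightarrow> C2_torus (g \<epsilon>)" "\<epsilon> > 0 \<Longrightarrow> \<theta> \<epsilon> * diff_gen a b \<epsilon> (g \<epsilon>) x = f x - c \<epsilon>"
    "\<exists>K. controlled g (\<lambda>\<epsilon> x. f x - c \<epsilon>) K" "(c \<longlongrightarrow> 0) (at_right 0)"
    "((\<lambda>\<epsilon>. g \<epsilon> (ends k)) \<longlongrightarrow> H k) (at_right 0)"
  using assms unfolding poisson_family_def by blast+

text \<open>Without c the increments of g tend to those of H, by telescoping the fluxes of H. The
  increments of both g and H sum to zero around the circle, so what c contributes in total must
  vanish in the limit, and its coefficient is positive.\<close>

lemma poisson_limit:
  assumes f: "torus_cont f" and Hper: "\<And>k. H (k + int u) = H k" and fH: "\<And>k. well_mean f k = gen H k"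
  shows "\<exists>g c. poisson_family f H g c"
proof -
  obtain K where K: "K > 0" "\<And>x. \<bar>f x\<bar> \<le> K" using torus_cont_bounded[OF f] by blast
  have fp: "periodic1 f" "continuous_on UNIV f" using f by (auto simp: torus_cont_def)
  have "\<forall>\<epsilon>. \<exists>g c. \<epsilon> > 0 \<longrightarrow> C2_torus g \<and> (\<forall>x. \<theta> \<epsilon> * diff_gen a b \<epsilon> g x = f x - c) \<and> \<bar>c\<bar> \<le> K"
    using poisson_solution[OF _ fp K(2)] by blast
  then obtain g0 where "\<forall>\<epsilon>. \<exists>c. \<epsilon> > 0 \<longrightarrow> C2_torus (g0 \<epsilon>) \<and> (\<forall>x. \<theta> \<epsilon> * diff_gen a b \<epsilon> (g0 \<epsilon>) x = f x - c) \<and> \<bar>c\<bar> \<le> K"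
    by (rule choice[THEN exE])
  then obtain c where "\<forall>\<epsilon>. \<epsilon> > 0 \<longrightarrow> C2_torus (g0 \<epsilon>) \<and> (\<forall>x. \<theta> \<epsilon> * diff_gen a b \<epsilon> (g0 \<epsilon>) x = f x - c \<epsilon>) \<and> \<bar>c \<epsilon>\<bar> \<le> K"
    by (rule choice[THEN exE])
  then have g0: "C2_torus (g0 \<epsilon>)" "\<theta> \<epsilon> * diff_gen a b \<epsilon> (g0 \<epsilon>) x = f x - c \<epsilon>" "\<bar>c \<epsilon>\<bar> \<le> K" if "\<epsilon> > 0" for \<epsilon> x
    using that by auto
  have bd: "\<bar>f x - c \<epsilon>\<bar> \<le> 2 * K" if "\<epsilon> > 0" for \<epsilon> x
    using K(2)[of x] g0(3)[OF that] by linarith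
  \<comment> \<open>The additive constant left free by the equation is fixed so that g agrees with H
    at the reference point of the set 0.\<close>
  define g where "g = (\<lambda>\<epsilon> x. g0 \<epsilon> x + (H 0 - g0 \<epsilon> (ends 0)))"
  have g: "C2_torus (g \<epsilon>)" "\<theta> \<epsilon> * diff_gen a b \<epsilon> (g \<epsilon>) x = f x - c \<epsilon>" if "\<epsilon> > 0" for \<epsilon> x
    unfolding g_def using C2_torus_add_const[OF g0(1)[OF that]] g0(2)[OF that] by simp_all
  have ctl: "controlled g (\<lambda>\<epsilon> x. f x - c \<epsilon>) (2 * K)"
    by (rule controlled_of_generator) (use g bd fp in \<open>auto intro!: continuous_intros\<close>)
  \<comment> \<open>The amount by which c lowers the increment across the passage k, per unit of
    c.\<close>
  define p where "p = (\<lambda>k. sw k * (\<Sum>j\<in>J k. wt j))"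
  have ppos: "p k > 0" for k
    unfolding p_def using J_self[of k] finite_J saddle_weight_pos well_weight_pos
    by (intro mult_pos_pos sum_pos) auto
  have inc: "((\<lambda>\<epsilon>. g \<epsilon> (ends (k + 1)) - g \<epsilon> (ends k) - (H (k + 1) - H k) + c \<epsilon> * p k) \<longlongrightarrow> 0) (at_right 0)" for k
  proof -
    have i1: "((\<lambda>\<epsilon>. g \<epsilon> (ends (k + 1)) - g \<epsilon> (ends k) - sw k * (\<Sum>q\<in>Q k. weight1 a b q * (f q - c \<epsilon>))) \<longlongrightarrow> 0) (at_right 0)"
    proof (rule increment_limit[OF ctl])
      show "tracks (\<lambda>\<epsilon> x. f x - c \<epsilon>) (\<lambda>\<epsilon>. f q - c \<epsilon>) q" for q
        using fp(2) by (intro tracks_diff tracks_const tracks_continuous) (simp add: continuous_on_eq_continuous_at)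
    qed (use bd in auto)
    have i2: "sw k * (\<Sum>q\<in>Q k. weight1 a b q * (f q - c \<epsilon>)) = (H (k + 1) - H k) - c \<epsilon> * p k" for \<epsilon>
    proof -
      have "well_mean (\<lambda>q. f q - c \<epsilon>) j = gen H j - c \<epsilon>" for j
        unfolding well_mean_linear fH by (simp add: well_mean_const)
      then have "(\<Sum>q\<in>Q k. weight1 a b q * (f q - c \<epsilon>)) = (\<Sum>j\<in>J k. wt j * gen H j) - c \<epsilon> * (\<Sum>j\<in>J k. wt j)"
        unfolding Q_sum by (simp add: right_diff_distrib sum_subtractf sum_distrib_left mult.commute)
      then show ?thesis unfolding J_sum_gen using saddle_weight_pos[of k] by (simp add: p_def field_simps)
    qed
    from i1 show ?thesis unfolding i2 by (simp add: algebra_simps)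
  qed
  have gper: "g \<epsilon> (ends (k + int u)) = g \<epsilon> (ends k)" if "\<epsilon> > 0" for \<epsilon> k
    using ends_shift[of k 1] periodic1_of_int[OF C2_torusD(1)[OF g(1)[OF that]], of "ends k" 1] by simp
  have c0: "(c \<longlongrightarrow> 0) (at_right 0)"
  proof -
    have "((\<lambda>\<epsilon>. \<Sum>k\<in>{0..<int u}. g \<epsilon> (ends (k + 1)) - g \<epsilon> (ends k) - (H (k + 1) - H k) + c \<epsilon> * p k) \<longlongrightarrow> 0) (at_right 0)"
      by (intro tendsto_null_sum inc)
    moreover have "eventually (\<lambda>\<epsilon>. (\<Sum>k\<in>{0..<int u}. g \<epsilon> (ends (k + 1)) - g \<epsilon> (ends k) - (H (k + 1) - H k) + c \<epsilon> * p k)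
        = c \<epsilon> * (\<Sum>k\<in>{0..<int u}. p k)) (at_right 0)"
      using eventually_at_right_less[of 0]
    proof eventually_elim
      case (elim \<epsilon>)
      show ?case
        using periodic_sum_diff[of "\<lambda>k. g \<epsilon> (ends k)" u, OF gper[OF elim]] periodic_sum_diff[of H u, OF Hper]
        by (simp add: sum.distrib sum_subtractf sum_distrib_left)
    qed
    ultimately have "((\<lambda>\<epsilon>. c \<epsilon> * (\<Sum>k\<in>{0..<int u}. p k)) \<longlongrightarrow> 0) (at_right 0)" by (rule Lim_transform_eventually)
    from tendsto_mult_right[OF this, of "1 / (\<Sum>k\<in>{0..<int u}. p k)"]
    have "((\<lambda>\<epsilon>. c \<epsilon> * (\<Sum>k\<in>{0..<int u}. p k) * (1 / (\<Sum>k\<in>{0..<int u}. p k))) \<longlongrightarrow> 0) (at_right 0)" by simp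
    moreover have "(\<Sum>k\<in>{0..<int u}. p k) > 0" using u_pos ppos by (intro sum_pos) auto
    ultimately show ?thesis by simp
  qed
  have inc': "((\<lambda>\<epsilon>. g \<epsilon> (ends (k + 1)) - g \<epsilon> (ends k)) \<longlongrightarrow> H (k + 1) - H k) (at_right 0)" for k
  proof -
    have "((\<lambda>\<epsilon>. g \<epsilon> (ends (k + 1)) - g \<epsilon> (ends k) - (H (k + 1) - H k) + c \<epsilon> * p k - c \<epsilon> * p k) \<longlongrightarrow> 0 - 0 * p k) (at_right 0)"
      by (intro tendsto_intros inc c0)
    then show ?thesis by (simp add: LIM_zero_iff)
  qed
  have lim: "((\<lambda>\<epsilon>. g \<epsilon> (ends k)) \<longlongrightarrow> H k) (at_right 0)" for k
  proof (induction k rule: int_induct[where k = 0])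
    case base
    show ?case by (simp add: g_def)
  next
    case (step1 i)
    from tendsto_add[OF step1(2) inc'[of i]] show ?case by simp
  next
    case (step2 i)
    from tendsto_diff[OF step2(2) inc'[of "i - 1"]] show ?case by simp
  qed
  have "poisson_family f H g c" unfolding poisson_family_def using g ctl c0 lim by blast
  then show ?thesis by blast
qed

text \<open>Between reference points g is close to a convex combination of its values there, so
  bounds on finitely many limits extend to the whole circle.\<close>

lemma uniform_bound:
  assumes ctl: "controlled g v C" and per: "\<And>\<epsilon>. \<epsilon> > 0 \<Longrightarrow> periodic1 (g \<epsilon>)"
    and lim: "\<And>k. ((\<lambda>\<epsilon>. g \<epsilon> (ends k)) \<longlongrightarrow> H k) (at_right 0)"
    and H: "\<And>k. lo \<le> H k" "\<And>k. H k \<le> hi" and \<eta>: "\<eta> > 0"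
  shows "eventually (\<lambda>\<epsilon>. \<forall>x. lo - \<eta> \<le> g \<epsilon> x \<and> g \<epsilon> x \<le> hi + \<eta>) (at_right 0)"
proof -
  have e1: "eventually (\<lambda>\<epsilon>. \<forall>k\<in>{0..<int u}. \<bar>g \<epsilon> (ends k) - H k\<bar> < \<eta> / 2) (at_right 0)"
  proof (intro eventually_ball_finite ballI)
    fix k
    show "eventually (\<lambda>\<epsilon>. \<bar>g \<epsilon> (ends k) - H k\<bar> < \<eta> / 2) (at_right 0)"
      using tendstoD[OF lim, of "\<eta> / 2" k] \<eta> by (simp add: dist_real_def)
  qed auto
  have e2: "eventually (\<lambda>\<epsilon>. \<forall>x. \<exists>k. \<exists>p\<in>{0..1}.
    \<bar>g \<epsilon> x - ((1 - p) * g \<epsilon> (ends k) + p * g \<epsilon> (ends (k + 1)))\<bar> \<le> \<eta> / 2) (at_right 0)"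
    using \<eta> by (intro interpolation_periodic[OF ctl _ per]) auto
  show ?thesis using e1 e2 eventually_at_right_less[of 0]
  proof eventually_elim
    case (elim \<epsilon>)
    have in_range: "lo - \<eta> / 2 \<le> g \<epsilon> (ends k) \<and> g \<epsilon> (ends k) \<le> hi + \<eta> / 2" for k
    proof -
      have "g \<epsilon> (ends k) = g \<epsilon> (ends (k mod int u))"
        using periodic_int_mod[of "\<lambda>k. g \<epsilon> (ends k)" u k] ends_shift[of _ 1] per[OF elim(3)]
        by (simp add: periodic1_def)
      moreover have "k mod int u \<in> {0..<int u}" using u_pos by simp
      ultimately show ?thesis using elim(1) H[of "k mod int u"] by (smt (verit, best))
    qed
    show ?case
    proof
      fix x
      obtain k p where p: "p \<in> {0..1}" "\<bar>g \<epsilon> x - ((1 - p) * g \<epsilon> (ends k) + p * g \<epsilon> (ends (k + 1)))\<bar> \<le> \<eta> / 2"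
        using elim(2) by blast
      have "(1 - p) * g \<epsilon> (ends k) + p * g \<epsilon> (ends (k + 1)) \<le> (1 - p) * (hi + \<eta> / 2) + p * (hi + \<eta> / 2)"
        using p(1) in_range by (intro add_mono mult_left_mono) auto
      moreover have "(1 - p) * (lo - \<eta> / 2) + p * (lo - \<eta> / 2) \<le> (1 - p) * g \<epsilon> (ends k) + p * g \<epsilon> (ends (k + 1))"
        using p(1) in_range by (intro add_mono mult_left_mono) auto
      moreover have "(1 - p) * X + p * X = X" for X by (simp add: algebra_simps)
      ultimately have "(1 - p) * g \<epsilon> (ends k) + p * g \<epsilon> (ends (k + 1)) \<le> hi + \<eta> / 2"
        "lo - \<eta> / 2 \<le> (1 - p) * g \<epsilon> (ends k) + p * g \<epsilon> (ends (k + 1))" by metis+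
      then show "lo - \<eta> \<le> g \<epsilon> x \<and> g \<epsilon> x \<le> hi + \<eta>"
        using p(2) by (smt (verit) field_sum_of_halves)
    qed
  qed
qed

end

text \<open>What the limit requires of the remaining data: the cutoffs are exact indicators at the
  minima of the family, and \<open>om\<close> is a normalized stationary state, in weak form, of the
  chain tilted by h.\<close>

locale tilted_family = nonreversible_family +
  fixes lam :: real and \<zeta> :: "int \<Rightarrow> real \<Rightarrow> real" and h :: "real set \<Rightarrow> real" and om :: "int \<Rightarrow> real"
    and \<phi> :: "real \<Rightarrow> real \<Rightarrow> real" and M :: "real \<Rightarrow> real measure"
  assumes zeta_cont: "k \<in> {0..<int u} \<Longrightarrow> torus_cont (\<zeta> k)"
    and zeta_at: "k \<in> {0..<int u} \<Longrightarrow> q \<in> F j \<Longrightarrow> \<zeta> k q = of_bool (j mod int u = k)"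
    and h_pos: "0 < h (P k)" and lam_pos: "0 < lam"
    and resolvent: "\<epsilon> > 0 \<Longrightarrow> resolvent_solution a b F \<zeta> h lam \<epsilon> (\<phi> \<epsilon>)"
    and stationary: "\<epsilon> > 0 \<Longrightarrow> (\<forall>x. 0 < \<phi> \<epsilon> x) \<Longrightarrow> stationary_state (tilted_gen a b \<epsilon> (\<phi> \<epsilon>)) (M \<epsilon>)"
    and om_per: "om (k + int u) = om k" and om_sum: "(\<Sum>k\<in>{0..<int u}. om k) = 1"
    and om_stationary: "(\<And>k. H (k + int u) = H k) \<Longrightarrow>
      (\<Sum>k\<in>{0..<int u}. om k / h (P k) * (gen H k - gen (\<lambda>k. h (P k)) k / h (P k) * H k)) = 0"
begin

definition hk :: "int \<Rightarrow> real" where "hk k = h (P k)"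
definition gk :: "int \<Rightarrow> real" where "gk k = lam * hk k - gen hk k"
definition G :: "real \<Rightarrow> real" where "G x = (\<Sum>k\<in>{0..<int u}. gk k * \<zeta> k x)"

lemma hk_pos: "0 < hk k" and hk_per: "hk (k + int u) = hk k"
  using h_pos P_shift[of k 1] by (auto simp: hk_def)

lemma gk_per: "gk (k + int u) = gk k"
  unfolding gk_def using gen_periodic[of hk, OF hk_per] hk_per by simp

lemma zeta_sum:
  assumes "q \<in> F j" "\<And>k. c (k + int u) = c k"
  shows "(\<Sum>k\<in>{0..<int u}. c k * \<zeta> k q) = c j"
proof -
  have "(\<Sum>k\<in>{0..<int u}. c k * \<zeta> k q) = (\<Sum>k\<in>{0..<int u}. if k = j mod int u then c k else 0)"
    using assms(1) by (intro sum.cong refl) (simp add: zeta_at)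
  also have "\<dots> = c (j mod int u)" using u_pos by simp
  also have "\<dots> = c j" using periodic_int_mod[of c u, OF assms(2)] by simp
  finally show ?thesis .
qed

lemma zeta_comb_cont: "torus_cont (\<lambda>x. \<Sum>k\<in>{0..<int u}. c k * \<zeta> k x)"
  by (intro torus_cont_intros zeta_cont)

lemma G_cont: "torus_cont G"
  unfolding G_def[abs_def] by (rule zeta_comb_cont)

lemma G_at: "q \<in> F j \<Longrightarrow> G q = gk j"
  unfolding G_def by (rule zeta_sum) (simp_all add: gk_per)

lemma phi: "C2_torus (\<phi> \<epsilon>)" "lam * \<phi> \<epsilon> x - \<theta> \<epsilon> * diff_gen a b \<epsilon> (\<phi> \<epsilon>) x = G x" if "\<epsilon> > 0" for \<epsilon> x
  using resolvent[OF that] unfolding resolvent_solution_def num_classes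
  by (simp_all add: G_def gk_def hk_def[abs_def] proj_gen_eq)

text \<open>Maximum principle: L \<phi> is nonpositive at a maximum and nonnegative at a minimum, so
  lam * \<phi> is bounded by the extremes of G.\<close>

lemma phi_bound: "\<exists>C>0. \<forall>\<epsilon>>0. \<forall>x. \<bar>\<phi> \<epsilon> x\<bar> \<le> C"
proof -
  obtain K where K: "K > 0" "\<And>x. \<bar>G x\<bar> \<le> K" using torus_cont_bounded[OF G_cont] by blast
  have th: "\<theta> \<epsilon> > 0" for \<epsilon> by (simp add: time_scale_def)
  have "\<bar>\<phi> \<epsilon> x\<bar> \<le> K / lam" if eps: "\<epsilon> > 0" for \<epsilon> x
  proof -
    obtain y where y: "\<forall>z. \<phi> \<epsilon> z \<le> \<phi> \<epsilon> y" "deriv (\<phi> \<epsilon>) y = 0" "deriv (deriv (\<phi> \<epsilon>)) y \<le> 0"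
      using C2_torus_attains_max[OF phi(1)[OF eps]] by blast
    have "\<epsilon> * a y * deriv (deriv (\<phi> \<epsilon>)) y \<le> 0" using y(3) a_pos[of y] eps by (simp add: mult_nonneg_nonpos)
    then have "\<theta> \<epsilon> * diff_gen a b \<epsilon> (\<phi> \<epsilon>) y \<le> 0"
      using y(2) th[of \<epsilon>] by (simp add: diff_gen_def mult_nonneg_nonpos)
    then have "lam * \<phi> \<epsilon> y \<le> K" using phi(2)[OF eps, of y] K(2)[of y] by linarith
    moreover have "lam * \<phi> \<epsilon> x \<le> lam * \<phi> \<epsilon> y" using y(1) lam_pos by simp
    ultimately have "lam * \<phi> \<epsilon> x \<le> K" by linarith
    then have up: "\<phi> \<epsilon> x \<le> K / lam" using lam_pos by (simp add: pos_le_divide_eq mult.commute)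
    obtain y where y: "\<forall>z. \<phi> \<epsilon> y \<le> \<phi> \<epsilon> z" "deriv (\<phi> \<epsilon>) y = 0" "0 \<le> deriv (deriv (\<phi> \<epsilon>)) y"
      using C2_torus_attains_min[OF phi(1)[OF eps]] by blast
    have "0 \<le> \<epsilon> * a y * deriv (deriv (\<phi> \<epsilon>)) y" using y(3) a_pos[of y] eps by simp
    then have "0 \<le> \<theta> \<epsilon> * diff_gen a b \<epsilon> (\<phi> \<epsilon>) y"
      using y(2) th[of \<epsilon>] by (simp add: diff_gen_def)
    then have "- K \<le> lam * \<phi> \<epsilon> y" using phi(2)[OF eps, of y] K(2)[of y] by linarith
    then have "- (K / lam) \<le> \<phi> \<epsilon> y" using lam_pos by (simp add: field_simps)
    then have "- (K / lam) \<le> \<phi> \<epsilon> x" using y(1) by (meson order_trans)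
    then show ?thesis using up by (simp add: abs_le_iff)
  qed
  then show ?thesis using K lam_pos by (intro exI[of _ "K / lam"]) auto
qed

lemma phi_controlled: "\<exists>C>0. controlled \<phi> (\<lambda>\<epsilon> x. lam * \<phi> \<epsilon> x - G x) C \<and>
  (\<forall>\<epsilon>>0. \<forall>j. \<bar>lam * \<phi> \<epsilon> (ends j) - gk j\<bar> \<le> C)"
proof -
  obtain C where C: "C > 0" "\<And>\<epsilon> x. \<epsilon> > 0 \<Longrightarrow> \<bar>\<phi> \<epsilon> x\<bar> \<le> C" using phi_bound by blast
  obtain K where K: "K > 0" "\<And>x. \<bar>G x\<bar> \<le> K" using torus_cont_bounded[OF G_cont] by blast
  have bd: "\<bar>lam * \<phi> \<epsilon> x - G x\<bar> \<le> lam * C + K" if "\<epsilon> > 0" for \<epsilon> x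
  proof -
    have "\<bar>lam * \<phi> \<epsilon> x\<bar> \<le> lam * C" using C(2)[OF that, of x] lam_pos by (simp add: abs_mult)
    then show ?thesis using K(2)[of x] by linarith
  qed
  have ctl: "controlled \<phi> (\<lambda>\<epsilon> x. lam * \<phi> \<epsilon> x - G x) (lam * C + K)"
  proof (rule controlled_of_generator[OF phi(1)])
    show "lam * \<phi> \<epsilon> x - G x = \<theta> \<epsilon> * diff_gen a b \<epsilon> (\<phi> \<epsilon>) x" if "\<epsilon> > 0" for \<epsilon> x
      using phi(2)[OF that, of x] by linarith
    show "continuous_on UNIV (\<lambda>x. lam * \<phi> \<epsilon> x - G x)" if "\<epsilon> > 0" for \<epsilon>
      using C2_torusD(4)[OF phi(1)[OF that]] G_cont by (auto simp: torus_cont_def intro!: continuous_intros)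
  qed (use bd in auto)
  have "\<bar>lam * \<phi> \<epsilon> (ends j) - gk j\<bar> \<le> lam * C + K" if "\<epsilon> > 0" for \<epsilon> j
    using bd[OF that, of "ends j"] G_at[OF ends_in, of j] by simp
  then show ?thesis using ctl C K lam_pos by (intro exI[of _ "lam * C + K"]) (auto simp: add_pos_pos)
qed

text \<open>The right-hand side near the set j is asymptotically lam * \<phi> (ends j) - gk j, with
  no limit known yet. Thus the difference D from hk nearly satisfies the homogeneous resolvent
  equation of the chain, and the resolvent bound gives D \<rightarrow> 0.\<close>

lemma phi_limit: "((\<lambda>\<epsilon>. \<phi> \<epsilon> (ends k)) \<longlongrightarrow> hk k) (at_right 0)"
proof -
  obtain C where C: "controlled \<phi> (\<lambda>\<epsilon> x. lam * \<phi> \<epsilon> x - G x) C" "\<And>\<epsilon> j. \<epsilon> > 0 \<Longrightarrow> \<bar>lam * \<phi> \<epsilon> (ends j) - gk j\<bar> \<le> C"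
    using phi_controlled by blast
  define D where "D = (\<lambda>\<epsilon> k. \<phi> \<epsilon> (ends k) - hk k)"
  have lim: "((\<lambda>\<epsilon>. gen (D \<epsilon>) k - lam * D \<epsilon> k) \<longlongrightarrow> 0) (at_right 0)" for k
  proof -
    have "((\<lambda>\<epsilon>. gen (\<lambda>k. \<phi> \<epsilon> (ends k)) k - (lam * \<phi> \<epsilon> (ends k) - gk k)) \<longlongrightarrow> 0) (at_right 0)"
    proof (rule gen_limit[OF C])
      fix q j assume q: "q \<in> F j"
      have "tracks (\<lambda>\<epsilon>. G) (\<lambda>\<epsilon>. gk j) q"
        using tracks_continuous[where f = G and q = q] G_cont G_at[OF q] by (simp add: torus_cont_def continuous_on_eq_continuous_at)
      then show "tracks (\<lambda>\<epsilon> x. lam * \<phi> \<epsilon> x - G x) (\<lambda>\<epsilon>. lam * \<phi> \<epsilon> (ends j) - gk j) q"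
        by (intro tracks_diff tracks_cmult tracks_well[OF C(1) q])
    qed
    moreover have "gen (D \<epsilon>) k - lam * D \<epsilon> k = gen (\<lambda>k. \<phi> \<epsilon> (ends k)) k - (lam * \<phi> \<epsilon> (ends k) - gk k)" for \<epsilon>
      unfolding D_def gen_diff gk_def by (simp add: algebra_simps)
    ultimately show ?thesis by simp
  qed
  have "((\<lambda>\<epsilon>. D \<epsilon> k) \<longlongrightarrow> 0) (at_right 0)"
  proof (rule tendstoI)
    fix e :: real assume e: "e > 0"
    have "eventually (\<lambda>\<epsilon>. \<forall>k\<in>{0..<int u}. \<bar>gen (D \<epsilon>) k - lam * D \<epsilon> k\<bar> < lam * (e / 2)) (at_right 0)"
    proof (intro eventually_ball_finite ballI)
      fix k
      show "eventually (\<lambda>\<epsilon>. \<bar>gen (D \<epsilon>) k - lam * D \<epsilon> k\<bar> < lam * (e / 2)) (at_right 0)"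
        using tendstoD[OF lim, of "lam * (e / 2)" k] e lam_pos by (simp add: dist_real_def)
    qed auto
    then show "eventually (\<lambda>\<epsilon>. dist (D \<epsilon> k) 0 < e) (at_right 0)" using eventually_at_right_less[of 0]
    proof eventually_elim
      case (elim \<epsilon>)
      have per: "D \<epsilon> (k + int u) = D \<epsilon> k" for k
        using ends_shift[of k 1] periodic1_of_int[OF C2_torusD(1)[OF phi(1)[OF elim(2)]], of "ends k" 1] hk_per
        by (simp add: D_def)
      have "\<bar>gen (D \<epsilon>) k - lam * D \<epsilon> k\<bar> \<le> lam * (e / 2)" for k
      proof -
        have "gen (D \<epsilon>) (k mod int u) - lam * D \<epsilon> (k mod int u) = gen (D \<epsilon>) k - lam * D \<epsilon> k"
          using periodic_int_mod[of "gen (D \<epsilon>)" u k, OF gen_periodic[of "D \<epsilon>", OF per]] periodic_int_mod[of "D \<epsilon>" u k, OF per] by simp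
        moreover have "k mod int u \<in> {0..<int u}" using u_pos by simp
        ultimately show ?thesis using elim(1) by (metis less_imp_le)
      qed
      from resolvent_bound[of "D \<epsilon>" lam "e / 2" k, OF per lam_pos this] show ?case using e by simp
    qed
  qed
  then show ?thesis by (simp add: D_def LIM_zero_iff)
qed

lemma phi_near: "q \<in> F j \<Longrightarrow> near_limit \<phi> q (hk j)"
  using phi_controlled tracks_well near_limit_tracks phi_limit by metis

text \<open>Half of the least value of h: the other half absorbs the error of the uniform lower
  bound on \<phi> \<epsilon>.\<close>

definition cphi :: real where "cphi = Min (hk ` {0..<int u}) / 2"

lemma hk_ge: "2 * cphi \<le> hk k" and cphi_pos: "0 < cphi"
proof -
  have r: "range hk = hk ` {0..<int u}" by (rule periodic_int_finite_range(1)[of hk u, OF hk_per u_pos])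
  have fin: "finite (hk ` {0..<int u})" by simp
  have "hk k \<in> hk ` {0..<int u}" using r by blast
  then show "2 * cphi \<le> hk k" unfolding cphi_def using fin by simp
  have "Min (hk ` {0..<int u}) \<in> hk ` {0..<int u}" using fin u_pos by (intro Min_in) auto
  then show "0 < cphi" unfolding cphi_def using hk_pos by auto
qed

definition good :: "real \<Rightarrow> bool" where "good \<epsilon> \<longleftrightarrow> \<epsilon> > 0 \<and> (\<forall>x. cphi \<le> \<phi> \<epsilon> x)"

lemma eventually_good: "eventually good (at_right 0)"
proof -
  obtain C where C: "controlled \<phi> (\<lambda>\<epsilon> x. lam * \<phi> \<epsilon> x - G x) C" using phi_controlled by blast
  obtain hi where hi: "\<forall>k. hk k \<le> hi" using periodic_int_attains_max[of hk u, OF hk_per u_pos] by blast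
  have "eventually (\<lambda>\<epsilon>. \<forall>x. 2 * cphi - cphi \<le> \<phi> \<epsilon> x \<and> \<phi> \<epsilon> x \<le> hi + cphi) (at_right 0)"
    by (rule uniform_bound[OF C _ phi_limit hk_ge _ cphi_pos]) (use C2_torusD(1) phi(1) hi in auto)
  then show ?thesis using eventually_at_right_less[of 0]
    by eventually_elim (auto simp: good_def)
qed

lemma goodD:
  assumes "good \<epsilon>"
  shows "\<epsilon> > 0" "cphi \<le> \<phi> \<epsilon> x" "0 < \<phi> \<epsilon> x" "torus_prob (M \<epsilon>)" "torus_cont (\<phi> \<epsilon>)"
    "C2_torus f \<Longrightarrow> (\<integral>x. tilted_gen a b \<epsilon> (\<phi> \<epsilon>) f x \<partial>M \<epsilon>) = 0"
proof -
  show e: "\<epsilon> > 0" "cphi \<le> \<phi> \<epsilon> x" for x using assms by (auto simp: good_def)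
  show pos: "0 < \<phi> \<epsilon> x" for x using e(2)[of x] cphi_pos by linarith
  have "stationary_state (tilted_gen a b \<epsilon> (\<phi> \<epsilon>)) (M \<epsilon>)" using stationary e(1) pos by blast
  then show "torus_prob (M \<epsilon>)" "C2_torus f \<Longrightarrow> (\<integral>x. tilted_gen a b \<epsilon> (\<phi> \<epsilon>) f x \<partial>M \<epsilon>) = 0"
    by (auto simp: stationary_state_def)
  show "torus_cont (\<phi> \<epsilon>)" by (rule torus_cont_C2[OF phi(1)[OF e(1)]])
qed

definition nu :: "real \<Rightarrow> (real \<Rightarrow> real) \<Rightarrow> real" where
  "nu \<epsilon> f = (\<integral>x. f x / \<phi> \<epsilon> x \<partial>M \<epsilon>)"

lemma nu_integrable: "good \<epsilon> \<Longrightarrow> torus_cont f \<Longrightarrow> integrable (M \<epsilon>) (\<lambda>x. f x / \<phi> \<epsilon> x)"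
  by (intro torus_cont_integrable torus_cont_intros goodD)

lemma nu_linear:
  assumes "good \<epsilon>" "torus_cont f" "torus_cont g"
  shows "nu \<epsilon> (\<lambda>x. f x + g x) = nu \<epsilon> f + nu \<epsilon> g" "nu \<epsilon> (\<lambda>x. f x - g x) = nu \<epsilon> f - nu \<epsilon> g"
    "nu \<epsilon> (\<lambda>x. c * f x) = c * nu \<epsilon> f"
  using nu_integrable[OF assms(1,2)] nu_integrable[OF assms(1,3)]
  by (simp_all add: nu_def add_divide_distrib diff_divide_distrib flip: times_divide_eq_right)

lemma nu_sum:
  assumes "good \<epsilon>" "\<And>i. i \<in> I \<Longrightarrow> torus_cont (f i)"
  shows "nu \<epsilon> (\<lambda>x. \<Sum>i\<in>I. c i * f i x) = (\<Sum>i\<in>I. c i * nu \<epsilon> (f i))"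
proof -
  have "nu \<epsilon> (\<lambda>x. \<Sum>i\<in>I. c i * f i x) = (\<integral>x. (\<Sum>i\<in>I. c i * (f i x / \<phi> \<epsilon> x)) \<partial>M \<epsilon>)"
    by (simp add: nu_def sum_divide_distrib)
  also have "\<dots> = (\<Sum>i\<in>I. \<integral>x. c i * (f i x / \<phi> \<epsilon> x) \<partial>M \<epsilon>)"
    by (intro Bochner_Integration.integral_sum integrable_mult_right nu_integrable assms)
  also have "\<dots> = (\<Sum>i\<in>I. c i * nu \<epsilon> (f i))"
    unfolding nu_def by (simp only: integral_mult_right_zero)
  finally show ?thesis .
qed

lemma nu_mono_abs:
  assumes g: "good \<epsilon>" and f: "torus_cont f" "torus_cont w" "\<And>x. \<bar>f x\<bar> \<le> w x"
  shows "\<bar>nu \<epsilon> f\<bar> \<le> nu \<epsilon> w"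
proof -
  have "norm (nu \<epsilon> f) \<le> (\<integral>x. norm (f x / \<phi> \<epsilon> x) \<partial>M \<epsilon>)"
    unfolding nu_def by (rule integral_norm_bound)
  also have "\<dots> \<le> nu \<epsilon> w"
    unfolding nu_def using f goodD(3)[OF g] nu_integrable[OF g]
    by (intro integral_mono integrable_norm) (auto simp: less_imp_le intro!: divide_right_mono)
  finally show ?thesis by simp
qed

lemma nu_bound:
  assumes g: "good \<epsilon>" and f: "torus_cont f" "\<And>x. \<bar>f x\<bar> \<le> K"
  shows "\<bar>nu \<epsilon> f\<bar> \<le> K / cphi"
proof -
  interpret prob_space "M \<epsilon>" using goodD(4)[OF g] by (simp add: torus_prob_def)
  have "K \<ge> 0" using f(2)[of 0] by simp
  have "norm (nu \<epsilon> f) \<le> (\<integral>x. norm (f x / \<phi> \<epsilon> x) \<partial>M \<epsilon>)"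
    unfolding nu_def by (rule integral_norm_bound)
  also have "\<dots> \<le> (\<integral>x. K / cphi \<partial>M \<epsilon>)"
  proof (intro integral_mono integrable_norm nu_integrable[OF g f(1)])
    fix x
    have "\<bar>f x\<bar> / \<phi> \<epsilon> x \<le> K / cphi"
      by (intro frac_le f(2) \<open>K \<ge> 0\<close> cphi_pos goodD(2)[OF g])
    then show "norm (f x / \<phi> \<epsilon> x) \<le> K / cphi" using goodD(3)[OF g, of x] by simp
  qed auto
  finally show ?thesis by (simp add: prob_space)
qed

text \<open>Test stationarity with f / \<phi> and use the Doob transform; the resolvent equation
  replaces \<theta> * L \<phi> by lam * \<phi> - G.\<close>

lemma nu_identity:
  assumes g: "good \<epsilon>" and f: "C2_torus f"
  shows "nu \<epsilon> (\<lambda>x. \<theta> \<epsilon> * diff_gen a b \<epsilon> f x) = nu \<epsilon> (\<lambda>x. (lam - G x / \<phi> \<epsilon> x) * f x)"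
proof -
  note gd = goodD[OF g]
  have c1: "torus_cont (\<lambda>x. \<theta> \<epsilon> * diff_gen a b \<epsilon> f x)"
    unfolding diff_gen_def by (intro torus_cont_intros torus_cont_C2 a_C2 b_C2 f)
  have c2: "torus_cont (\<lambda>x. (lam - G x / \<phi> \<epsilon> x) * f x)"
    by (intro torus_cont_intros torus_cont_C2(1)[OF f] G_cont gd)
  have "\<theta> \<epsilon> * tilted_gen a b \<epsilon> (\<phi> \<epsilon>) (\<lambda>x. f x / \<phi> \<epsilon> x) x
      = (\<theta> \<epsilon> * diff_gen a b \<epsilon> f x - (lam - G x / \<phi> \<epsilon> x) * f x) / \<phi> \<epsilon> x" for x
  proof -
    have e: "\<theta> \<epsilon> * diff_gen a b \<epsilon> (\<phi> \<epsilon>) x = lam * \<phi> \<epsilon> x - G x" using phi(2)[OF gd(1), of x] by linarith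
    have "\<theta> \<epsilon> * tilted_gen a b \<epsilon> (\<phi> \<epsilon>) (\<lambda>x. f x / \<phi> \<epsilon> x) x
      = (\<theta> \<epsilon> * diff_gen a b \<epsilon> f x - f x / \<phi> \<epsilon> x * (\<theta> \<epsilon> * diff_gen a b \<epsilon> (\<phi> \<epsilon>) x)) / \<phi> \<epsilon> x"
      unfolding tilted_gen_quotient[OF f phi(1)[OF gd(1)] gd(3)] by (simp add: algebra_simps)
    then show ?thesis unfolding e using gd(3)[of x] by (simp add: field_simps)
  qed
  then have "nu \<epsilon> (\<lambda>x. \<theta> \<epsilon> * diff_gen a b \<epsilon> f x - (lam - G x / \<phi> \<epsilon> x) * f x) =
      (\<integral>x. \<theta> \<epsilon> * tilted_gen a b \<epsilon> (\<phi> \<epsilon>) (\<lambda>x. f x / \<phi> \<epsilon> x) x \<partial>M \<epsilon>)"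
    by (simp add: nu_def)
  also have "\<dots> = 0" using gd(6)[OF C2_torus_divide(1)[OF f phi(1)[OF gd(1)] gd(3)]] by simp
  finally show ?thesis unfolding nu_linear(2)[OF g c1 c2] by simp
qed

lemma nu_phi: "good \<epsilon> \<Longrightarrow> torus_cont f \<Longrightarrow> nu \<epsilon> (\<lambda>x. f x * \<phi> \<epsilon> x) = (\<integral>x. f x \<partial>M \<epsilon>)"
  unfolding nu_def using goodD(3)[of \<epsilon>] by (simp add: less_imp_neq[symmetric])

lemma ratio_bound: "\<exists>K>0. \<forall>\<epsilon>. good \<epsilon> \<longrightarrow> (\<forall>x. \<bar>lam - G x / \<phi> \<epsilon> x\<bar> \<le> K)"
proof -
  obtain K where K: "K > 0" "\<And>x. \<bar>G x\<bar> \<le> K" using torus_cont_bounded[OF G_cont] by blast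
  have "\<bar>lam - G x / \<phi> \<epsilon> x\<bar> \<le> lam + K / cphi" if "good \<epsilon>" for \<epsilon> x
  proof -
    have "\<bar>G x\<bar> / \<phi> \<epsilon> x \<le> K / cphi"
      using K by (intro frac_le cphi_pos goodD(2)[OF that]) auto
    then have "\<bar>G x / \<phi> \<epsilon> x\<bar> \<le> K / cphi" using goodD(3)[OF that, of x] by simp
    then show ?thesis using lam_pos by linarith
  qed
  then show ?thesis using K lam_pos cphi_pos by (intro exI[of _ "lam + K / cphi"]) (auto intro: add_pos_pos)
qed

lemma Bfun_nu_one: "Bfun (\<lambda>\<epsilon>. nu \<epsilon> (\<lambda>x. 1)) (at_right 0)"
  using eventually_good nu_bound[OF _ torus_cont_intros(1), of _ 1 1]
  by (intro BfunI[where K = "1 / cphi"]) (auto elim: eventually_mono)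

text \<open>Solve the Poisson equation with limit profile H = 0. Its solution tends to 0 uniformly,
  so the right-hand side of \<open>nu_identity\<close> vanishes, while the left-hand side is nu f up
  to the vanishing constant c.\<close>

lemma nu_mean_zero:
  assumes f: "torus_cont f" and zero: "\<And>k. well_mean f k = 0"
  shows "((\<lambda>\<epsilon>. nu \<epsilon> f) \<longlongrightarrow> 0) (at_right 0)"
proof -
  have gen0: "gen (\<lambda>_. 0) k = 0" for k by (simp add: gen_def)
  have "well_mean f k = gen (\<lambda>_. 0) k" for k using zero gen0 by simp
  then obtain g c where pf: "poisson_family f (\<lambda>_. 0) g c" using poisson_limit[OF f, of "\<lambda>_. 0"] by blast
  note g = poisson_familyD[OF pf]
  obtain C where C: "controlled g (\<lambda>\<epsilon> x. f x - c \<epsilon>) C" using g(3) by blast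
  obtain K where K: "K > 0" "\<And>\<epsilon> x. good \<epsilon> \<Longrightarrow> \<bar>lam - G x / \<phi> \<epsilon> x\<bar> \<le> K" using ratio_bound by blast
  have 1: "((\<lambda>\<epsilon>. nu \<epsilon> (\<lambda>x. (lam - G x / \<phi> \<epsilon> x) * g \<epsilon> x)) \<longlongrightarrow> 0) (at_right 0)"
  proof (rule tendstoI)
    fix e :: real assume e: "e > 0"
    define \<eta> where "\<eta> = e * cphi / (2 * K)"
    have \<eta>: "\<eta> > 0" using e cphi_pos K by (simp add: \<eta>_def)
    have "eventually (\<lambda>\<epsilon>. \<forall>x. 0 - \<eta> \<le> g \<epsilon> x \<and> g \<epsilon> x \<le> 0 + \<eta>) (at_right 0)"
      by (rule uniform_bound[OF C _ g(5) _ _ \<eta>]) (use C2_torusD(1) g(1) in auto)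
    then show "eventually (\<lambda>\<epsilon>. dist (nu \<epsilon> (\<lambda>x. (lam - G x / \<phi> \<epsilon> x) * g \<epsilon> x)) 0 < e) (at_right 0)"
      using eventually_good
    proof eventually_elim
      case (elim \<epsilon>)
      have "\<bar>nu \<epsilon> (\<lambda>x. (lam - G x / \<phi> \<epsilon> x) * g \<epsilon> x)\<bar> \<le> K * \<eta> / cphi"
      proof (rule nu_bound[OF elim(2)])
        show "torus_cont (\<lambda>x. (lam - G x / \<phi> \<epsilon> x) * g \<epsilon> x)"
          by (intro torus_cont_intros torus_cont_C2(1) g(1) G_cont goodD[OF elim(2)])
        show "\<bar>(lam - G x / \<phi> \<epsilon> x) * g \<epsilon> x\<bar> \<le> K * \<eta>" for x
          unfolding abs_mult using K elim(1)[rule_format, of x] elim(2) by (intro mult_mono) auto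
      qed
      also have "\<dots> = e / 2" using K cphi_pos by (simp add: \<eta>_def)
      finally show ?case using e by simp
    qed
  qed
  have 2: "((\<lambda>\<epsilon>. nu \<epsilon> (\<lambda>x. 1) * c \<epsilon>) \<longlongrightarrow> 0) (at_right 0)"
    by (rule Bfun_tendsto_mult_zero[OF Bfun_nu_one g(4)])
  have "eventually (\<lambda>\<epsilon>. nu \<epsilon> (\<lambda>x. (lam - G x / \<phi> \<epsilon> x) * g \<epsilon> x) + nu \<epsilon> (\<lambda>x. 1) * c \<epsilon> = nu \<epsilon> f) (at_right 0)"
    using eventually_good
  proof eventually_elim
    case (elim \<epsilon>)
    note gd = goodD(1)[OF elim]
    have "nu \<epsilon> (\<lambda>x. f x - c \<epsilon> * 1) = nu \<epsilon> f - c \<epsilon> * nu \<epsilon> (\<lambda>x. 1)"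
      unfolding nu_linear(3)[OF elim torus_cont_intros(1) f, symmetric]
      by (rule nu_linear(2)[OF elim f]) (intro torus_cont_intros)
    then have "nu \<epsilon> f - c \<epsilon> * nu \<epsilon> (\<lambda>x. 1) = nu \<epsilon> (\<lambda>x. (lam - G x / \<phi> \<epsilon> x) * g \<epsilon> x)"
      using nu_identity[OF elim g(1)[OF gd]] g(2)[OF gd] by simp
    then show ?case by (simp add: algebra_simps)
  qed
  with tendsto_add[OF 1 2] show ?thesis by (simp add: Lim_transform_eventually)
qed

end

section \<open>Concentration on the wells and the limiting weights\<close>

context tilted_family
begin

lemma infdist_periodic: "infdist (x + 1) (\<Union> (range F)) = infdist x (\<Union> (range F))"
proof -
  let ?U = "\<Union> (range F)"
  have ne: "?U \<noteq> {}" using F_ne by auto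
  have "?U = (\<lambda>y. y + 1) ` ?U"
  proof -
    have "F k \<subseteq> (\<lambda>y. y + 1) ` ?U" for k
      using F_shift1[of "k - int u"] by auto
    moreover have "(\<lambda>y. y + 1) ` F k \<subseteq> ?U" for k unfolding F_shift1[symmetric] by blast
    ultimately show ?thesis by blast
  qed
  then have "(INF y\<in>?U. dist (x + 1) y) = (INF y\<in>(\<lambda>y. y + 1) ` ?U. dist (x + 1) y)" by simp
  also have "\<dots> = (INF y\<in>?U. dist x y)" by (simp add: image_image)
  finally show ?thesis using ne by (simp add: infdist_notempty)
qed

text \<open>The function \<open>cut\<close> vanishes at all minima of the family, so its well means
  are zero and nu of it tends to 0. Near the minima e is below \<eta>; away from them cut = 1
  dominates it.\<close>

lemma nu_concentration:
  assumes ev: "eventually (\<lambda>\<epsilon>. torus_cont (e \<epsilon>) \<and> (\<forall>x. \<bar>e \<epsilon> x\<bar> \<le> K)) (at_right 0)"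
    and near: "\<And>q j. q \<in> F j \<Longrightarrow> near_limit e q 0"
  shows "((\<lambda>\<epsilon>. nu \<epsilon> (e \<epsilon>)) \<longlongrightarrow> 0) (at_right 0)"
proof (rule tendstoI)
  fix d :: real assume d: "d > 0"
  define \<eta> where "\<eta> = d * cphi / 2"
  have \<eta>: "\<eta> > 0" using d cphi_pos by (simp add: \<eta>_def)
  let ?U = "\<Union> (range F)"
  let ?A = "\<Union>k\<in>{0..<int u}. F k"
  have neU: "?U \<noteq> {}" using F_ne by auto
  have finA: "finite ?A" by simp
  have "\<exists>\<rho>>0. eventually (\<lambda>\<epsilon>. \<forall>y\<in>ball q \<rho>. \<bar>e \<epsilon> y\<bar> < \<eta>) (at_right 0)" if q: "q \<in> ?A" for q
  proof -
    obtain j where "q \<in> F j" using q by blast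
    from tendstoD[OF near[OF this, unfolded near_limit_def] \<eta>]
    obtain Pf Pg where P: "eventually Pf (at_right 0)" "eventually Pg (nhds q)"
      "\<And>x y. Pf x \<Longrightarrow> Pg y \<Longrightarrow> \<bar>e x y\<bar> < \<eta>"
      unfolding eventually_prod_filter by (auto simp: dist_real_def)
    obtain \<rho> where \<rho>: "\<rho> > 0" "\<And>y. dist y q < \<rho> \<Longrightarrow> Pg y" using P(2) by (auto simp: eventually_nhds_metric)
    have "eventually (\<lambda>\<epsilon>. \<forall>y\<in>ball q \<rho>. \<bar>e \<epsilon> y\<bar> < \<eta>) (at_right 0)"
      using P(1) by eventually_elim (use P(3) \<rho>(2) in \<open>auto simp: dist_commute\<close>)
    then show ?thesis using \<rho>(1) by blast
  qed
  then have "\<forall>q\<in>?A. \<exists>\<rho>. \<rho> > 0 \<and> eventually (\<lambda>\<epsilon>. \<forall>y\<in>ball q \<rho>. \<bar>e \<epsilon> y\<bar> < \<eta>) (at_right 0)" by blast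
  then obtain \<rho>q where "\<forall>q\<in>?A. \<rho>q q > 0 \<and> eventually (\<lambda>\<epsilon>. \<forall>y\<in>ball q (\<rho>q q). \<bar>e \<epsilon> y\<bar> < \<eta>) (at_right 0)"
    by (rule bchoice[THEN exE])
  then have \<rho>q: "\<And>q. q \<in> ?A \<Longrightarrow> \<rho>q q > 0"
    "\<And>q. q \<in> ?A \<Longrightarrow> eventually (\<lambda>\<epsilon>. \<forall>y\<in>ball q (\<rho>q q). \<bar>e \<epsilon> y\<bar> < \<eta>) (at_right 0)" by blast+
  define \<rho> where "\<rho> = Min (\<rho>q ` ?A)"
  have "F 0 \<subseteq> ?A" using u_pos by (intro UN_upper) simp
  then have neA: "?A \<noteq> {}" using F_ne[of 0] by blast
  have \<rho>pos: "\<rho> > 0" unfolding \<rho>_def using finA neA \<rho>q(1) by (simp add: Min_gr_iff)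
  define cut where "cut = (\<lambda>x. min 1 (infdist x ?U / \<rho>))"
  have cut_cont: "torus_cont cut"
    unfolding torus_cont_def periodic1_def cut_def using \<rho>pos
    by (auto simp: infdist_periodic intro!: continuous_intros)
  have "cut q = 0" if "q \<in> F j" for q j
  proof -
    have "infdist q ?U = 0" using that by (intro infdist_zero) auto
    then show ?thesis by (simp add: cut_def)
  qed
  then have "well_mean cut k = 0" for k by (rule well_mean_const)
  from nu_mean_zero[OF cut_cont this] have cut_null: "((\<lambda>\<epsilon>. nu \<epsilon> cut) \<longlongrightarrow> 0) (at_right 0)" .
  define K' where "K' = \<bar>K\<bar> + 1"
  have "eventually (\<lambda>\<epsilon>. \<forall>q\<in>?A. \<forall>y\<in>ball q (\<rho>q q). \<bar>e \<epsilon> y\<bar> < \<eta>) (at_right 0)"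
    using \<rho>q(2) by (intro eventually_ball_finite finA) auto
  moreover have "eventually (\<lambda>\<epsilon>. nu \<epsilon> cut < d / (2 * K')) (at_right 0)"
    using order_tendstoD(2)[OF cut_null, of "d / (2 * K')"] d by (simp add: K'_def)
  ultimately show "eventually (\<lambda>\<epsilon>. dist (nu \<epsilon> (e \<epsilon>)) 0 < d) (at_right 0)"
    using ev eventually_good
  proof eventually_elim
    case (elim \<epsilon>)
    have ec: "torus_cont (e \<epsilon>)" using elim(3) by blast
    have eK: "\<bar>e \<epsilon> x\<bar> \<le> K'" for x
    proof -
      have "\<bar>e \<epsilon> x\<bar> \<le> K" using elim(3) by blast
      then show ?thesis unfolding K'_def by linarith
    qed
    have K'0: "K' > 0" by (simp add: K'_def)
    have bd: "\<bar>e \<epsilon> x\<bar> \<le> \<eta> + K' * cut x" for x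
    proof (cases "infdist x ?U < \<rho>")
      case True
      then have "\<exists>y\<in>?U. dist x y < \<rho>"
        unfolding infdist_notempty[OF neU] by (subst (asm) cINF_less_iff) (use neU in auto)
      then obtain y j where y: "y \<in> F j" "dist x y < \<rho>" by blast
      \<comment> \<open>The radii were chosen for one period of minima; the nearby minimum is
        translated into it.\<close>
      define n where "n = - (j div int u)"
      have "j + n * int u = j mod int u" by (simp add: n_def minus_div_mult_eq_mod)
      then have yA: "y + of_int n \<in> ?A" using y(1) F_shift[of j n] u_pos by (auto intro!: bexI[of _ "j mod int u"])
      have "\<rho> \<le> \<rho>q (y + of_int n)" unfolding \<rho>_def using finA yA by (intro Min_le) auto
      then have "x + of_int n \<in> ball (y + of_int n) (\<rho>q (y + of_int n))"
        using y(2) by (simp add: dist_commute dist_real_def)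
      then have "\<bar>e \<epsilon> (x + of_int n)\<bar> < \<eta>" using elim(1) yA by blast
      moreover have "e \<epsilon> (x + of_int n) = e \<epsilon> x" using ec periodic1_of_int by (auto simp: torus_cont_def)
      moreover have "cut x \<ge> 0" using \<rho>pos by (simp add: cut_def infdist_nonneg)
      ultimately show ?thesis using K'0 by (simp add: add_increasing2)
    next
      case False
      then have "cut x = 1" using \<rho>pos by (simp add: cut_def)
      then show ?thesis using eK[of x] \<eta> by simp
    qed
    have wc: "torus_cont (\<lambda>x. \<eta> + K' * cut x)" by (intro torus_cont_intros cut_cont)
    have "\<bar>nu \<epsilon> (e \<epsilon>)\<bar> \<le> nu \<epsilon> (\<lambda>x. \<eta> + K' * cut x)"
      by (rule nu_mono_abs[OF elim(4) ec wc bd])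
    also have "\<dots> = nu \<epsilon> (\<lambda>x. \<eta>) + K' * nu \<epsilon> cut"
      using nu_linear(1)[OF elim(4), of "\<lambda>x. \<eta>" "\<lambda>x. K' * cut x"] nu_linear(3)[OF elim(4) cut_cont cut_cont, of K'] cut_cont
      by (simp add: torus_cont_intros)
    also have "\<dots> < d / 2 + d / 2"
    proof (rule add_le_less_mono)
      have "\<bar>nu \<epsilon> (\<lambda>x. \<eta>)\<bar> \<le> \<eta> / cphi" by (rule nu_bound[OF elim(4)]) (use \<eta> in \<open>auto intro: torus_cont_intros\<close>)
      then show "nu \<epsilon> (\<lambda>x. \<eta>) \<le> d / 2" using cphi_pos by (simp add: \<eta>_def)
      have "K' * nu \<epsilon> cut < K' * (d / (2 * K'))" using elim(2) K'0 by (rule mult_strict_left_mono)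
      then show "K' * nu \<epsilon> cut < d / 2" using K'0 by simp
    qed
    finally show ?case by simp
  qed
qed

text \<open>The mass that nu gives to the wells of the set k. Multiplied by hk k it becomes
  asymptotically the mass under M \<epsilon>.\<close>

definition nn :: "real \<Rightarrow> int \<Rightarrow> real" where "nn \<epsilon> k = nu \<epsilon> (\<zeta> (k mod int u))"

lemma nn_per: "nn \<epsilon> (k + int u) = nn \<epsilon> k"
  by (simp add: nn_def)

lemma nn_eq: "k \<in> {0..<int u} \<Longrightarrow> nn \<epsilon> k = nu \<epsilon> (\<zeta> k)"
  by (simp add: nn_def)

lemma nu_zeta_comb: "good \<epsilon> \<Longrightarrow> nu \<epsilon> (\<lambda>x. \<Sum>k\<in>{0..<int u}. c k * \<zeta> k x) = (\<Sum>k\<in>{0..<int u}. c k * nn \<epsilon> k)"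
  by (subst nu_sum) (auto simp: zeta_cont nn_eq)

lemma zeta_comb_near:
  assumes "q \<in> F j" "\<And>k. c (k + int u) = c k"
  shows "near_limit (\<lambda>\<epsilon> x. \<Sum>k\<in>{0..<int u}. c k * \<zeta> k x) q (c j)"
  using near_limit_continuous[OF zeta_comb_cont, of c q] zeta_sum[of q j c, OF assms] by simp

text \<open>Take for f a function with value gen H on the wells, so that the Poisson solution g
  tends to H there. By concentration both sides of \<open>nu_identity\<close> reduce to sums over
  wells. The bracket is hk times the tilted generator applied to H / hk.\<close>

lemma tilted_stationarity:
  assumes Hper: "\<And>k. H (k + int u) = H k"
  shows "((\<lambda>\<epsilon>. \<Sum>k\<in>{0..<int u}. nn \<epsilon> k * (gen H k - gen hk k / hk k * H k)) \<longlongrightarrow> 0) (at_right 0)"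
proof -
  define f where "f = (\<lambda>x. \<Sum>k\<in>{0..<int u}. gen H k * \<zeta> k x)"
  have fc: "torus_cont f" unfolding f_def by (rule zeta_comb_cont)
  have "f q = gen H j" if "q \<in> F j" for q j
    unfolding f_def by (rule zeta_sum[of q j "gen H", OF that gen_periodic[of H, OF Hper]])
  then have "well_mean f k = gen H k" for k by (rule well_mean_const)
  then obtain g c where pf: "poisson_family f H g c" using poisson_limit[OF fc, of H] Hper by blast
  note g = poisson_familyD[OF pf]
  obtain C where C: "controlled g (\<lambda>\<epsilon> x. f x - c \<epsilon>) C" using g(3) by blast
  define r where "r = (\<lambda>k. lam - gk k / hk k)"
  \<comment> \<open>By definition of gk the limit of lam - G / \<phi> on the wells is the potential
    term of the Doob transform of the chain.\<close>
  have r: "r k = gen hk k / hk k" for k using hk_pos[of k] by (simp add: r_def gk_def field_simps)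
  define cH where "cH = (\<lambda>k. r k * H k)"
  have cHper: "cH (k + int u) = cH k" for k using gk_per[of k] hk_per[of k] Hper[of k] by (simp add: cH_def r_def)
  define e where "e = (\<lambda>\<epsilon> x. (lam - G x / \<phi> \<epsilon> x) * g \<epsilon> x - (\<Sum>k\<in>{0..<int u}. cH k * \<zeta> k x))"
  obtain K where K: "K > 0" "\<And>\<epsilon> x. good \<epsilon> \<Longrightarrow> \<bar>lam - G x / \<phi> \<epsilon> x\<bar> \<le> K" using ratio_bound by blast
  obtain K2 where K2: "K2 > 0" "\<And>x. \<bar>\<Sum>k\<in>{0..<int u}. cH k * \<zeta> k x\<bar> \<le> K2"
    using torus_cont_bounded[OF zeta_comb_cont[of cH]] by blast
  obtain hi where hi: "\<forall>k. H k \<le> hi" using periodic_int_attains_max[of H u, OF Hper u_pos] by blast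
  have "\<exists>k. \<forall>j. - H j \<le> - H k"
    by (rule periodic_int_attains_max[of "\<lambda>k. - H k" u]) (use Hper u_pos in simp_all)
  then obtain lo where lo: "\<forall>k. - H k \<le> lo" by blast
  have ctn: "torus_cont (\<lambda>x. (lam - G x / \<phi> \<epsilon> x) * g \<epsilon> x)" if "good \<epsilon>" for \<epsilon>
    by (intro torus_cont_intros torus_cont_C2(1) g(1) G_cont goodD[OF that])
  have 1: "((\<lambda>\<epsilon>. nu \<epsilon> (e \<epsilon>)) \<longlongrightarrow> 0) (at_right 0)"
  proof (rule nu_concentration)
    have "eventually (\<lambda>\<epsilon>. \<forall>x. - lo - 1 \<le> g \<epsilon> x \<and> g \<epsilon> x \<le> hi + 1) (at_right 0)"
      by (rule uniform_bound[OF C _ g(5)]) (use C2_torusD(1) g(1) hi lo in \<open>auto simp: minus_le_iff\<close>)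
    then show "eventually (\<lambda>\<epsilon>. torus_cont (e \<epsilon>) \<and> (\<forall>x. \<bar>e \<epsilon> x\<bar> \<le> K * (\<bar>lo\<bar> + \<bar>hi\<bar> + 1) + K2)) (at_right 0)"
      using eventually_good
    proof eventually_elim
      case (elim \<epsilon>)
      have "\<bar>e \<epsilon> x\<bar> \<le> K * (\<bar>lo\<bar> + \<bar>hi\<bar> + 1) + K2" for x
      proof -
        have "\<bar>g \<epsilon> x\<bar> \<le> \<bar>lo\<bar> + \<bar>hi\<bar> + 1" using elim(1)[rule_format, of x] by linarith
        then have "\<bar>(lam - G x / \<phi> \<epsilon> x) * g \<epsilon> x\<bar> \<le> K * (\<bar>lo\<bar> + \<bar>hi\<bar> + 1)"
          unfolding abs_mult using K elim(2) by (intro mult_mono) auto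
        then show ?thesis unfolding e_def using K2(2)[of x] by linarith
      qed
      moreover have "torus_cont (e \<epsilon>)"
        unfolding e_def by (intro torus_cont_intros(3) ctn elim(2) zeta_comb_cont)
      ultimately show ?case by blast
    qed
    fix q j assume q: "q \<in> F j"
    have "near_limit g q (H j)" by (rule near_limit_tracks[OF tracks_well[OF C q] g(5)])
    moreover have "near_limit (\<lambda>\<epsilon>. G) q (gk j)" using near_limit_continuous[OF G_cont] G_at[OF q] by metis
    ultimately have "near_limit e q ((lam - gk j / hk j) * H j - cH j)"
      unfolding e_def using hk_pos[of j] by (intro near_limit_intros phi_near q zeta_comb_near cHper) auto
    then show "near_limit e q 0" by (simp add: cH_def r_def)
  qed
  have 2: "((\<lambda>\<epsilon>. nu \<epsilon> (\<lambda>x. 1) * c \<epsilon>) \<longlongrightarrow> 0) (at_right 0)"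
    by (rule Bfun_tendsto_mult_zero[OF Bfun_nu_one g(4)])
  have "eventually (\<lambda>\<epsilon>. nu \<epsilon> (e \<epsilon>) + nu \<epsilon> (\<lambda>x. 1) * c \<epsilon> =
      (\<Sum>k\<in>{0..<int u}. nn \<epsilon> k * (gen H k - gen hk k / hk k * H k))) (at_right 0)"
    using eventually_good
  proof eventually_elim
    case (elim \<epsilon>)
    note gd = goodD(1)[OF elim]
    have "nu \<epsilon> (\<lambda>x. f x - c \<epsilon> * 1) = nu \<epsilon> f - c \<epsilon> * nu \<epsilon> (\<lambda>x. 1)"
      unfolding nu_linear(3)[OF elim torus_cont_intros(1) fc, symmetric]
      by (rule nu_linear(2)[OF elim fc]) (intro torus_cont_intros)
    then have i1: "nu \<epsilon> f - c \<epsilon> * nu \<epsilon> (\<lambda>x. 1) = nu \<epsilon> (\<lambda>x. (lam - G x / \<phi> \<epsilon> x) * g \<epsilon> x)"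
      using nu_identity[OF elim g(1)[OF gd]] g(2)[OF gd] by simp
    have i2: "nu \<epsilon> (e \<epsilon>) = nu \<epsilon> (\<lambda>x. (lam - G x / \<phi> \<epsilon> x) * g \<epsilon> x) - (\<Sum>k\<in>{0..<int u}. cH k * nn \<epsilon> k)"
      unfolding e_def nu_linear(2)[OF elim ctn[OF elim] zeta_comb_cont] nu_zeta_comb[OF elim] ..
    have i3: "nu \<epsilon> f = (\<Sum>k\<in>{0..<int u}. gen H k * nn \<epsilon> k)"
      unfolding f_def by (rule nu_zeta_comb[OF elim])
    have "(\<Sum>k\<in>{0..<int u}. nn \<epsilon> k * (gen H k - gen hk k / hk k * H k)) =
        (\<Sum>k\<in>{0..<int u}. gen H k * nn \<epsilon> k) - (\<Sum>k\<in>{0..<int u}. cH k * nn \<epsilon> k)"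
      unfolding sum_subtractf[symmetric] by (intro sum.cong refl) (simp add: cH_def r algebra_simps)
    then show ?case using i1 i2 i3 by (simp add: algebra_simps)
  qed
  with tendsto_add[OF 1 2] show ?thesis by (simp add: Lim_transform_eventually)
qed

text \<open>nu of \<phi> is the total mass of M \<epsilon>, and \<phi> may be replaced by its values
  hk on the wells.\<close>

lemma total_mass: "((\<lambda>\<epsilon>. \<Sum>k\<in>{0..<int u}. hk k * nn \<epsilon> k) \<longlongrightarrow> 1) (at_right 0)"
proof -
  obtain C where C: "C > 0" "\<And>\<epsilon> x. \<epsilon> > 0 \<Longrightarrow> \<bar>\<phi> \<epsilon> x\<bar> \<le> C" using phi_bound by blast
  obtain K2 where K2: "K2 > 0" "\<And>x. \<bar>\<Sum>k\<in>{0..<int u}. hk k * \<zeta> k x\<bar> \<le> K2"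
    using torus_cont_bounded[OF zeta_comb_cont[of hk]] by blast
  define e where "e = (\<lambda>\<epsilon> x. \<phi> \<epsilon> x - (\<Sum>k\<in>{0..<int u}. hk k * \<zeta> k x))"
  have "((\<lambda>\<epsilon>. nu \<epsilon> (e \<epsilon>)) \<longlongrightarrow> 0) (at_right 0)"
  proof (rule nu_concentration)
    show "eventually (\<lambda>\<epsilon>. torus_cont (e \<epsilon>) \<and> (\<forall>x. \<bar>e \<epsilon> x\<bar> \<le> C + K2)) (at_right 0)"
      using eventually_good
    proof eventually_elim
      case (elim \<epsilon>)
      have "\<bar>e \<epsilon> x\<bar> \<le> C + K2" for x
        unfolding e_def using C(2)[OF goodD(1)[OF elim], of x] K2(2)[of x] by linarith
      moreover have "torus_cont (e \<epsilon>)" unfolding e_def by (intro torus_cont_intros(3) goodD(5) elim zeta_comb_cont)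
      ultimately show ?case by blast
    qed
    show "near_limit e q 0" if "q \<in> F j" for q j
      using near_limit_intros(3)[OF phi_near[OF that] zeta_comb_near[of q j hk, OF that hk_per]] by (simp add: e_def)
  qed
  moreover have "eventually (\<lambda>\<epsilon>. nu \<epsilon> (e \<epsilon>) = 1 - (\<Sum>k\<in>{0..<int u}. hk k * nn \<epsilon> k)) (at_right 0)"
    using eventually_good
  proof eventually_elim
    case (elim \<epsilon>)
    interpret prob_space "M \<epsilon>" using goodD(4)[OF elim] by (simp add: torus_prob_def)
    have "nu \<epsilon> (\<phi> \<epsilon>) = 1" using nu_phi[OF elim torus_cont_intros(1), of 1] by (simp add: prob_space)
    then show ?case unfolding e_def nu_linear(2)[OF elim goodD(5)[OF elim] zeta_comb_cont] nu_zeta_comb[OF elim] by simp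
  qed
  ultimately have "((\<lambda>\<epsilon>. 1 - (\<Sum>k\<in>{0..<int u}. hk k * nn \<epsilon> k)) \<longlongrightarrow> 0) (at_right 0)"
    by (rule Lim_transform_eventually)
  from tendsto_diff[OF tendsto_const[of 1] this] show ?thesis by simp
qed

text \<open>Jump rates of the chain tilted by h, the Doob transform of the limiting chain.\<close>

definition flux_right :: "int \<Rightarrow> real" where "flux_right k = rate a b F k (k + 1) * hk (k + 1) / hk k"
definition flux_left :: "int \<Rightarrow> real" where "flux_left k = rate a b F k (k - 1) * hk (k - 1) / hk k"

lemma flux_per: "flux_right (k + int u) = flux_right k" "flux_left (k + int u) = flux_left k"
  using rate_shift[of k 1] hk_per[of k] hk_per[of "k + 1"] hk_per[of "k - 1"]
  by (simp_all add: flux_right_def flux_left_def algebra_simps)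

lemma flux_right_pos: "flux_right k > 0" and flux_left_nonneg: "flux_left k \<ge> 0"
  using rate_right_pos[of k] rate_left_nonneg[of k] hk_pos by (simp_all add: flux_right_def flux_left_def less_imp_le)

text \<open>The depth value drops by B > 0 over a period, so two neighbouring depths differ
  somewhere, and there the left jump is blocked.\<close>

lemma flux_left_zero: "\<exists>j. flux_left j = 0"
proof -
  have "\<exists>j. pv (j - 1) \<noteq> pv j"
  proof (rule ccontr)
    assume "\<nexists>j. pv (j - 1) \<noteq> pv j"
    then have "pv (j + 1) = pv j" for j using add_diff_cancel_right' by metis
    then have "pv (int n) = pv 0" for n by (induction n) (auto simp: add.commute, metis add.commute)
    from this[of u] show False using pv_shift[of 0 1] B_pos by simp
  qed
  then obtain j where "HL j \<noteq> \<hh>" using HL_eq_iff by blast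
  then show ?thesis by (auto simp: flux_left_def rate_left)
qed

text \<open>Testing with functions supported on one residue class shows that the tilted current between
  neighbours is asymptotically constant; since one left rate vanishes, the recursion for the
  weights can be started there.\<close>

lemma weights_vanish:
  assumes Dper: "\<And>\<epsilon> k. D \<epsilon> (k + int u) = D \<epsilon> k"
    and D: "\<And>H. (\<And>k. H (k + int u) = H k) \<Longrightarrow>
      ((\<lambda>\<epsilon>. \<Sum>k\<in>{0..<int u}. D \<epsilon> k / hk k * (gen H k - gen hk k / hk k * H k)) \<longlongrightarrow> 0) (at_right 0)"
    and sum0: "((\<lambda>\<epsilon>. \<Sum>k\<in>{0..<int u}. D \<epsilon> k) \<longlongrightarrow> 0) (at_right 0)"
  shows "((\<lambda>\<epsilon>. D \<epsilon> k) \<longlongrightarrow> 0) (at_right 0)"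
proof -
  \<comment> \<open>The net tilted current from k to k + 1 carried by the weights D.\<close>
  define c where "c = (\<lambda>\<epsilon> k. D \<epsilon> k * flux_right k - D \<epsilon> (k + 1) * flux_left (k + 1))"
  have cper: "c \<epsilon> (k + int u) = c \<epsilon> k" for \<epsilon> k
    using Dper[of \<epsilon> k] Dper[of \<epsilon> "k + 1"] flux_per[of k] flux_per[of "k + 1"] by (simp add: c_def algebra_simps)
  \<comment> \<open>Summation by parts on the cycle: for H = hk * f the bracket divided by hk is the
    tilted generator applied to f, and the boundary terms cancel by periodicity.\<close>
  have identity: "(\<Sum>k\<in>{0..<int u}. D \<epsilon> k / hk k * (gen (\<lambda>k. hk k * f k) k - gen hk k / hk k * (hk k * f k)))
      = (\<Sum>k\<in>{0..<int u}. f k * (c \<epsilon> (k - 1) - c \<epsilon> k))" if fper: "\<And>k. f (k + int u) = f k" for f \<epsilon>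
  proof -
    have tm: "D \<epsilon> k / hk k * (gen (\<lambda>k. hk k * f k) k - gen hk k / hk k * (hk k * f k))
        = D \<epsilon> k * flux_right k * (f (k + 1) - f k) - D \<epsilon> k * flux_left k * (f k - f (k - 1))" for k
      using hk_pos[of k] by (simp add: gen_def flux_right_def flux_left_def field_simps)
    let ?x = "\<lambda>k. D \<epsilon> k * flux_left k * (f k - f (k - 1))"
    let ?y = "\<lambda>k. f k * c \<epsilon> (k - 1)"
    have xper: "?x (k + int u) = ?x k" for k
      using Dper[of \<epsilon> k] flux_per[of k] fper[of k] fper[of "k - 1"] by (simp add: algebra_simps)
    have yper: "?y (k + int u) = ?y k" for k
      using cper[of \<epsilon> "k - 1"] fper[of k] by (simp add: algebra_simps)
    have "(\<Sum>k\<in>{0..<int u}. D \<epsilon> k * flux_right k * (f (k + 1) - f k) - ?x k) =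
      (\<Sum>k\<in>{0..<int u}. f k * (c \<epsilon> (k - 1) - c \<epsilon> k) + ((?x (k + 1) - ?x k) + (?y (k + 1) - ?y k)))"
      by (intro sum.cong refl) (simp add: c_def algebra_simps)
    also have "\<dots> = (\<Sum>k\<in>{0..<int u}. f k * (c \<epsilon> (k - 1) - c \<epsilon> k))"
      unfolding sum.distrib periodic_sum_diff[of ?x u, OF xper] periodic_sum_diff[of ?y u, OF yper] by simp
    finally show ?thesis unfolding tm .
  qed
  have step: "((\<lambda>\<epsilon>. c \<epsilon> (i - 1) - c \<epsilon> i) \<longlongrightarrow> 0) (at_right 0)" for i
  proof -
    define f where "f = (\<lambda>k. of_bool (k mod int u = i mod int u) :: real)"
    have fper: "f (k + int u) = f k" for k by (simp add: f_def)
    have "((\<lambda>\<epsilon>. \<Sum>k\<in>{0..<int u}. f k * (c \<epsilon> (k - 1) - c \<epsilon> k)) \<longlongrightarrow> 0) (at_right 0)"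
      using D[of "\<lambda>k. hk k * f k"] fper hk_per unfolding identity[of f, OF fper] by simp
    moreover have "(\<Sum>k\<in>{0..<int u}. f k * (c \<epsilon> (k - 1) - c \<epsilon> k)) = c \<epsilon> (i - 1) - c \<epsilon> i" for \<epsilon>
    proof -
      let ?w = "\<lambda>k. c \<epsilon> (k - 1) - c \<epsilon> k"
      have wper: "?w (k + int u) = ?w k" for k
        using cper[of \<epsilon> k] cper[of \<epsilon> "k - 1"] by (simp add: algebra_simps)
      have "(\<Sum>k\<in>{0..<int u}. f k * ?w k) = (\<Sum>k\<in>{0..<int u}. if k = i mod int u then ?w k else 0)"
        by (intro sum.cong refl) (simp add: f_def)
      also have "\<dots> = ?w (i mod int u)" using u_pos by simp
      also have "\<dots> = ?w i" by (rule periodic_int_mod[of ?w u i, OF wper])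
      finally show ?thesis .
    qed
    ultimately show ?thesis by simp
  qed
  have const: "((\<lambda>\<epsilon>. c \<epsilon> i - c \<epsilon> 0) \<longlongrightarrow> 0) (at_right 0)" for i
  proof (induction i rule: int_induct[where k = 0])
    case (step1 i)
    from tendsto_diff[OF step1(2) step[of "i + 1"]] show ?case by simp
  next
    case (step2 i)
    from tendsto_add[OF step2(2) step[of i]] show ?case by simp
  qed simp
  obtain j where j: "flux_left j = 0" using flux_left_zero by blast
  \<comment> \<open>Starting left of the blocked jump, each weight is asymptotically a positive
    multiple of the common current. As the weights sum to zero in the limit, positivity forces the
    current to vanish, and all weights with it.\<close>
  have "\<exists>q>0. ((\<lambda>\<epsilon>. D \<epsilon> (j - 1 - int n) - c \<epsilon> 0 * q) \<longlongrightarrow> 0) (at_right 0)" for n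
  proof (induction n)
    case 0
    let ?q = "1 / flux_right (j - 1)"
    have "((\<lambda>\<epsilon>. (c \<epsilon> (j - 1) - c \<epsilon> 0) * ?q) \<longlongrightarrow> 0 * ?q) (at_right 0)" by (intro tendsto_intros const)
    moreover have "(c \<epsilon> (j - 1) - c \<epsilon> 0) * ?q = D \<epsilon> (j - 1) - c \<epsilon> 0 * ?q" for \<epsilon>
      using flux_right_pos[of "j - 1"] j by (simp add: c_def field_simps)
    ultimately show ?case using flux_right_pos[of "j - 1"] by (intro exI[of _ ?q]) simp
  next
    case (Suc n)
    then obtain q where q: "q > 0" "((\<lambda>\<epsilon>. D \<epsilon> (j - 1 - int n) - c \<epsilon> 0 * q) \<longlongrightarrow> 0) (at_right 0)" by blast
    define k where "k = j - 1 - int (Suc n)"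
    have k1: "j - 1 - int n = k + 1" by (simp add: k_def)
    let ?q = "(1 + q * flux_left (k + 1)) / flux_right k"
    have fr: "flux_right k > 0" and fl: "flux_left (k + 1) \<ge> 0" by (rule flux_right_pos flux_left_nonneg)+
    have "((\<lambda>\<epsilon>. ((c \<epsilon> k - c \<epsilon> 0) + (D \<epsilon> (k + 1) - c \<epsilon> 0 * q) * flux_left (k + 1)) / flux_right k) \<longlongrightarrow>
        (0 + 0 * flux_left (k + 1)) / flux_right k) (at_right 0)"
      using fr q(2) unfolding k1 by (intro tendsto_intros const) auto
    moreover have "((c \<epsilon> k - c \<epsilon> 0) + (D \<epsilon> (k + 1) - c \<epsilon> 0 * q) * flux_left (k + 1)) / flux_right k
        = D \<epsilon> k - c \<epsilon> 0 * ?q" for \<epsilon>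
      using fr by (simp add: c_def field_simps)
    moreover have "?q > 0" using fr fl q(1) by (simp add: add_pos_nonneg)
    ultimately show ?case unfolding k_def[symmetric] by (intro exI[of _ ?q]) simp
  qed
  then obtain q where q: "\<And>n. q n > 0" "\<And>n. ((\<lambda>\<epsilon>. D \<epsilon> (j - 1 - int n) - c \<epsilon> 0 * q n) \<longlongrightarrow> 0) (at_right 0)" by metis
  have sumD: "(\<Sum>n<u. D \<epsilon> (j - 1 - int n)) = (\<Sum>k\<in>{0..<int u}. D \<epsilon> k)" for \<epsilon>
  proof -
    have "(\<Sum>n<u. D \<epsilon> (j - 1 - int n)) = sum (D \<epsilon>) {j - int u..<j - int u + int u}"
      by (rule sum.reindex_bij_witness[of _ "\<lambda>k. nat (j - 1 - k)" "\<lambda>n. j - 1 - int n"]) auto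
    then show ?thesis using periodic_sum_shift[of "D \<epsilon>" u "j - int u", OF Dper] by simp
  qed
  define qs where "qs = (\<Sum>n<u. q n)"
  have qs: "qs > 0" unfolding qs_def using q(1) u_pos by (intro sum_pos) (auto simp: lessThan_empty_iff)
  have "((\<lambda>\<epsilon>. \<Sum>n<u. D \<epsilon> (j - 1 - int n) - c \<epsilon> 0 * q n) \<longlongrightarrow> 0) (at_right 0)"
    by (intro tendsto_null_sum q)
  then have "((\<lambda>\<epsilon>. (\<Sum>k\<in>{0..<int u}. D \<epsilon> k) - c \<epsilon> 0 * qs) \<longlongrightarrow> 0) (at_right 0)"
    by (simp add: sum_subtractf sumD qs_def sum_distrib_left)
  from tendsto_diff[OF sum0 this] have "((\<lambda>\<epsilon>. c \<epsilon> 0 * qs) \<longlongrightarrow> 0) (at_right 0)" by simp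
  from tendsto_divide[OF this tendsto_const[of qs]] have c0: "((\<lambda>\<epsilon>. c \<epsilon> 0) \<longlongrightarrow> 0) (at_right 0)" using qs by simp
  have Dn: "((\<lambda>\<epsilon>. D \<epsilon> (j - 1 - int n)) \<longlongrightarrow> 0) (at_right 0)" for n
  proof -
    have "((\<lambda>\<epsilon>. (D \<epsilon> (j - 1 - int n) - c \<epsilon> 0 * q n) + c \<epsilon> 0 * q n) \<longlongrightarrow> 0 + 0 * q n) (at_right 0)"
      by (intro tendsto_intros q c0)
    then show ?thesis by simp
  qed
  define n where "n = nat ((j - 1 - k) mod int u)"
  have "j - 1 - int n = k + ((j - 1 - k) div int u) * int u"
  proof -
    have "int n = (j - 1 - k) mod int u" using u_pos by (simp add: n_def)
    then show ?thesis using div_mult_mod_eq[of "j - 1 - k" "int u"] by linarith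
  qed
  then have "D \<epsilon> (j - 1 - int n) = D \<epsilon> k" for \<epsilon>
    using periodic_int_shift[of "D \<epsilon>" u k, OF Dper] by simp
  then show ?thesis using Dn[of n] by simp
qed

text \<open>Both \<open>om\<close> and hk * nn have total mass 1 and are stationary for the tilted
  chain, the latter asymptotically; their difference falls under
  \<open>weights_vanish\<close>.\<close>

lemma weights_limit: "((\<lambda>\<epsilon>. hk k * nn \<epsilon> k) \<longlongrightarrow> om k) (at_right 0)"
proof -
  define D where "D = (\<lambda>\<epsilon> k. hk k * nn \<epsilon> k - om k)"
  have "((\<lambda>\<epsilon>. D \<epsilon> k) \<longlongrightarrow> 0) (at_right 0)"
  proof (rule weights_vanish)
    show "D \<epsilon> (k + int u) = D \<epsilon> k" for \<epsilon> k by (simp add: D_def hk_per nn_per om_per)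
    show "((\<lambda>\<epsilon>. \<Sum>k\<in>{0..<int u}. D \<epsilon> k) \<longlongrightarrow> 0) (at_right 0)"
      using tendsto_diff[OF total_mass tendsto_const[of 1]] by (simp add: D_def sum_subtractf om_sum)
    fix H :: "int \<Rightarrow> real" assume Hper: "\<And>k. H (k + int u) = H k"
    have s: "(\<Sum>k\<in>{0..<int u}. om k / hk k * (gen H k - gen hk k / hk k * H k)) = 0"
      using om_stationary[of H] Hper unfolding hk_def[abs_def] by simp
    have "(\<Sum>k\<in>{0..<int u}. D \<epsilon> k / hk k * (gen H k - gen hk k / hk k * H k)) =
        (\<Sum>k\<in>{0..<int u}. nn \<epsilon> k * (gen H k - gen hk k / hk k * H k))
        - (\<Sum>k\<in>{0..<int u}. om k / hk k * (gen H k - gen hk k / hk k * H k))" for \<epsilon>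
    proof -
      have "D \<epsilon> k / hk k = nn \<epsilon> k - om k / hk k" for k
        using hk_pos[of k] by (simp add: D_def field_simps)
      then show ?thesis by (simp add: sum_subtractf left_diff_distrib)
    qed
    then show "((\<lambda>\<epsilon>. \<Sum>k\<in>{0..<int u}. D \<epsilon> k / hk k * (gen H k - gen hk k / hk k * H k)) \<longlongrightarrow> 0) (at_right 0)"
      using tilted_stationarity[of H, OF Hper] unfolding s by simp
  qed
  then show ?thesis by (simp add: D_def LIM_zero_iff)
qed

text \<open>Subtracting the mean over the well leaves a function with vanishing well means, to which
  \<open>nu_mean_zero\<close> applies. The masses inside one set therefore split in proportion to
  \<open>weight1\<close>.\<close>

lemma nu_near_well:
  assumes f: "torus_cont f" and k: "k \<in> {0..<int u}"
  shows "((\<lambda>\<epsilon>. nu \<epsilon> (\<lambda>x. f x * \<zeta> k x) - well_mean f k * nn \<epsilon> k) \<longlongrightarrow> 0) (at_right 0)"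
proof -
  note zc = zeta_cont[OF k]
  have fz: "torus_cont (\<lambda>x. f x * \<zeta> k x)" by (intro torus_cont_intros f zc)
  have c2: "torus_cont (\<lambda>x. well_mean f k * \<zeta> k x)" by (intro torus_cont_intros zc)
  have "well_mean (\<lambda>x. f x * \<zeta> k x - well_mean f k * \<zeta> k x) j = 0" for j
  proof -
    have "well_mean (\<lambda>x. f x * \<zeta> k x) j = of_bool (j mod int u = k) * well_mean f j"
      unfolding well_mean_def by (cases "j mod int u = k") (simp_all add: zeta_at[OF k])
    moreover have "well_mean (\<zeta> k) j = of_bool (j mod int u = k)"
      by (rule well_mean_const) (simp add: zeta_at[OF k])
    moreover have "well_mean f (j mod int u) = well_mean f j"
    proof (rule periodic_int_mod)
      fix i
      have "f (x + 1) = f x" for x using f by (simp add: torus_cont_def periodic1_def)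
      then show "well_mean f (i + int u) = well_mean f i"
        using wt_shift[of i 1] weight1_shift[of _ 1] unfolding well_mean_def F_shift1
        by (simp add: sum.reindex inj_on_def)
    qed
    ultimately show ?thesis unfolding well_mean_linear by auto
  qed
  then have "((\<lambda>\<epsilon>. nu \<epsilon> (\<lambda>x. f x * \<zeta> k x - well_mean f k * \<zeta> k x)) \<longlongrightarrow> 0) (at_right 0)"
    by (intro nu_mean_zero torus_cont_intros(3) fz c2)
  moreover have "eventually (\<lambda>\<epsilon>. nu \<epsilon> (\<lambda>x. f x * \<zeta> k x - well_mean f k * \<zeta> k x)
      = nu \<epsilon> (\<lambda>x. f x * \<zeta> k x) - well_mean f k * nn \<epsilon> k) (at_right 0)"
    using eventually_good
    by eventually_elim (simp add: nu_linear(2)[OF _ fz c2] nu_linear(3)[OF _ zc zc] nn_eq[OF k])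
  ultimately show ?thesis by (rule Lim_transform_eventually)
qed

text \<open>Write the integral under M \<epsilon> as nu of f * \<phi>, localize it on the wells,
  average over each set and insert the limiting weights; each replacement costs a null term.\<close>

theorem stationary_limit:
  assumes f: "torus_cont f"
  shows "((\<lambda>\<epsilon>. \<integral>x. f x \<partial>M \<epsilon>) \<longlongrightarrow> (\<Sum>k\<in>{0..<int u}. om k * well_mean f k)) (at_right 0)"
proof -
  let ?I = "{0..<int u}"
  obtain C where C: "C > 0" "\<And>\<epsilon> x. \<epsilon> > 0 \<Longrightarrow> \<bar>\<phi> \<epsilon> x\<bar> \<le> C" using phi_bound by blast
  obtain K where K: "K > 0" "\<And>x. \<bar>f x\<bar> \<le> K" using torus_cont_bounded[OF f] by blast
  have zc: "torus_cont (\<lambda>x. \<Sum>k\<in>?I. hk k * \<zeta> k x)" by (rule zeta_comb_cont)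
  obtain K2 where K2: "K2 > 0" "\<And>x. \<bar>\<Sum>k\<in>?I. hk k * \<zeta> k x\<bar> \<le> K2" using torus_cont_bounded[OF zc] by blast
  define e where "e = (\<lambda>\<epsilon> x. f x * \<phi> \<epsilon> x - f x * (\<Sum>k\<in>?I. hk k * \<zeta> k x))"
  have 1: "((\<lambda>\<epsilon>. nu \<epsilon> (e \<epsilon>)) \<longlongrightarrow> 0) (at_right 0)"
  proof (rule nu_concentration)
    show "eventually (\<lambda>\<epsilon>. torus_cont (e \<epsilon>) \<and> (\<forall>x. \<bar>e \<epsilon> x\<bar> \<le> K * C + K * K2)) (at_right 0)"
      using eventually_good
    proof eventually_elim
      case (elim \<epsilon>)
      have "\<bar>e \<epsilon> x\<bar> \<le> K * C + K * K2" for x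
      proof -
        have "\<bar>f x * \<phi> \<epsilon> x\<bar> \<le> K * C" "\<bar>f x * (\<Sum>k\<in>?I. hk k * \<zeta> k x)\<bar> \<le> K * K2"
          unfolding abs_mult using K C(2)[OF goodD(1)[OF elim]] K2 by (auto intro!: mult_mono)
        then show ?thesis unfolding e_def by linarith
      qed
      moreover have "torus_cont (e \<epsilon>)"
        unfolding e_def by (intro torus_cont_intros(3,4) f goodD(5) elim zc)
      ultimately show ?case by blast
    qed
    fix q j assume q: "q \<in> F j"
    have "near_limit e q (f q * hk j - f q * hk j)" unfolding e_def
      by (intro near_limit_intros(3,4) near_limit_continuous f phi_near q zeta_comb_near hk_per)
    then show "near_limit e q 0" by simp
  qed
  have 2: "((\<lambda>\<epsilon>. \<Sum>k\<in>?I. hk k * (nu \<epsilon> (\<lambda>x. f x * \<zeta> k x) - well_mean f k * nn \<epsilon> k)) \<longlongrightarrow> 0) (at_right 0)"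
    by (intro tendsto_null_sum tendsto_mult_right_zero nu_near_well f)
  have 3: "((\<lambda>\<epsilon>. \<Sum>k\<in>?I. well_mean f k * (hk k * nn \<epsilon> k)) \<longlongrightarrow> (\<Sum>k\<in>?I. well_mean f k * om k)) (at_right 0)"
    by (intro tendsto_intros weights_limit)
  have "eventually (\<lambda>\<epsilon>. nu \<epsilon> (e \<epsilon>) + (\<Sum>k\<in>?I. hk k * (nu \<epsilon> (\<lambda>x. f x * \<zeta> k x) - well_mean f k * nn \<epsilon> k))
      + (\<Sum>k\<in>?I. well_mean f k * (hk k * nn \<epsilon> k)) = (\<integral>x. f x \<partial>M \<epsilon>)) (at_right 0)"
    using eventually_good
  proof eventually_elim
    case (elim \<epsilon>)
    have c1: "torus_cont (\<lambda>x. f x * \<phi> \<epsilon> x)" "torus_cont (\<lambda>x. f x * (\<Sum>k\<in>?I. hk k * \<zeta> k x))"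
      by (intro torus_cont_intros(4) f goodD(5) elim zc)+
    have "nu \<epsilon> (\<lambda>x. f x * (\<Sum>k\<in>?I. hk k * \<zeta> k x)) = nu \<epsilon> (\<lambda>x. \<Sum>k\<in>?I. hk k * (f x * \<zeta> k x))"
      by (simp add: sum_distrib_left mult.left_commute)
    also have "\<dots> = (\<Sum>k\<in>?I. hk k * nu \<epsilon> (\<lambda>x. f x * \<zeta> k x))"
      by (rule nu_sum[OF elim]) (intro torus_cont_intros f zeta_cont)
    finally have "nu \<epsilon> (e \<epsilon>) = (\<integral>x. f x \<partial>M \<epsilon>) - (\<Sum>k\<in>?I. hk k * nu \<epsilon> (\<lambda>x. f x * \<zeta> k x))"
      unfolding e_def nu_linear(2)[OF elim c1] nu_phi[OF elim f] by simp
    then show ?case by (simp add: right_diff_distrib sum_subtractf mult.left_commute)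
  qed
  with tendsto_add[OF tendsto_add[OF 1 2] 3] show ?thesis
    by (simp add: Lim_transform_eventually mult.commute)
qed

end

section \<open>Identification of the limit\<close>

lemma sets_torus_borel_space: "space torus_borel = {0..<1}"
  by (simp add: torus_borel_def space_restrict_space)

text \<open>\<open>measure_of\<close> returns the given set function only if it is a measure, so
  countable additivity has to be verified.\<close>

lemma weighted_sum_measure:
  assumes I: "finite I" and \<nu>: "\<And>i. i \<in> I \<Longrightarrow> sets (\<nu> i) = sets torus_borel"
  shows "sets (weighted_sum_measure I w \<nu>) = sets torus_borel"
    "A \<in> sets torus_borel \<Longrightarrow>
      emeasure (weighted_sum_measure I w \<nu>) A = (\<Sum>i\<in>I. ennreal (w i) * emeasure (\<nu> i) A)"
proof -
  let ?\<mu> = "\<lambda>A. \<Sum>i\<in>I. ennreal (w i) * emeasure (\<nu> i) A"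
  have sa: "sigma_algebra (space torus_borel) (sets torus_borel)" by (rule sets.sigma_algebra_axioms)
  show "sets (weighted_sum_measure I w \<nu>) = sets torus_borel"
    unfolding weighted_sum_measure_def by (simp add: sets_measure_of[OF sets.space_closed] sets.sigma_sets_eq)
  assume A: "A \<in> sets torus_borel"
  have ca: "countably_additive (sets torus_borel) ?\<mu>"
  proof (rule countably_additiveI)
    fix X :: "nat \<Rightarrow> real set"
    assume X: "range X \<subseteq> sets torus_borel" "disjoint_family X" "\<Union> (range X) \<in> sets torus_borel"
    have "(\<Sum>n. ?\<mu> (X n)) = (\<Sum>i\<in>I. \<Sum>n. ennreal (w i) * emeasure (\<nu> i) (X n))"
      by (rule suminf_sum) (rule summableI)
    also have "\<dots> = ?\<mu> (\<Union> (range X))"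
    proof (rule sum.cong[OF refl])
      fix i assume "i \<in> I"
      then have "range X \<subseteq> sets (\<nu> i)" using X(1) \<nu> by simp
      from suminf_emeasure[OF this X(2)]
      show "(\<Sum>n. ennreal (w i) * emeasure (\<nu> i) (X n)) = ennreal (w i) * emeasure (\<nu> i) (\<Union> (range X))"
        by simp
    qed
    finally show "(\<Sum>n. ?\<mu> (X n)) = ?\<mu> (\<Union> (range X))" .
  qed
  have "positive (sets torus_borel) ?\<mu>" by (simp add: positive_def)
  from emeasure_measure_of_sigma[OF sa this ca A]
  show "emeasure (weighted_sum_measure I w \<nu>) A = ?\<mu> A" by (simp add: weighted_sum_measure_def)
qed

lemma smooth_torus_cont: "smooth_torus f \<Longrightarrow> torus_cont f"
proof -
  assume f: "smooth_torus f"
  have "f differentiable (at x)" for x using f[unfolded smooth_torus_def, THEN conjunct2, rule_format, of 0 x] by simp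
  then show "torus_cont f"
    using f unfolding torus_cont_def smooth_torus_def
    by (auto intro!: continuous_at_imp_continuous_on differentiable_imp_continuous_within)
qed

lemma torus_cont_frac: "torus_cont f \<Longrightarrow> f (frac x) = f x"
  using periodic1_frac by (auto simp: torus_cont_def)

context nonreversible_family
begin

lemma mixture_integral:
  assumes f: "torus_cont f"
  shows "(\<integral>x. f x \<partial>mixture_measure a b F \<omega>) = (\<Sum>k\<in>{0..<int u}. pmf \<omega> (P k) * well_mean f k)"
proof -
  let ?I = "SIGMA k:{0..<int u}. F k"
  define c where "c = (\<lambda>(k, x). pmf \<omega> (P k) * (weight1 a b x / wt k))"
  define g :: "int \<times> real \<Rightarrow> real" where "g = (\<lambda>(k, x). frac x)"
  have finI: "finite ?I" by auto
  have w0: "0 \<le> weight1 a b x / wt k" if "x \<in> F k" for x k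
    using weight1_pos[of x] F_Mins[of k] well_weight_pos[of k] that by (auto simp: less_imp_le subset_iff)
  have c0: "0 \<le> c i" if iI: "i \<in> ?I" for i
  proof -
    obtain k x where i: "i = (k, x)" "x \<in> F k" using iI by auto
    show ?thesis unfolding c_def i(1) prod.case by (intro mult_nonneg_nonneg pmf_nonneg w0 i(2))
  qed
  have cc: "ennreal (c (k, x)) = ennreal (pmf \<omega> (P k)) * ennreal (weight1 a b x / wt k)" if "x \<in> F k" for k x
    unfolding c_def prod.case by (rule ennreal_mult[OF pmf_nonneg w0[OF that]])
  have gm: "g \<in> measurable (point_measure ?I (\<lambda>i. ennreal (c i))) torus_borel"
    unfolding measurable_point_measure_eq1 by (auto simp: g_def sets_torus_borel_space frac_lt_1)
  have sw: "sets (well_measure a b F k) = sets torus_borel" for k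
    unfolding well_measure_def by (intro weighted_sum_measure) auto
  have ew: "emeasure (well_measure a b F k) A = (\<Sum>x\<in>F k. ennreal (weight1 a b x / wt k) * indicator A (frac x))"
    if A: "A \<in> sets torus_borel" for k A
    unfolding well_measure_def using A by (subst weighted_sum_measure) auto
  have sm: "sets (mixture_measure a b F \<omega>) = sets torus_borel"
    unfolding mixture_measure_def by (intro weighted_sum_measure sw) auto
  have "mixture_measure a b F \<omega> = distr (point_measure ?I (\<lambda>i. ennreal (c i))) torus_borel g"
  proof (rule measure_eqI)
    fix A assume "A \<in> sets (mixture_measure a b F \<omega>)"
    then have A: "A \<in> sets torus_borel" using sm by simp
    have "emeasure (mixture_measure a b F \<omega>) A =
        (\<Sum>k\<in>{0..<int u}. ennreal (pmf \<omega> (P k)) * emeasure (well_measure a b F k) A)"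
      unfolding mixture_measure_def num_classes using A sw by (intro weighted_sum_measure) auto
    also have "\<dots> = (\<Sum>k\<in>{0..<int u}. \<Sum>x\<in>F k. ennreal (c (k, x)) * indicator A (frac x))"
      unfolding ew[OF A] sum_distrib_left
      by (intro sum.cong refl) (simp only: cc mult.assoc)
    also have "\<dots> = (\<Sum>i\<in>?I. ennreal (c i) * indicator A (g i))"
      by (subst sum.Sigma) (auto simp: g_def case_prod_unfold)
    also have "\<dots> = (\<Sum>i\<in>g -` A \<inter> ?I. ennreal (c i))"
      using finI by (intro sum.mono_neutral_cong_right) (auto simp: indicator_def)
    also have "\<dots> = emeasure (distr (point_measure ?I (\<lambda>i. ennreal (c i))) torus_borel g) A"
      using finI A gm by (simp add: emeasure_distr space_point_measure emeasure_point_measure_finite)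
    finally show "emeasure (mixture_measure a b F \<omega>) A = emeasure (distr (point_measure ?I (\<lambda>i. ennreal (c i))) torus_borel g) A" .
  qed (simp add: sm)
  moreover have "f \<in> borel_measurable torus_borel"
    unfolding torus_borel_def using f
    by (intro measurable_restrict_space1 borel_measurable_continuous_onI) (simp add: torus_cont_def)
  ultimately have "(\<integral>x. f x \<partial>mixture_measure a b F \<omega>) = (\<integral>i. f (g i) \<partial>point_measure ?I (\<lambda>i. ennreal (c i)))"
    using gm by (simp add: integral_distr)
  also have "\<dots> = (\<Sum>i\<in>?I. c i * f (g i))"
    using lebesgue_integral_point_measure_finite[where f = c and g = "\<lambda>i. f (g i)", OF finI c0] by (simp add: mult.commute)
  also have "\<dots> = (\<Sum>k\<in>{0..<int u}. \<Sum>x\<in>F k. c (k, x) * f (frac x))"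
    by (subst sum.Sigma) (auto simp: g_def case_prod_unfold)
  also have "\<dots> = (\<Sum>k\<in>{0..<int u}. pmf \<omega> (P k) * well_mean f k)"
    unfolding well_mean_def torus_cont_frac[OF f] sum_divide_distrib sum_distrib_left
    by (intro sum.cong refl) (simp add: c_def)
  finally show ?thesis .
qed

text \<open>First-order condition at the maximizer h: the objective is differentiated along h + t *
  \<psi>, which stays positive for small t. The result is stationarity of \<omega> for the tilted
  chain, tested with H.\<close>

lemma euler_lagrange:
  assumes opt: "dv_optimizer a b F \<omega> h" and Hper: "\<And>k. H (k + int u) = H k"
  shows "(\<Sum>k\<in>{0..<int u}. pmf \<omega> (P k) / h (P k) * (gen H k - gen (\<lambda>k. h (P k)) k / h (P k) * H k)) = 0"
proof -
  \<comment> \<open>Transports H from indices to states. The index chosen for a state is arbitrary,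
    which is harmless because H is periodic.\<close>
  define \<psi> where "\<psi> = (\<lambda>A. H (SOME k. P k = A))"
  have \<psi>: "\<psi> (P k) = H k" for k
  proof -
    have "P (SOME l. P l = P k) = P k" by (rule someI[of _ k]) simp
    then have "(SOME l. P l = P k) mod int u = k mod int u" by (simp add: P_eq_iff)
    then show ?thesis
      using periodic_int_mod[of H u "SOME l. P l = P k", OF Hper] periodic_int_mod[of H u k, OF Hper]
      by (simp add: \<psi>_def)
  qed
  have hpos: "h (P k) > 0" for k using opt by (simp add: dv_optimizer_def proj_states_eq)
  have max: "dv_objective a b F \<omega> H' \<le> dv_objective a b F \<omega> h" if "\<And>k. H' (P k) > 0" for H'
  proof -
    have "ereal (dv_objective a b F \<omega> H') \<le> dv_rate a b F \<omega>"
      unfolding dv_rate_def using that by (intro SUP_upper) (auto simp: proj_states_eq)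
    then show ?thesis using opt by (simp add: dv_optimizer_def)
  qed
  let ?hk = "\<lambda>k. h (P k)"
  define obj where "obj = (\<lambda>t. - (\<Sum>k\<in>{0..<int u}. (gen ?hk k + t * gen H k) / (?hk k + t * H k) * pmf \<omega> (P k)))"
  have obj: "dv_objective a b F \<omega> (\<lambda>A. h A + t * \<psi> A) = obj t" for t
  proof -
    have "gen (\<lambda>k. ?hk k + t * H k) k = gen ?hk k + t * gen H k" for k by (simp add: gen_def algebra_simps)
    then show ?thesis by (simp add: dv_objective_def num_classes proj_gen_eq \<psi> obj_def)
  qed
  have "eventually (\<lambda>t. \<forall>k\<in>{0..<int u}. ?hk k + t * H k > 0) (nhds (0::real))"
  proof (intro eventually_ball_finite ballI)
    fix k
    have "((\<lambda>t. ?hk k + t * H k) \<longlongrightarrow> ?hk k + 0 * H k) (nhds (0::real))" by (intro tendsto_intros filterlim_ident)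
    then show "eventually (\<lambda>t. ?hk k + t * H k > 0) (nhds (0::real))"
      using hpos[of k] by (intro order_tendstoD) auto
  qed simp
  then obtain d where d: "d > 0" "\<And>t. dist t 0 < d \<Longrightarrow> \<forall>k\<in>{0..<int u}. ?hk k + t * H k > 0"
    unfolding eventually_nhds_metric by blast
  have le: "obj t \<le> obj 0" if "\<bar>0 - t\<bar> < d" for t
  proof -
    have "h (P k) + t * \<psi> (P k) > 0" for k
    proof -
      have "k mod int u \<in> {0..<int u}" using u_pos by simp
      then have "?hk (k mod int u) + t * H (k mod int u) > 0" using d(2)[of t] that by (simp add: dist_real_def)
      moreover have "P (k mod int u) = P k" by (simp add: P_eq_iff)
      ultimately show ?thesis using periodic_int_mod[of H u k, OF Hper] by (simp add: \<psi>)
    qed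
    then have "dv_objective a b F \<omega> (\<lambda>A. h A + t * \<psi> A) \<le> dv_objective a b F \<omega> h" by (rule max)
    then show ?thesis using obj[of t] obj[of 0] by simp
  qed
  have "(obj has_real_derivative - (\<Sum>k\<in>{0..<int u}. (gen H k * ?hk k - gen ?hk k * H k) / (?hk k * ?hk k) * pmf \<omega> (P k))) (at 0)"
    unfolding obj_def
  proof (intro DERIV_minus DERIV_sum)
    fix k
    have "((\<lambda>t. (gen ?hk k + t * gen H k) / (?hk k + t * H k)) has_real_derivative
        ((gen H k) * (?hk k + 0 * H k) - (gen ?hk k + 0 * gen H k) * H k) / ((?hk k + 0 * H k) * (?hk k + 0 * H k))) (at 0)"
      using hpos[of k] by (intro DERIV_divide) (auto intro!: derivative_eq_intros)
    from DERIV_cmult_right[OF this, of "pmf \<omega> (P k)"]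
    show "((\<lambda>t. (gen ?hk k + t * gen H k) / (?hk k + t * H k) * pmf \<omega> (P k)) has_real_derivative
        (gen H k * ?hk k - gen ?hk k * H k) / (?hk k * ?hk k) * pmf \<omega> (P k)) (at 0)" by simp
  qed
  from DERIV_local_max[OF this d(1)] le
  have "(\<Sum>k\<in>{0..<int u}. (gen H k * ?hk k - gen ?hk k * H k) / (?hk k * ?hk k) * pmf \<omega> (P k)) = 0" by simp
  moreover have "(gen H k * ?hk k - gen ?hk k * H k) / (?hk k * ?hk k) * pmf \<omega> (P k) =
      pmf \<omega> (P k) / h (P k) * (gen H k - gen ?hk k / h (P k) * H k)" for k
    using hpos[of k] by (simp add: field_simps)
  ultimately show ?thesis by simp
qed

lemma frac_in_well: "q \<in> F k \<Longrightarrow> 0 < r \<Longrightarrow> frac q \<in> well_union a b F r k"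
  unfolding well_union_def local_well_def proj_set_def
  by (intro UN_I[of "frac q"] imageI image_eqI[of _ _ "frac q"]) (auto simp: frac_frac)

text \<open>Inside a well of height r one cannot pass from one minimum of S to another, since
  leaving a minimum in either direction means climbing at least the lowest barrier of level one. So
  a minimum found in a well is its centre.\<close>

lemma well_separation:
  assumes q: "q \<in> F j" and in_well: "frac q \<in> well_union a b F r k" and r: "r < lowest_barrier a b (level a b m 1)"
  shows "j mod int u = k mod int u"
proof -
  obtain q' y where q': "q' \<in> F k" "frac y = frac q"
    "connected_component {z. S z < S (frac q') + r} (frac q') y"
    using in_well by (auto simp: well_union_def local_well_def proj_set_def)
  define x where "x = frac q'"
  have xM: "x \<in> Mins" using q'(1) F_Mins Mins_shift[of q' "- \<lfloor>q'\<rfloor>"] by (auto simp: x_def frac_def)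
  have qM: "q \<in> Mins" using q F_Mins by blast
  have "y = q + of_int (\<lfloor>y\<rfloor> - \<lfloor>q\<rfloor>)" using q'(2) by (simp add: frac_def algebra_simps)
  then have yM: "y \<in> Mins" using qM Mins_shift[of q "\<lfloor>y\<rfloor> - \<lfloor>q\<rfloor>"] by simp
  obtain T where T: "connected T" "T \<subseteq> {z. S z < S x + r}" "x \<in> T" "y \<in> T"
    using q'(3) by (auto simp: connected_component_def x_def)
  \<comment> \<open>A connected set contains the whole segment between x and y, so S stays below S x
    + r along it, saddles included.\<close>
  have low: "S z < S x + r" if "z \<in> {min x y..max x y}" for z
  proof -
    have "z \<in> T" using connectedD_interval[OF T(1), of "min x y" "max x y" z] T(3,4) that
      by (auto simp: min_def max_def split: if_splits)
    then show ?thesis using T(2) by blast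
  qed
  obtain i where i: "x = m i" using xM range_m by blast
  obtain l where l: "y = m l" using yM range_m by blast
  interpret L: metastable_family a b N m \<sigma> "\<lambda>k. {m k}" N by (rule level_one_family)
  have rL: "r < L.\<hh>" using r by simp
  have "i = l"
  proof (rule ccontr)
    assume "i \<noteq> l"
    then consider "i < l" | "l < i" by linarith
    then show False
    proof cases
      case 1
      obtain z where z: "z \<in> gap (\<lambda>k. {m k}) i" "L.sad i = S z" using L.saddle_ex by blast
      have "m (i + 1) \<le> m l" using L.F_less[of "i + 1" l "m (i+1)" "m l"] 1 by (cases "i + 1 = l") auto
      then have "S z < S x + r" using z(1) i l by (intro low) (auto simp: gap_def)
      moreover have "L.\<hh> \<le> L.sad i - S x" using L.hh_le(1)[of i] i by (simp add: height_right_def pot_value_def)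
      ultimately show False using z(2) rL by linarith
    next
      case 2
      obtain z where z: "z \<in> gap (\<lambda>k. {m k}) (i - 1)" "L.sad (i - 1) = S z" using L.saddle_ex by blast
      have "m l \<le> m (i - 1)" using L.F_less[of l "i - 1" "m l" "m (i-1)"] 2 by (cases "l = i - 1") auto
      then have "S z < S x + r" using z(1) i l by (intro low) (auto simp: gap_def)
      moreover have "L.\<hh> \<le> L.sad (i - 1) - S x" using L.hh_le(2)[of i] i by (simp add: height_left_def pot_value_def)
      ultimately show False using z(2) rL by linarith
    qed
  qed
  then have "y = x" using i l by simp
  moreover have "frac x = x" by (simp add: x_def frac_frac)
  ultimately have "frac q' = frac q" using q'(2) by (simp add: x_def)
  then show ?thesis using same_frac_index[OF q q'(1)] by simp
qed

end

theorem proposition9p3: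
  fixes a b :: "real \<Rightarrow> real" and N :: nat and m \<sigma> :: "int \<Rightarrow> real"
    and F :: "int \<Rightarrow> real set"
    and r_hat r0 r lam :: real
    and \<zeta> :: "int \<Rightarrow> real \<Rightarrow> real"
    and \<omega> :: "real set pmf" and h :: "real set \<Rightarrow> real"
    and \<phi> :: "real \<Rightarrow> real \<Rightarrow> real" and M :: "real \<Rightarrow> real measure"
  assumes coefficients: "admissible_coefficients a b N"
    and labelling: "critical_labelling b N m \<sigma>"
    and F: "F = level a b m (final_level a b m)"
    and NonRev: "0 < drift_integral a b"
      "\<forall>k. 0 < rate a b F k (k + 1)"
      "\<exists>j. rate a b F j (j - 1) = 0"
    and r_hat: "0 < r_hat" "\<forall>k\<in>{0..<int N}. ball (m k) r_hat \<subset> {0<..<1}"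
    and r0: "0 < r0" "r0 < min (lowest_barrier a b (level a b m 1)) r_hat / 2"
    and r: "2 * r0 < r" "r < min (lowest_barrier a b (level a b m 1)) r_hat"
    and \<zeta>: "\<forall>k\<in>{0..<int (num_classes F)}. smooth_torus (\<zeta> k) \<and>
      (\<forall>x\<in>{0..<1}. indicator (well_union a b F r0 k) x \<le> \<zeta> k x \<and>
                   \<zeta> k x \<le> indicator (well_union a b F r k) x)"
    and \<omega>: "set_pmf \<omega> = proj_states F"
    and h: "dv_optimizer a b F \<omega> h"
    and lam: "0 < lam"
    and \<phi>: "\<forall>\<epsilon>>0. resolvent_solution a b F \<zeta> h lam \<epsilon> (\<phi> \<epsilon>)"
    and M: "\<forall>\<epsilon>>0. (\<forall>x. 0 < \<phi> \<epsilon> x) \<longrightarrow> stationary_state (tilted_gen a b \<epsilon> (\<phi> \<epsilon>)) (M \<epsilon>)"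
  shows "weak_conv_torus M (mixture_measure a b F \<omega>) (at_right 0)"
proof -
  interpret L: landscape a b N m \<sigma> by unfold_locales (rule coefficients, rule labelling)
  obtain u where "metastable_family a b N m \<sigma> F u" using L.final_level_family F by blast
  then interpret F: metastable_family a b N m \<sigma> F u .
  interpret F: nonreversible_family a b N m \<sigma> F u
  proof
    show "0 < drift_integral a b" by (rule NonRev)
    \<comment> \<open>A right rate is positive exactly when the right barrier has the lowest
      height.\<close>
    show "F.HR k = F.\<hh>" for k using NonRev(2) F.rate_pos_iff[of k "k + 1"] by auto
  qed
  have \<zeta>': "smooth_torus (\<zeta> k)"
    "x \<in> {0..<1} \<Longrightarrow> indicator (well_union a b F r0 k) x \<le> \<zeta> k x"
    "x \<in> {0..<1} \<Longrightarrow> \<zeta> k x \<le> indicator (well_union a b F r k) x"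
    if "k \<in> {0..<int u}" for k x
    using \<zeta> that unfolding F.num_classes by auto
  interpret T: tilted_family a b N m \<sigma> F u lam \<zeta> h "\<lambda>k. pmf \<omega> (F.P k)" \<phi> M
  proof
    fix k q j assume k: "k \<in> {0..<int u}"
    show zc: "torus_cont (\<zeta> k)" by (rule smooth_torus_cont[OF \<zeta>'(1)[OF k]])
    assume q: "q \<in> F j"
    have fq: "frac q \<in> {0..<1}" by (simp add: frac_lt_1)
    have P: "well_union a b F s (k' mod int u) = well_union a b F s k'" for s k'
      unfolding well_union_def using F.P_eq_iff[of "k' mod int u" k'] by simp
    \<comment> \<open>The sandwich between the two indicators pins the cutoff down at the minima:
      inside its own inner well it is 1, and separation of the outer wells makes it 0 at the minima
      of other sets.\<close>
    have "\<zeta> k (frac q) = of_bool (j mod int u = k)"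
    proof (cases "j mod int u = k")
      case True
      then have "frac q \<in> well_union a b F r0 k" using F.frac_in_well[OF q r0(1)] P by metis
      then have "1 \<le> \<zeta> k (frac q)" using \<zeta>'(2)[OF k fq] by simp
      moreover have "\<zeta> k (frac q) \<le> 1" using \<zeta>'(3)[OF k fq] by (rule order_trans) (simp add: indicator_def)
      ultimately show ?thesis using True by simp
    next
      case False
      have "frac q \<notin> well_union a b F r k"
      proof
        assume "frac q \<in> well_union a b F r k"
        then have "j mod int u = k mod int u" using r(2) by (intro F.well_separation[OF q]) auto
        then show False using False k by simp
      qed
      then have "\<zeta> k (frac q) \<le> 0" using \<zeta>'(3)[OF k fq] by simp
      moreover have "0 \<le> \<zeta> k (frac q)" using \<zeta>'(2)[OF k fq] by (rule order_trans[rotated]) (simp add: indicator_def)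
      ultimately show ?thesis using False by simp
    qed
    then show "\<zeta> k q = of_bool (j mod int u = k)" unfolding torus_cont_frac[OF zc] .
  next
    show "0 < h (F.P k)" for k using h by (simp add: dv_optimizer_def F.proj_states_eq)
    show "0 < lam" by (rule lam)
    show "pmf \<omega> (F.P (k + int u)) = pmf \<omega> (F.P k)" for k using F.P_shift[of k 1] by simp
    \<comment> \<open>Over one period every projected state is counted exactly once, and these
      states are the support of \<omega>.\<close>
    have "(\<Sum>k\<in>{0..<int u}. pmf \<omega> (F.P k)) = sum (pmf \<omega>) (proj_states F)"
      unfolding proj_states_def F.num_classes by (simp add: sum.reindex[OF F.inj_on_P])
    also have "\<dots> = 1" using \<omega> by (intro sum_pmf_eq_1) (simp_all add: proj_states_def)
    finally show "(\<Sum>k\<in>{0..<int u}. pmf \<omega> (F.P k)) = 1" .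
    show "(\<Sum>k\<in>{0..<int u}. pmf \<omega> (F.P k) / h (F.P k) *
        (F.gen H k - F.gen (\<lambda>k. h (F.P k)) k / h (F.P k) * H k)) = 0"
      if "\<And>k. H (k + int u) = H k" for H using F.euler_lagrange[where H = H, OF h that] .
  qed (use \<phi> M in auto)
  show ?thesis
    unfolding weak_conv_torus_def
  proof (intro allI impI)
    fix f assume "periodic1 f \<and> continuous_on UNIV f"
    then have f: "torus_cont f" by (simp add: torus_cont_def)
    show "((\<lambda>\<epsilon>. \<integral>x. f x \<partial>M \<epsilon>) \<longlongrightarrow> (\<integral>x. f x \<partial>mixture_measure a b F \<omega>)) (at_right 0)"
      unfolding F.mixture_integral[OF f] by (rule T.stationary_limit[OF f])
  qed
qed

end
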